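(* Let $d\ge1$, let $\omega$ be a weight function, let $\varphi_0(x)=e^{-|x|^2}$ on $\mathbb{R}^d$, and let $\alpha_0,\beta_0>0$ be such that $\{\Pi(\sigma)\varphi_0\}_{\sigma\in\Lambda}$, $\Lambda=\alpha_0\mathbb{Z}^d\times\beta_0\mathbb{Z}^d$, is a Gabor frame for $L^2(\mathbb{R}^d)$. Then the analysis operator $$C_{\varphi_0}:\ \mathcal{S}_\omega(\mathbb{R}^d)\longrightarrow \operatorname{Im}C_{\varphi_0}\subseteq\tilde\Lambda_\omega,\qquad C_{\varphi_0}f=(\langle f,\Pi(\sigma)\varphi_0\rangle)_{\sigma\in\Lambda},$$ is a topological isomorphism of $\mathcal{S}_\omega(\mathbb{R}^d)$ onto its image, where the image carries the topology induced by $\tilde\Lambda_\omega$. In particular, $\mathcal{S}_\omega(\mathbb{R}^d)$ is isomorphic to a topological subspace of $\tilde\Lambda_\omega$.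
   Context: A weight function is a continuous increasing function $\omega:[0,+\infty)\to[0,+\infty)$ such that: $(\alpha)$ there is $L\ge 1$ with $\omega(2t)\le L(\omega(t)+1)$ for all $t\ge 0$; $(\beta)$ $\omega(t)=o(t)$ as $t\to+\infty$; $(\gamma)$ there are $a\in\mathbb{R}$, $b>0$ with $\omega(t)\ge a+b\log(1+t)$ for all $t\ge 0$; $(\delta)$ the map $t\mapsto\omega(e^t)$ is convex. For a vector $\zeta$ one writes $\omega(\zeta):=\omega(|\zeta|)$, with $|\cdot|$ the Euclidean norm. The Fourier transform is $\hat u(\xi)=\int_{\mathbb{R}^d}u(x)e^{-i\langle x,\xi\rangle}dx$. The space $\mathcal{S}_\omega(\mathbb{R}^d)$ is the set of all $u\in L^1(\mathbb{R}^d)$ such that $u,\hat u\in C^\infty(\mathbb{R}^d)$ and, for each $\lambda>0$ and each $\alpha\in\mathbb{N}_0^d$, $\sup_{x}e^{\lambda\omega(x)}|\partial^\alpha u(x)|<+\infty$ and $\sup_{\xi}e^{\lambda\omega(\xi)}|\partial^\alpha\hat u(\xi)|<+\infty$. It carries the Fréchet topology given by these seminorms. For $z=(x,\xi)\in\mathbb{R}^{2d}$, $\Pi(z)f(y)=e^{i\langle y,\xi\rangle}f(y-x)$. The bracket is $\langle f,g\rangle=\int_{\mathbb{R}^d}f\overline{g}$. $\tilde\Lambda_\omega$ is the Fréchet space of all complex families $c=(c_\sigma)_{\sigma\in\Lambda}$ such that $\|c\|_k:=\sup_{\sigma\in\Lambda}|c_\sigma|e^{k\omega(\sigma)}<+\infty$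 for all $k\in\mathbb{N}$, with the topology given by the norms $\|\cdot\|_k$. *)

theory Defs
  imports "HOL-Analysis.Analysis" "HOL-Library.Landau_Symbols"
begin

definition weight_function :: "(real \<Rightarrow> real) \<Rightarrow> bool" where
  "weight_function \<omega> \<longleftrightarrow>
     (\<forall>t\<ge>0. \<omega> t \<ge> 0) \<and> continuous_on {0..} \<omega> \<and> mono_on {0..} \<omega> \<and>
     (\<exists>L\<ge>1. \<forall>t\<ge>0. \<omega> (2 * t) \<le> L * (\<omega> t + 1)) \<and>
     \<omega> \<in> o[at_top](\<lambda>t. t) \<and>
     (\<exists>a b. b > 0 \<and> (\<forall>t\<ge>0. \<omega> t \<ge> a + b * ln (1 + t))) \<and>
     convex_on UNIV (\<lambda>t. \<omega> (exp t))"

definition partial_deriv :: "'d::finite \<Rightarrow> (real^'d \<Rightarrow> complex) \<Rightarrow> real^'d \<Rightarrow> complex" where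
  "partial_deriv i u x = vector_derivative (\<lambda>t. u (x + t *\<^sub>R axis i 1)) (at 0)"

definition C_infinity :: "(real^'d::finite \<Rightarrow> complex) \<Rightarrow> bool" where
  "C_infinity u \<longleftrightarrow>
     (\<forall>is. continuous_on UNIV (foldr partial_deriv is u) \<and>
        (\<forall>i x. (\<lambda>t. foldr partial_deriv is u (x + t *\<^sub>R axis i 1)) differentiable (at 0)))"

(* The coordinates are processed in a fixed but arbitrary order; for smooth u the result does
   not depend on it. *)
definition multi_deriv :: "('d::finite \<Rightarrow> nat) \<Rightarrow> (real^'d \<Rightarrow> complex) \<Rightarrow> real^'d \<Rightarrow> complex" where
  "multi_deriv \<alpha> u =
     foldr (\<lambda>i. partial_deriv i ^^ \<alpha> i) (SOME is. distinct is \<and> set is = UNIV) u"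

definition fourier :: "(real^'d::finite \<Rightarrow> complex) \<Rightarrow> real^'d \<Rightarrow> complex" where
  "fourier u \<xi> = (LINT x|lborel. u x * exp (- (\<i> * complex_of_real (x \<bullet> \<xi>))))"

definition S_omega :: "(real \<Rightarrow> real) \<Rightarrow> (real^'d::finite \<Rightarrow> complex) set" where
  "S_omega \<omega> = {u. integrable lborel u \<and> C_infinity u \<and> C_infinity (fourier u) \<and>
     (\<forall>\<mu>>0. \<forall>\<alpha>.
        bdd_above (range (\<lambda>x. exp (\<mu> * \<omega> (norm x)) * cmod (multi_deriv \<alpha> u x))) \<and>
        bdd_above (range (\<lambda>\<xi>. exp (\<mu> * \<omega> (norm \<xi>)) * cmod (multi_deriv \<alpha> (fourier u) \<xi>))))}"

definition S_seminorm ::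
  "(real \<Rightarrow> real) \<Rightarrow> real \<Rightarrow> ('d::finite \<Rightarrow> nat) \<Rightarrow> (real^'d \<Rightarrow> complex) \<Rightarrow> real" where
  "S_seminorm \<omega> \<mu> \<alpha> u = (SUP x. exp (\<mu> * \<omega> (norm x)) * cmod (multi_deriv \<alpha> u x))"

definition S_seminorms :: "(real \<Rightarrow> real) \<Rightarrow> ((real^'d::finite \<Rightarrow> complex) \<Rightarrow> real) set" where
  "S_seminorms \<omega> =
     {S_seminorm \<omega> \<mu> \<alpha> | \<mu> \<alpha>. \<mu> > 0} \<union> {\<lambda>u. S_seminorm \<omega> \<mu> \<alpha> (fourier u) | \<mu> \<alpha>. \<mu> > 0}"

definition seminorm_topology ::
  "('a \<Rightarrow> complex) set \<Rightarrow> (('a \<Rightarrow> complex) \<Rightarrow> real) set \<Rightarrow> ('a \<Rightarrow> complex) topology" where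
  "seminorm_topology V P = topology_generated_by
     {{g \<in> V. p (\<lambda>x. g x - f x) < \<epsilon>} | p f \<epsilon>. p \<in> P \<and> f \<in> V \<and> \<epsilon> > 0}"

lemma topspace_seminorm_topology:
  assumes "P \<noteq> {}"
  shows "topspace (seminorm_topology V P) = V"
proof
  show "topspace (seminorm_topology V P) \<subseteq> V"
    unfolding seminorm_topology_def topology_generated_by_topspace by blast
  show "V \<subseteq> topspace (seminorm_topology V P)"
  proof
    fix f assume f: "f \<in> V"
    obtain p where p: "p \<in> P" using assms by blast
    have "f \<in> {g \<in> V. p (\<lambda>x. g x - f x) < \<bar>p (\<lambda>x. f x - f x)\<bar> + 1}" using f by simp
    moreover have "\<bar>p (\<lambda>x. f x - f x)\<bar> + 1 > 0" by simp
    ultimately show "f \<in> topspace (seminorm_topology V P)"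
      unfolding seminorm_topology_def topology_generated_by_topspace using p f by blast
  qed
qed

definition S_topology :: "(real \<Rightarrow> real) \<Rightarrow> (real^'d::finite \<Rightarrow> complex) topology" where
  "S_topology \<omega> = seminorm_topology (S_omega \<omega>) (S_seminorms \<omega>)"

lemma topspace_S_topology: "topspace (S_topology \<omega>) = S_omega \<omega>"
proof -
  have "S_seminorm \<omega> 1 (\<lambda>_. 0) \<in> S_seminorms \<omega>"
    unfolding S_seminorms_def using zero_less_one by blast
  then show ?thesis
    unfolding S_topology_def by (intro topspace_seminorm_topology) blast
qed

definition time_freq_shift ::
  "(real^'d::finite) \<times> (real^'d) \<Rightarrow> (real^'d \<Rightarrow> complex) \<Rightarrow> real^'d \<Rightarrow> complex" where
  "time_freq_shift z f y = exp (\<i> * complex_of_real (y \<bullet> snd z)) * f (y - fst z)"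

definition bracket :: "(real^'d::finite \<Rightarrow> complex) \<Rightarrow> (real^'d \<Rightarrow> complex) \<Rightarrow> complex" where
  "bracket f g = (LINT x|lborel. f x * cnj (g x))"

definition gabor_lattice :: "real \<Rightarrow> real \<Rightarrow> ((real^'d::finite) \<times> (real^'d)) set" where
  "gabor_lattice a b =
     {(a *\<^sub>R m, b *\<^sub>R n) | m n. (\<forall>i. m $ i \<in> \<int>) \<and> (\<forall>i. n $ i \<in> \<int>)}"

definition gabor_frame ::
  "(real^'d::finite \<Rightarrow> complex) \<Rightarrow> ((real^'d) \<times> (real^'d)) set \<Rightarrow> bool" where
  "gabor_frame \<phi> \<Lambda> \<longleftrightarrow>
     (\<exists>A>0. \<exists>B>0. \<forall>f. f \<in> borel_measurable lborel \<and> integrable lborel (\<lambda>x. (cmod (f x))\<^sup>2) \<longrightarrow>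
        (\<lambda>\<sigma>. (cmod (bracket f (time_freq_shift \<sigma> \<phi>)))\<^sup>2) summable_on \<Lambda> \<and>
        A * (LINT x|lborel. (cmod (f x))\<^sup>2)
          \<le> (\<Sum>\<^sub>\<infinity>\<sigma>\<in>\<Lambda>. (cmod (bracket f (time_freq_shift \<sigma> \<phi>)))\<^sup>2) \<and>
        (\<Sum>\<^sub>\<infinity>\<sigma>\<in>\<Lambda>. (cmod (bracket f (time_freq_shift \<sigma> \<phi>)))\<^sup>2)
          \<le> B * (LINT x|lborel. (cmod (f x))\<^sup>2))"

(* A family indexed by \<Lambda> is encoded as a function on the whole phase space vanishing off \<Lambda>, so
   that pointwise operations are those of the families. The norm of a pair is the Euclidean norm
   of the concatenated vector. *)
definition Lambda_omega ::
  "(real \<Rightarrow> real) \<Rightarrow> ((real^'d::finite) \<times> (real^'d)) set \<Rightarrow> ((real^'d) \<times> (real^'d) \<Rightarrow> complex) set" where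
  "Lambda_omega \<omega> \<Lambda> = {c. (\<forall>\<sigma>. \<sigma> \<notin> \<Lambda> \<longrightarrow> c \<sigma> = 0) \<and>
     (\<forall>k::nat. bdd_above ((\<lambda>\<sigma>. cmod (c \<sigma>) * exp (real k * \<omega> (norm \<sigma>))) ` \<Lambda>))}"

definition Lambda_norm ::
  "(real \<Rightarrow> real) \<Rightarrow> ((real^'d::finite) \<times> (real^'d)) set \<Rightarrow> nat
     \<Rightarrow> ((real^'d) \<times> (real^'d) \<Rightarrow> complex) \<Rightarrow> real" where
  "Lambda_norm \<omega> \<Lambda> k c = (SUP \<sigma>\<in>\<Lambda>. cmod (c \<sigma>) * exp (real k * \<omega> (norm \<sigma>)))"

definition Lambda_topology ::
  "(real \<Rightarrow> real) \<Rightarrow> ((real^'d::finite) \<times> (real^'d)) set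
     \<Rightarrow> ((real^'d) \<times> (real^'d) \<Rightarrow> complex) topology" where
  "Lambda_topology \<omega> \<Lambda> = seminorm_topology (Lambda_omega \<omega> \<Lambda>) (range (Lambda_norm \<omega> \<Lambda>))"

lemma topspace_Lambda_topology: "topspace (Lambda_topology \<omega> \<Lambda>) = Lambda_omega \<omega> \<Lambda>"
  unfolding Lambda_topology_def by (intro topspace_seminorm_topology) blast

definition analysis_operator ::
  "(real^'d::finite \<Rightarrow> complex) \<Rightarrow> ((real^'d) \<times> (real^'d)) set
     \<Rightarrow> (real^'d \<Rightarrow> complex) \<Rightarrow> (real^'d) \<times> (real^'d) \<Rightarrow> complex" where
  "analysis_operator \<phi> \<Lambda> f \<sigma> = (if \<sigma> \<in> \<Lambda> then bracket f (time_freq_shift \<sigma> \<phi>) else 0)"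

definition gaussian :: "real^'d::finite \<Rightarrow> complex" where
  "gaussian x = complex_of_real (exp (- (norm x)\<^sup>2))"

definition complex_subspace :: "('a \<Rightarrow> complex) set \<Rightarrow> bool" where
  "complex_subspace V \<longleftrightarrow> (\<lambda>_. 0) \<in> V \<and>
     (\<forall>f\<in>V. \<forall>g\<in>V. (\<lambda>x. f x + g x) \<in> V) \<and> (\<forall>a. \<forall>f\<in>V. (\<lambda>x. a * f x) \<in> V)"

definition complex_linear_on ::
  "('a \<Rightarrow> complex) set \<Rightarrow> (('a \<Rightarrow> complex) \<Rightarrow> 'b \<Rightarrow> complex) \<Rightarrow> bool" where
  "complex_linear_on V T \<longleftrightarrow>
     (\<forall>f\<in>V. \<forall>g\<in>V. T (\<lambda>x. f x + g x) = (\<lambda>y. T f y + T g y)) \<and>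
     (\<forall>a. \<forall>f\<in>V. T (\<lambda>x. a * f x) = (\<lambda>y. a * T f y))"

definition topological_isomorphism ::
  "('a \<Rightarrow> complex) topology \<Rightarrow> ('b \<Rightarrow> complex) topology
     \<Rightarrow> (('a \<Rightarrow> complex) \<Rightarrow> 'b \<Rightarrow> complex) \<Rightarrow> bool" where
  "topological_isomorphism X Y T \<longleftrightarrow>
     complex_subspace (topspace X) \<and> complex_subspace (topspace Y) \<and>
     complex_linear_on (topspace X) T \<and> homeomorphic_map X Y T"

end

theory Submission
  imports Defs "HOL-Probability.Characteristic_Functions" "HOL-Probability.Sinc_Integral"
begin

text \<open>Continuity of the analysis operator is elementary: its coefficients are samples of the short-time
Fourier transform with Gaussian window, which inherits the decay of \<open>f\<close> in time and, by the multiplication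
formula, the decay of the Fourier transform of \<open>f\<close> in frequency (\<open>stft_decay\<close>). The substance is the reverse
inequality: every seminorm of \<open>f\<close> is bounded by a weighted supremum of the samples over the lattice.

The frame hypothesis is an unweighted inequality between square norms. It is upgraded to a weighted
one by localisation, without a dual window. A weight \<open>exp (\<nu> \<omega>(|z|))\<close> is equivalent, up to a change of \<open>\<nu>\<close>, to a
weight \<open>m\<close> whose logarithm is Lipschitz with a constant \<open>\<epsilon>\<close> as small as desired, because \<open>\<omega>(t) = o(t)\<close>
(\<open>slowly_varying_weight\<close>). Let \<open>F\<close> be the short-time Fourier transform of \<open>f\<close> and let \<open>g\<close> be the superposition
of time-frequency shifted Gaussians with coefficients \<open>m F\<close>. The reproducing kernel decays like a Gaussian and \<open>m\<close> hardly
varies at the scale of that kernel, so the transform of \<open>g\<close> is a constant multiple of \<open>m F\<close> up to an error of relative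
size \<open>\<epsilon>\<close>, both in the square norm over phase space and in the square norm over the lattice
(\<open>weighted_localization\<close>, \<open>Schur_bounds\<close>). The lower frame bound for \<open>g\<close> thus bounds the square norm of \<open>m F\<close>
by that of its samples plus \<open>O(\<epsilon>)\<close> times itself. For \<open>f\<close> in the space this norm is finite and the error can be absorbed,
which bounds weighted integrals of \<open>F\<close> by the sampled norms (\<open>weighted_stft_bound\<close>).

Finally \<open>f\<close> and its Fourier transform are superpositions of Gaussians with coefficients \<open>F\<close>
(\<open>stft_inversion\<close>). Differentiating under the integral sign bounds all seminorms of \<open>f\<close> by weighted integrals of \<open>F\<close>
(\<open>S_seminorm_le_stft\<close>, \<open>S_seminorm_fourier_le_stft\<close>), and a general criterion for seminorm topologies turns
the two families of inequalities into a homeomorphism onto the image.\<close>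

section \<open>Gaussian integrals and sums over separated sets\<close>

lemmas integrable_dominated = Bochner_Integration.integrable_bound
  and norm_integral_le = Bochner_Integration.integral_norm_bound_integral

lemma prod_Basis_lborel:
  fixes f :: "'a::euclidean_space \<Rightarrow> real \<Rightarrow> complex"
  assumes I: "\<And>b. b \<in> Basis \<Longrightarrow> integrable lborel (f b)"
  shows "integrable lborel (\<lambda>x::'a. \<Prod>b\<in>Basis. f b (x \<bullet> b))"
    and "(LINT x|lborel. (\<Prod>b\<in>Basis. f b (x \<bullet> b))) = (\<Prod>b\<in>Basis. (LINT x|lborel. f b x))"
proof -
  interpret product_sigma_finite "\<lambda>b::'a. lborel :: real measure" ..
  have [measurable]: "\<And>b. b \<in> Basis \<Longrightarrow> f b \<in> borel_measurable borel"
    using I by (simp add: borel_measurable_integrable)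
  have [measurable]: "(\<lambda>x::'a. \<Prod>b\<in>Basis. f b (x \<bullet> b)) \<in> borel_measurable borel" by measurable
  have eq: "(\<Prod>b\<in>Basis. f b ((\<Sum>b\<in>Basis. g b *\<^sub>R b) \<bullet> b)) = (\<Prod>b\<in>Basis. f b (g b))" for g :: "'a \<Rightarrow> real"
    by (intro prod.cong refl) (simp add: inner_sum_left inner_Basis if_distrib cong: if_cong)
  have [measurable]: "(\<lambda>g. \<Sum>b\<in>Basis. g b *\<^sub>R b) \<in> measurable (\<Pi>\<^sub>M b\<in>(Basis::'a set). (lborel::real measure)) borel"
    by (intro borel_measurable_sum borel_measurable_scaleR) measurable
  show "integrable lborel (\<lambda>x::'a. \<Prod>b\<in>Basis. f b (x \<bullet> b))"
    by (subst lborel_eq, subst integrable_distr_eq) (auto simp: eq intro!: product_integrable_prod I)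
  show "(LINT x|lborel. (\<Prod>b\<in>Basis. f b (x \<bullet> b))) = (\<Prod>b\<in>Basis. (LINT x|lborel. f b x))"
    by (subst lborel_eq, subst integral_distr) (auto simp: eq intro!: product_integral_prod I)
qed

text \<open>The one-dimensional case is the characteristic function of the standard normal distribution after
the substitution \<open>x \<mapsto> sqrt (2 a) x\<close>; products over the coordinates give all dimensions.\<close>
lemma gaussian_fourier_real:
  assumes "a > 0"
  shows "integrable lborel (\<lambda>x::real. complex_of_real (exp (- a * x\<^sup>2)) * exp (- (\<i> * complex_of_real (x * y))))"
    "(LINT x|lborel. complex_of_real (exp (- a * x\<^sup>2)) * exp (- (\<i> * complex_of_real (x * y))))
       = complex_of_real (sqrt (pi / a) * exp (- y\<^sup>2 / (4 * a)))"
proof -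
  let ?f = "\<lambda>t x. complex_of_real (std_normal_density x) * iexp (t * x)"
  have i0: "integrable lborel (?f t)" for t
    by (rule integrable_dominated[OF integrable_normal_density[of 1 0]]) (auto simp: norm_mult)
  have v0: "(LINT x|lborel. ?f t x) = complex_of_real (exp (- (t^2) / 2))" for t
  proof -
    have "char std_normal_distribution t = (LINT x|lborel. ?f t x)"
      unfolding char_def by (subst integral_density) (auto simp: scaleR_conv_of_real)
    then show ?thesis using char_std_normal_distribution by metis
  qed
  define s where "s = sqrt (2 * a)"
  have s: "s > 0" "s^2 = 2 * a" using assms by (auto simp: s_def)
  let ?g = "\<lambda>x::real. complex_of_real (exp (- a * x\<^sup>2)) * exp (- (\<i> * complex_of_real (x * y)))"
  have eq: "?g x = complex_of_real (sqrt (2 * pi)) * ?f (- y / s) (0 + s * x)" for x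
    using s by (simp add: std_normal_density_def power_mult_distrib field_simps)
  show "integrable lborel ?g"
    unfolding eq using s lborel_integrable_real_affine[OF i0[of "-y/s"], of s 0] by (intro integrable_mult_right) auto
  have "(LINT x|lborel. ?f (- y / s) x) = s *\<^sub>R (LINT x|lborel. ?f (-y/s) (0 + s * x))"
    using lborel_integral_real_affine[of s "?f (-y/s)" 0] s(1) by (simp only: abs_of_pos)
  then have "s *\<^sub>R (LINT x|lborel. ?f (-y/s) (0 + s * x)) = complex_of_real (exp (- ((-y/s)^2) / 2))"
    by (simp only: v0)
  then have "(LINT x|lborel. ?f (-y/s) (0 + s * x)) = complex_of_real (exp (- ((-y/s)^2) / 2)) / s"
    using s by (simp add: scaleR_conv_of_real field_simps)
  moreover have "sqrt (2 * pi) / s = sqrt (pi / a)"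
    using assms by (simp add: s_def real_sqrt_mult real_sqrt_divide)
  moreover have "(-y/s)^2 / 2 = y^2 / (4*a)" using s by (simp add: power_divide)
  ultimately show "(LINT x|lborel. ?g x) = complex_of_real (sqrt (pi / a) * exp (- y\<^sup>2 / (4 * a)))"
    unfolding eq by (simp add: mult.assoc) (metis (no_types, lifting) of_real_divide times_divide_eq_left mult.commute)
qed

lemma gaussian_fourier:
  fixes y :: "'a::euclidean_space"
  assumes "a > 0"
  shows "integrable lborel (\<lambda>x::'a. complex_of_real (exp (- a * (norm x)\<^sup>2)) * exp (- (\<i> * complex_of_real (x \<bullet> y))))" (is ?I)
    "(LINT x|lborel. complex_of_real (exp (- a * (norm x)\<^sup>2)) * exp (- (\<i> * complex_of_real (x \<bullet> y))))
       = complex_of_real (sqrt (pi / a) ^ DIM('a) * exp (- (norm y)\<^sup>2 / (4 * a)))" (is ?V)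
proof -
  have n: "(norm x)\<^sup>2 = (\<Sum>b\<in>Basis. (x \<bullet> b)\<^sup>2)" for x :: 'a
    by (simp add: norm_eq_sqrt_inner euclidean_inner[of x x] power2_eq_square sum_nonneg)
  have eq: "complex_of_real (exp (- a * (norm x)\<^sup>2)) * exp (- (\<i> * complex_of_real (x \<bullet> y)))
     = (\<Prod>b\<in>Basis. complex_of_real (exp (- a * (x \<bullet> b)\<^sup>2)) * exp (- (\<i> * complex_of_real ((x \<bullet> b) * (y \<bullet> b)))))" for x
    by (simp add: n euclidean_inner[of x y] prod.distrib sum_distrib_left of_real_sum flip: exp_sum of_real_prod sum_negf)
  show ?I unfolding eq by (intro prod_Basis_lborel gaussian_fourier_real assms)
  show ?V unfolding eq
    by (subst prod_Basis_lborel(2)[OF gaussian_fourier_real(1)[OF assms]], subst gaussian_fourier_real(2)[OF assms])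
      (simp add: n prod.distrib sum_divide_distrib flip: exp_sum of_real_prod sum_negf)
qed

lemma lborel_translate:
  fixes f :: "'a::euclidean_space \<Rightarrow> 'b::{banach, second_countable_topology}"
  assumes [measurable]: "f \<in> borel_measurable borel"
  shows "integrable lborel (\<lambda>x. f (x - p)) \<longleftrightarrow> integrable lborel f"
    and "(LINT x|lborel. f (x - p)) = (LINT x|lborel. f x)"
proof -
  have "integrable (distr lborel borel ((+) (-p))) f \<longleftrightarrow> integrable lborel (\<lambda>x. f (-p + x))"
    by (rule integrable_distr_eq) auto
  then show "integrable lborel (\<lambda>x. f (x - p)) \<longleftrightarrow> integrable lborel f"
    by (simp add: lborel_distr_plus)
  have "integral\<^sup>L (distr lborel borel ((+) (-p))) f = (LINT x|lborel. f (-p + x))"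
    by (rule integral_distr) auto
  then show "(LINT x|lborel. f (x - p)) = (LINT x|lborel. f x)"
    by (simp add: lborel_distr_plus)
qed

lemma integrable_gaussian:
  assumes "a > 0"
  shows "integrable lborel (\<lambda>x::'a::euclidean_space. exp (- a * (norm (x - p))\<^sup>2))"
proof -
  have "integrable lborel (\<lambda>x::'a. exp (- a * (norm x)\<^sup>2))"
    using integrable_norm[OF gaussian_fourier(1)[OF assms, of 0]] by (simp add: norm_mult)
  then show ?thesis by (subst lborel_translate) auto
qed

lemma integral_gaussian:
  assumes "a > 0"
  shows "(LINT x|lborel. exp (- a * (norm (x - p :: 'a::euclidean_space))\<^sup>2)) = sqrt (pi / a) ^ DIM('a)"
proof -
  have "complex_of_real (LINT x|lborel. exp (- a * (norm (x :: 'a))\<^sup>2)) = complex_of_real (sqrt (pi / a) ^ DIM('a))"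
    using gaussian_fourier(2)[OF assms, of "0::'a"] by (simp flip: integral_complex_of_real)
  then have "(LINT x|lborel. exp (- a * (norm (x :: 'a))\<^sup>2)) = sqrt (pi / a) ^ DIM('a)"
    using of_real_eq_iff by blast
  then show ?thesis by (subst lborel_translate) auto
qed

lemma integrable_inverse_power:
  "integrable lborel (\<lambda>x::'a::euclidean_space. 1 / (1 + (norm x)\<^sup>2) ^ DIM('a))"
proof -
  have "integrable lborel (\<lambda>x::real. inverse (1 + x\<^sup>2))"
    using integrable_inverse_1_plus_square by (simp add: set_integrable_def einterval_def)
  then have "integrable lborel (\<lambda>x::real. complex_of_real (inverse (1 + x\<^sup>2)))"
    by (rule integrable_of_real)
  then have "integrable lborel (\<lambda>x::'a. \<Prod>b\<in>Basis. complex_of_real (inverse (1 + (x \<bullet> b)\<^sup>2)))"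
    by (intro prod_Basis_lborel(1))
  then show ?thesis
  proof (rule integrable_dominated, goal_cases)
    case 2
    show ?case
    proof (intro AE_I2)
      fix x :: 'a
      have "(\<Prod>b\<in>Basis. 1 + (x \<bullet> b)\<^sup>2) \<le> (\<Prod>b\<in>(Basis::'a set). 1 + (norm x)\<^sup>2)"
        by (intro prod_mono) (auto intro: add_nonneg_nonneg abs_le_square_iff[THEN iffD1] simp: Basis_le_norm)
      then have "inverse ((1 + (norm x)\<^sup>2) ^ DIM('a)) \<le> inverse (\<Prod>b\<in>Basis. 1 + (x \<bullet> b)\<^sup>2)"
        by (intro le_imp_inverse_le) (auto intro!: prod_pos add_pos_nonneg)
      then show "norm (1 / (1 + (norm x)\<^sup>2) ^ DIM('a)) \<le> norm (\<Prod>b\<in>Basis. complex_of_real (inverse (1 + (x \<bullet> b)\<^sup>2)))"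
        unfolding of_real_prod[symmetric] norm_of_real
        by (simp add: divide_inverse prod_inversef[unfolded comp_def] abs_of_nonneg prod_nonneg)
    qed
  qed measurable
qed

text \<open>Balls of radius \<open>r / 2\<close> around the points of an \<open>r\<close>-separated set are disjoint and have equal
volume, so a sum over the set is controlled by an integral as soon as the summand can be compared with
the integrand across one such ball. The bound does not depend on the shift \<open>z\<close>; this uniformity is
what makes lattice sums of kernels as good as integrals in the Schur test.\<close>
lemma sum_separated_le_integral:
  fixes \<Lambda> :: "'a::euclidean_space set"
  assumes r: "r > 0" and sep: "\<And>x y. x \<in> \<Lambda> \<Longrightarrow> y \<in> \<Lambda> \<Longrightarrow> x \<noteq> y \<Longrightarrow> dist x y \<ge> r"
    and q: "integrable lborel q" and q0: "\<And>x. q x \<ge> (0::real)"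
    and pq: "\<And>x y. dist x y < r / 2 \<Longrightarrow> p x \<le> q y"
  shows "\<exists>C\<ge>0. \<forall>S. finite S \<longrightarrow> S \<subseteq> \<Lambda> \<longrightarrow> (\<forall>z. (\<Sum>\<sigma>\<in>S. p (\<sigma> - z)) \<le> C)"
proof -
  define v where "v = measure lborel (ball (0::'a) (r/2))"
  have v: "v > 0" unfolding v_def using r by (simp add: content_ball_pos)
  have [measurable]: "q \<in> borel_measurable borel" using q by auto
  have bound: "(\<Sum>\<sigma>\<in>S. p (\<sigma> - z)) \<le> (LINT x|lborel. q x) / v" if S: "finite S" "S \<subseteq> \<Lambda>" for S z
  proof -
    have qz: "integrable lborel (\<lambda>x. q (x - z))" using q by (subst lborel_translate) auto
    have meas: "measure lborel (ball \<sigma> (r/2)) = v" for \<sigma> :: 'a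
      unfolding v_def using r by (simp add: content_ball)
    have ib: "integrable lborel (\<lambda>x. indicator (ball \<sigma> (r/2)) x * c)" for \<sigma> :: 'a and c :: real
      by (intro integrable_mult_left integrable_real_indicator) (use emeasure_lborel_ball_finite[of \<sigma> "r/2"] in auto)
    have "v * (\<Sum>\<sigma>\<in>S. p (\<sigma> - z)) = (\<Sum>\<sigma>\<in>S. (LINT x|lborel. indicator (ball \<sigma> (r/2)) x * p (\<sigma> - z)))"
      by (simp add: meas sum_distrib_left)
    also have "\<dots> = (LINT x|lborel. (\<Sum>\<sigma>\<in>S. indicator (ball \<sigma> (r/2)) x * p (\<sigma> - z)))"
      by (intro Bochner_Integration.integral_sum[symmetric] ib)
    also have "\<dots> \<le> (LINT x|lborel. q (x - z))"
    proof (intro integral_mono Bochner_Integration.integrable_sum ib qz)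
      fix x
      show "(\<Sum>\<sigma>\<in>S. indicator (ball \<sigma> (r/2)) x * p (\<sigma> - z)) \<le> q (x - z)"
      proof (cases "\<exists>\<tau>\<in>S. dist \<tau> x < r/2")
        case True
        then obtain \<tau> where \<tau>: "\<tau> \<in> S" "dist \<tau> x < r/2" by blast
        have "indicator (ball \<sigma> (r/2)) x * p (\<sigma> - z) = (if \<sigma> = \<tau> then p (\<tau> - z) else 0)" if "\<sigma> \<in> S" for \<sigma>
        proof (cases "\<sigma> = \<tau>")
          case False
          then have "dist \<sigma> \<tau> \<ge> r" using sep S \<tau> that by blast
          then have "\<not> dist \<sigma> x < r/2" using \<tau> by metric
          then show ?thesis using False by simp
        qed (use \<tau> in simp)
        then have "(\<Sum>\<sigma>\<in>S. indicator (ball \<sigma> (r/2)) x * p (\<sigma> - z)) = p (\<tau> - z)"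
          using S \<tau> by simp
        also have "\<dots> \<le> q (x - z)" using \<tau> by (intro pq) (simp add: dist_norm)
        finally show ?thesis .
      next
        case False
        then have "(\<Sum>\<sigma>\<in>S. indicator (ball \<sigma> (r/2)) x * p (\<sigma> - z)) = 0"
          by (intro sum.neutral) auto
        then show ?thesis using q0 by simp
      qed
    qed
    also have "\<dots> = (LINT x|lborel. q x)" by (rule lborel_translate) auto
    finally show ?thesis using v by (simp add: field_simps)
  qed
  have "(LINT x|lborel. q x) / v \<ge> 0" using v q0 by simp
  then show ?thesis using bound by blast
qed

section \<open>Exponential weights\<close>

lemma weight_nonneg: "weight_function \<omega> \<Longrightarrow> t \<ge> 0 \<Longrightarrow> \<omega> t \<ge> 0"
  and weight_mono: "weight_function \<omega> \<Longrightarrow> 0 \<le> s \<Longrightarrow> s \<le> t \<Longrightarrow> \<omega> s \<le> \<omega> t"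
  by (auto simp: weight_function_def mono_on_def)

lemma weight_doubling:
  assumes "weight_function \<omega>"
  obtains L where "L \<ge> 1" "\<And>t. t \<ge> 0 \<Longrightarrow> \<omega> (2 * t) \<le> L * (\<omega> t + 1)"
  using assms unfolding weight_function_def by blast

lemma weight_sublinear:
  assumes w: "weight_function \<omega>" and e: "\<epsilon> > 0"
  obtains C where "C \<ge> 0" "\<And>t. t \<ge> 0 \<Longrightarrow> \<omega> t \<le> \<epsilon> * t + C"
proof -
  have "\<forall>\<^sub>F t in at_top. norm (\<omega> t) \<le> \<epsilon> * norm t"
    using w e landau_o.smallD[of \<omega> at_top "\<lambda>t. t" \<epsilon>] unfolding weight_function_def by blast
  then obtain T where T: "\<And>t. t \<ge> T \<Longrightarrow> \<bar>\<omega> t\<bar> \<le> \<epsilon> * \<bar>t\<bar>"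
    unfolding eventually_at_top_linorder by auto
  show ?thesis
  proof (rule that[of "\<omega> (max T 0)"])
    show "\<omega> (max T 0) \<ge> 0" using weight_nonneg[OF w] by simp
    fix t :: real assume t: "t \<ge> 0"
    show "\<omega> t \<le> \<epsilon> * t + \<omega> (max T 0)"
    proof (cases "t \<ge> T")
      case True
      then show ?thesis using T[of t] t weight_nonneg[OF w, of "max T 0"] by simp
    next
      case False
      then have "\<omega> t \<le> \<omega> (max T 0)" using t by (intro weight_mono[OF w]) auto
      then show ?thesis using e t by (smt (verit) mult_nonneg_nonneg)
    qed
  qed
qed

text \<open>Doubling serves as a substitute for subadditivity: the larger of the two arguments is at least half
of the sum.\<close>
lemma weight_add:
  assumes w: "weight_function \<omega>" and L: "L \<ge> 1" "\<And>t. t \<ge> 0 \<Longrightarrow> \<omega> (2 * t) \<le> L * (\<omega> t + 1)"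
    and "0 \<le> s" "0 \<le> t" "r \<le> s + t" "0 \<le> r"
  shows "\<omega> r \<le> L * (\<omega> s + 1) \<or> \<omega> r \<le> L * (\<omega> t + 1)"
proof -
  have "\<omega> r \<le> \<omega> (2 * max s t)" using assms by (intro weight_mono[OF w]) auto
  also have "\<dots> \<le> L * (\<omega> (max s t) + 1)" using assms by (intro L) auto
  finally show ?thesis by (cases "s \<le> t") (auto simp: max_def)
qed

text \<open>An exponential weight at \<open>x + y\<close> costs an exponential weight at \<open>x\<close> and only an ordinary exponential
in the displacement \<open>y\<close>, because the weight function grows sublinearly. Gaussians absorb the latter.\<close>
lemma weight_exp_add:
  assumes w: "weight_function \<omega>" and \<mu>: "\<mu> > 0"
  obtains C \<mu>' where "C > 0" "\<mu>' > 0"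
    "\<And>x y :: 'a::real_normed_vector. exp (\<mu> * \<omega> (norm (x + y))) \<le> C * exp (\<mu>' * \<omega> (norm x)) * exp (norm y)"
proof -
  obtain L where L: "L \<ge> 1" "\<And>t. t \<ge> 0 \<Longrightarrow> \<omega> (2 * t) \<le> L * (\<omega> t + 1)"
    using weight_doubling[OF w] by blast
  have "1 / (\<mu> * L) > 0" using L \<mu> by simp
  then obtain C where C: "C \<ge> 0" "\<And>t. t \<ge> 0 \<Longrightarrow> \<omega> t \<le> 1 / (\<mu> * L) * t + C"
    using weight_sublinear[OF w] by blast
  show ?thesis
  proof (rule that[of "exp (\<mu> * L * (C + 1))" "\<mu> * L"])
    show "\<mu> * L > 0" using L \<mu> by simp
    fix x y :: 'a
    have "\<omega> (norm (x + y)) \<le> L * (\<omega> (norm x) + 1) \<or> \<omega> (norm (x + y)) \<le> L * (\<omega> (norm y) + 1)"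
      by (intro weight_add[OF w L]) (auto simp: norm_triangle_ineq)
    then have "\<omega> (norm (x + y)) \<le> L * (\<omega> (norm x) + \<omega> (norm y) + 1)"
      using weight_nonneg[OF w, of "norm x"] weight_nonneg[OF w, of "norm y"] L(1)
      by (smt (verit) mult_left_mono norm_ge_zero)
    also have "\<dots> \<le> L * (\<omega> (norm x) + (1 / (\<mu> * L) * norm y + C) + 1)"
      using C(2)[of "norm y"] L by (intro mult_left_mono) auto
    finally have "\<mu> * \<omega> (norm (x + y)) \<le> \<mu> * (L * (\<omega> (norm x) + (1 / (\<mu> * L) * norm y + C) + 1))"
      using \<mu> by simp
    also have "\<dots> = \<mu> * L * (C + 1) + \<mu> * L * \<omega> (norm x) + norm y"
      using L \<mu> by (simp add: field_simps)
    finally show "exp (\<mu> * \<omega> (norm (x + y))) \<le> exp (\<mu> * L * (C + 1)) * exp (\<mu> * L * \<omega> (norm x)) * exp (norm y)"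
      by (simp flip: exp_add)
  qed simp
qed

lemma weight_polynomial:
  assumes w: "weight_function \<omega>"
  obtains C k where "C > 0" "k > 0" "\<And>t. t \<ge> 0 \<Longrightarrow> (1 + t) ^ n \<le> C * exp (k * \<omega> t)"
proof -
  obtain a b where b: "b > 0" "\<And>t. t \<ge> 0 \<Longrightarrow> \<omega> t \<ge> a + b * ln (1 + t)"
    using w unfolding weight_function_def by blast
  show ?thesis
  proof (rule that[of "exp (- (real n + 1) * a / b)" "(real n + 1) / b"])
    fix t :: real assume t: "t \<ge> 0"
    have "(1 + t) ^ n \<le> (1 + t) ^ (n + 1)" using t by (intro power_increasing) auto
    also have "\<dots> = exp ((real n + 1) * ln (1 + t))"
      using t exp_of_nat_mult[of "n + 1" "ln (1 + t)"] by (simp add: add.commute)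
    also have "\<dots> \<le> exp ((real n + 1) * ((\<omega> t - a) / b))"
    proof -
      have "ln (1 + t) \<le> (\<omega> t - a) / b" using b(2)[OF t] b(1) by (simp add: field_simps)
      then show ?thesis by (intro exp_le_cancel_iff[THEN iffD2] mult_left_mono) auto
    qed
    also have "\<dots> = exp (- (real n + 1) * a / b) * exp ((real n + 1) / b * \<omega> t)"
      by (simp add: field_simps diff_divide_distrib add_divide_distrib flip: exp_add)
    finally show "(1 + t) ^ n \<le> exp (- (real n + 1) * a / b) * exp ((real n + 1) / b * \<omega> t)" .
  qed (use b in auto)
qed

lemma weight_norm_measurable:
  assumes w: "weight_function \<omega>"
  shows "(\<lambda>x::'a::euclidean_space. \<omega> (norm x)) \<in> borel_measurable borel"
proof -
  have "continuous_on UNIV (\<lambda>x::'a. \<omega> (norm x))"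
  proof -
    have "continuous_on {0..} \<omega>" using w unfolding weight_function_def by blast
    show ?thesis by (rule continuous_on_compose2[OF \<open>continuous_on {0..} \<omega>\<close> continuous_on_norm_id]) auto
  qed
  then show ?thesis by (rule borel_measurable_continuous_onI)
qed

text \<open>Exponential weights need not be slowly varying, but up to a change of the parameter they can be
replaced by weights whose logarithm is Lipschitz with an arbitrarily small constant \<open>\<epsilon>\<close>. The replacement is
the exponential of the inf-convolution of \<open>\<nu> L \<omega>(|y|)\<close> with \<open>\<epsilon> |z - y|\<close>, where \<open>L\<close> is the doubling constant.
The infimum does not drop below \<open>\<nu> \<omega>(|z|)\<close> by more than a constant, since either \<open>|y|\<close> or \<open>|z - y|\<close> is at
least half of \<open>|z|\<close> and \<open>\<omega>\<close> is sublinear. The upper exponent \<open>\<nu>'\<close> is the same for all \<open>\<epsilon>\<close>, so that \<open>\<epsilon>\<close> can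
be chosen last.\<close>
lemma slowly_varying_weight:
  assumes w: "weight_function \<omega>" and \<nu>: "\<nu> > 0"
  obtains \<nu>' where "\<nu>' > 0" and
    "\<And>\<epsilon>. \<epsilon> > 0 \<Longrightarrow> \<exists>m C. C > 0 \<and> m \<in> borel_measurable borel \<and> (\<forall>z::'a::euclidean_space. m z > 0 \<and>
       m z \<le> exp (\<nu>' * \<omega> (norm z)) \<and> exp (\<nu> * \<omega> (norm z)) \<le> C * m z) \<and>
       (\<forall>z y. m z \<le> m y * exp (\<epsilon> * norm (z - y)))"
proof -
  obtain L where L: "L \<ge> 1" "\<And>t. t \<ge> 0 \<Longrightarrow> \<omega> (2 * t) \<le> L * (\<omega> t + 1)"
    using weight_doubling[OF w] by blast
  show ?thesis
  proof (rule that[of "\<nu> * L"])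
    show "\<nu> * L > 0" using \<nu> L by simp
    fix \<epsilon> :: real assume e: "\<epsilon> > 0"
    have "\<epsilon> / (\<nu> * L) > 0" using L \<nu> e by simp
    then obtain C where C: "C \<ge> 0" "\<And>t. t \<ge> 0 \<Longrightarrow> \<omega> t \<le> \<epsilon> / (\<nu> * L) * t + C"
      using weight_sublinear[OF w] by blast
    define g where "g = (\<lambda>z y::'a. \<nu> * L * \<omega> (norm y) + \<epsilon> * norm (z - y))"
    define \<kappa> where "\<kappa> = (\<lambda>z. INF y. g z y)"
    have g0: "g z y \<ge> 0" for z y
      unfolding g_def using \<nu> L e weight_nonneg[OF w] by simp
    have bb: "bdd_below (range (g z))" for z using g0 by (auto intro!: bdd_belowI[of _ 0])
    have up: "\<kappa> z \<le> \<nu> * L * \<omega> (norm z)" for z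
      using cINF_lower[OF bb, of z z] by (simp add: \<kappa>_def g_def)
    have lip: "\<kappa> z \<le> \<kappa> y + \<epsilon> * norm (z - y)" for z y
    proof -
      have ky: "\<kappa> y = (INF x. g y x)" by (simp add: \<kappa>_def)
      have "\<kappa> z - \<epsilon> * norm (z - y) \<le> g y x" for x
      proof -
        have "\<kappa> z \<le> g z x" unfolding \<kappa>_def by (rule cINF_lower[OF bb]) simp
        moreover have "g z x \<le> g y x + \<epsilon> * norm (z - y)"
          using e norm_triangle_ineq[of "z - y" "y - x"] by (simp add: g_def flip: distrib_left)
        ultimately show ?thesis by simp
      qed
      then have "\<kappa> z - \<epsilon> * norm (z - y) \<le> \<kappa> y" unfolding ky by (intro cINF_greatest) auto
      then show ?thesis by simp
    qed
    have low: "\<nu> * \<omega> (norm z) \<le> \<kappa> z + \<nu> * L * (C + 1)" for z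
    proof -
      have "\<nu> * \<omega> (norm z) - \<nu> * L * (C + 1) \<le> g z y" for y
      proof -
        have "\<omega> (norm z) \<le> L * (\<omega> (norm y) + 1) \<or> \<omega> (norm z) \<le> L * (\<omega> (norm (z - y)) + 1)"
          using norm_triangle_ineq[of y "z - y"] by (intro weight_add[OF w L]) auto
        then have "\<omega> (norm z) \<le> L * (\<omega> (norm y) + \<omega> (norm (z - y)) + 1)"
          using weight_nonneg[OF w, of "norm y"] weight_nonneg[OF w, of "norm (z - y)"] L(1)
          by (smt (verit) mult_left_mono norm_ge_zero)
        also have "\<dots> \<le> L * (\<omega> (norm y) + (\<epsilon> / (\<nu> * L) * norm (z - y) + C) + 1)"
          using C(2)[of "norm (z - y)"] L by (intro mult_left_mono) auto
        finally have "\<nu> * \<omega> (norm z) \<le> \<nu> * (L * (\<omega> (norm y) + (\<epsilon> / (\<nu> * L) * norm (z - y) + C) + 1))"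
          using \<nu> by simp
        also have "\<dots> = g z y + \<nu> * L * (C + 1)"
          using L \<nu> by (simp add: field_simps g_def)
        finally show ?thesis by simp
      qed
      then have "\<nu> * \<omega> (norm z) - \<nu> * L * (C + 1) \<le> \<kappa> z" unfolding \<kappa>_def by (intro cINF_greatest) auto
      then show ?thesis by simp
    qed
    have "\<bar>\<kappa> z - \<kappa> y\<bar> \<le> \<epsilon> * norm (z - y)" for z y
      using lip[of z y] lip[of y z] by (simp add: norm_minus_commute abs_le_iff)
    then have "\<epsilon>-lipschitz_on UNIV \<kappa>" using e by (intro lipschitz_onI) (auto simp: dist_norm)
    then have "continuous_on UNIV \<kappa>" by (rule lipschitz_on_continuous_on)
    then have "(\<lambda>z. exp (\<kappa> z)) \<in> borel_measurable borel"
      by (intro borel_measurable_continuous_onI continuous_intros)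
    moreover have "exp (\<kappa> z) \<le> exp (\<kappa> y) * exp (\<epsilon> * norm (z - y))" for z y
      using lip[of z y] by (simp flip: exp_add)
    moreover have "exp (\<nu> * \<omega> (norm z)) \<le> exp (\<nu> * L * (C + 1)) * exp (\<kappa> z)" for z
      using low[of z] by (simp add: add.commute flip: exp_add)
    ultimately show "\<exists>m C. C > 0 \<and> m \<in> borel_measurable borel \<and> (\<forall>z::'a. m z > 0 \<and>
       m z \<le> exp (\<nu> * L * \<omega> (norm z)) \<and> exp (\<nu> * \<omega> (norm z)) \<le> C * m z) \<and>
       (\<forall>z y. m z \<le> m y * exp (\<epsilon> * norm (z - y)))"
      using up by (intro exI[of _ "\<lambda>z. exp (\<kappa> z)"] exI[of _ "exp (\<nu> * L * (C + 1))"]) auto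
  qed
qed

section \<open>Fourier inversion for Gaussian atoms\<close>

lemma measurable_fst_borel [measurable]: "fst \<in> borel_measurable (borel :: ('a::euclidean_space \<times> 'b::euclidean_space) measure)"
  and measurable_snd_borel [measurable]: "snd \<in> borel_measurable (borel :: ('a::euclidean_space \<times> 'b::euclidean_space) measure)"
  by (intro borel_measurable_continuous_onI continuous_intros)+

lemma Fubini_bound:
  fixes k :: "'a::euclidean_space \<Rightarrow> 'b::euclidean_space \<Rightarrow> 'c::{banach, second_countable_topology}"
  assumes m: "(\<lambda>(x, y). k x y) \<in> borel_measurable (lborel \<Otimes>\<^sub>M lborel)"
    and f: "integrable lborel f" and k: "\<And>x. integrable lborel (k x)"
    and b: "\<And>x. (LINT y|lborel. norm (k x y)) \<le> f x"
  shows "(LINT x|lborel. LINT y|lborel. k x y) = (LINT y|lborel. LINT x|lborel. k x y)"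
    and "integrable lborel (\<lambda>y. LINT x|lborel. k x y)"
proof -
  note [measurable] = m
  have *: "integrable (lborel \<Otimes>\<^sub>M lborel) (\<lambda>(x, y). k x y)"
  proof (rule lborel_pair.Fubini_integrable[OF m])
    show "integrable lborel (\<lambda>x. LINT y|lborel. norm (case (x, y) of (x, y) \<Rightarrow> k x y))"
    proof (rule integrable_dominated[OF f])
      show "AE x in lborel. norm (LINT y|lborel. norm (case (x, y) of (x, y) \<Rightarrow> k x y)) \<le> norm (f x)"
        using b by (intro AE_I2) (simp add: order_trans[OF _ abs_ge_self])
    qed measurable
  qed (use k in auto)
  show "(LINT x|lborel. LINT y|lborel. k x y) = (LINT y|lborel. LINT x|lborel. k x y)"
    by (rule lborel_pair.Fubini_integral[symmetric, OF *])
  show "integrable lborel (\<lambda>y. LINT x|lborel. k x y)"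
    using lborel_pair.integrable_snd[OF *] .
qed

lemma lborel_integral_affine:
  fixes f :: "'a::euclidean_space \<Rightarrow> complex"
  assumes [measurable]: "f \<in> borel_measurable borel" and c: "c > 0"
  shows "(LINT x|lborel. f x) = c ^ DIM('a) *\<^sub>R (LINT x|lborel. f (t + c *\<^sub>R x))"
proof -
  have "(LINT x|lborel. f x) = (LINT x|density (distr lborel borel (\<lambda>x. t + c *\<^sub>R x)) (\<lambda>_. \<bar>c\<bar>^DIM('a)). f x)"
    using lborel_affine[of c t] c by simp
  also have "\<dots> = (LINT x|distr lborel borel (\<lambda>x. t + c *\<^sub>R x). \<bar>c\<bar>^DIM('a) *\<^sub>R f x)"
    using c by (intro integral_density) auto
  also have "\<dots> = (LINT x|lborel. \<bar>c\<bar>^DIM('a) *\<^sub>R f (t + c *\<^sub>R x))"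
    by (rule integral_distr) auto
  finally show ?thesis using c by simp
qed

text \<open>This identity takes over the role of Plancherel's theorem: all functions paired with a given one
are explicit Gaussians, whose Fourier transforms are known.\<close>
lemma fourier_multiplication:
  fixes f g :: "real^'d::finite \<Rightarrow> complex"
  assumes f: "integrable lborel f" and g: "integrable lborel g"
  shows "(LINT x|lborel. f x * fourier g x) = (LINT y|lborel. fourier f y * g y)"
proof -
  have [measurable]: "f \<in> borel_measurable borel" "g \<in> borel_measurable borel" using f g by auto
  have "(LINT x|lborel. f x * fourier g x) = (LINT x|lborel. LINT y|lborel. f x * (g y * exp (- (\<i> * complex_of_real (y \<bullet> x)))))"
    unfolding fourier_def by (simp add: integral_mult_right_zero)
  also have "\<dots> = (LINT y|lborel. LINT x|lborel. f x * (g y * exp (- (\<i> * complex_of_real (y \<bullet> x)))))"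
  proof (rule Fubini_bound(1)[where f = "\<lambda>x. cmod (f x) * (LINT y|lborel. cmod (g y))"])
    show "integrable lborel (\<lambda>y. f x * (g y * exp (- (\<i> * complex_of_real (y \<bullet> x)))))" for x
      by (intro integrable_mult_right integrable_dominated[OF integrable_norm[OF g]])
        (auto simp: norm_mult)
  qed (use f in \<open>auto simp: norm_mult\<close>)
  also have "\<dots> = (LINT y|lborel. fourier f y * g y)"
    unfolding fourier_def by (subst integral_mult_left_zero[symmetric]) (simp add: mult_ac inner_commute)
  finally show ?thesis .
qed

text \<open>A Gaussian centred at \<open>p\<close> in time and at \<open>q\<close> in frequency. The width parameter \<open>a\<close> is 1 for the window
itself and 1/4 for its Fourier transform.\<close>
definition atom :: "real \<Rightarrow> real^'d \<Rightarrow> real^'d \<Rightarrow> real^'d::finite \<Rightarrow> complex" where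
  "atom a p q t = exp (\<i> * complex_of_real (t \<bullet> q)) * complex_of_real (exp (- a * (norm (t - p))\<^sup>2))"

lemma norm_atom: "cmod (atom a p q t) = exp (- a * (norm (t - p))\<^sup>2)"
  by (simp add: atom_def norm_mult)

lemma norm_atom_le_1: "a > 0 \<Longrightarrow> cmod (atom a p q t) \<le> 1"
  by (simp add: norm_atom)

lemma measurable_atom [measurable]:
  assumes [measurable]: "P \<in> borel_measurable M" "Q \<in> borel_measurable M" "T \<in> borel_measurable M"
  shows "(\<lambda>x. atom a (P x) (Q x) (T x)) \<in> borel_measurable M"
  unfolding atom_def by measurable

lemma integrable_atom:
  assumes "a > 0" shows "integrable lborel (atom a p q)"
proof (rule integrable_dominated[OF integrable_gaussian[OF assms, of p]])
  show "atom a p q \<in> borel_measurable lborel" by measurable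
qed (simp add: norm_atom)

lemma fourier_atom:
  fixes p q \<eta> :: "real^'d::finite"
  assumes a: "a > 0"
  shows "fourier (atom a p q) \<eta> = complex_of_real (sqrt (pi / a) ^ CARD('d)) *
           exp (\<i> * complex_of_real (p \<bullet> (q - \<eta>))) * complex_of_real (exp (- (norm (\<eta> - q))\<^sup>2 / (4 * a)))"
proof -
  let ?G = "\<lambda>s. complex_of_real (exp (- a * (norm s)\<^sup>2)) * exp (- (\<i> * complex_of_real (s \<bullet> (\<eta> - q))))"
  have "fourier (atom a p q) \<eta> = (LINT t|lborel. exp (\<i> * complex_of_real (p \<bullet> (q - \<eta>))) * ?G (t - p))"
    unfolding fourier_def atom_def
    by (intro Bochner_Integration.integral_cong refl)
      (simp add: mult_ac inner_diff_left inner_diff_right algebra_simps flip: exp_add)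
  also have "\<dots> = exp (\<i> * complex_of_real (p \<bullet> (q - \<eta>))) * (LINT t|lborel. ?G (t - p))"
    by (rule integral_mult_right_zero)
  also have "(LINT t|lborel. ?G (t - p)) = (LINT t|lborel. ?G t)"
    by (rule lborel_translate) measurable
  finally show ?thesis using gaussian_fourier(2)[OF a, of "\<eta> - q"] by (simp add: mult_ac)
qed

text \<open>Gaussian summation: inserting \<open>exp (- a |\<xi>|\<^sup>2)\<close> into the inversion integral turns it, by the multiplication
formula, into an average of \<open>h\<close> against a Gaussian around \<open>t\<close> of width proportional to \<open>sqrt a\<close>; both sides converge as
\<open>a \<rightarrow> 0\<close>.\<close>
theorem fourier_inversion:
  fixes h :: "real^'d::finite \<Rightarrow> complex"
  assumes c: "continuous_on UNIV h" and bd: "\<And>t. cmod (h t) \<le> B"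
    and h: "integrable lborel h" and hh: "integrable lborel (fourier h)"
  shows "complex_of_real ((2 * pi) ^ CARD('d)) * h t
    = (LINT \<xi>|lborel. fourier h \<xi> * exp (\<i> * complex_of_real (t \<bullet> \<xi>)))"
proof (rule LIMSEQ_unique)
  \<comment> \<open>With this choice the Gaussian average has width \<open>1 / (n + 1)\<close>.\<close>
  define a where "a = (\<lambda>n::nat. 1 / (4 * (real n + 1)\<^sup>2))"
  have a: "a n > 0" for n by (simp add: a_def)
  have [measurable]: "h \<in> borel_measurable borel" "fourier h \<in> borel_measurable borel" using h hh by auto
  let ?I = "\<lambda>n. (LINT \<xi>|lborel. fourier h \<xi> * atom (a n) 0 t \<xi>)"
  have lim0: "(\<lambda>n. 1 / (real n + 1)) \<longlonglongrightarrow> 0" by (rule LIMSEQ_inverse_real_of_nat[unfolded inverse_eq_divide of_nat_Suc add.commute[of 1]])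
  have "a = (\<lambda>n. (1 / (real n + 1))\<^sup>2 / 4)" by (auto simp: a_def power_divide)
  then have alim: "a \<longlonglongrightarrow> 0" using tendsto_divide[OF tendsto_power[OF lim0, of 2] tendsto_const[of 4]] by simp
  show "?I \<longlonglongrightarrow> (LINT \<xi>|lborel. fourier h \<xi> * exp (\<i> * complex_of_real (t \<bullet> \<xi>)))"
  proof (rule integral_dominated_convergence[where w = "\<lambda>\<xi>. cmod (fourier h \<xi>)"])
    show "AE \<xi> in lborel. (\<lambda>n. fourier h \<xi> * atom (a n) 0 t \<xi>) \<longlonglongrightarrow> fourier h \<xi> * exp (\<i> * complex_of_real (t \<bullet> \<xi>))"
    proof (intro AE_I2)
      fix \<xi> :: "real^'d"
      have "(\<lambda>n. complex_of_real (exp (- a n * (norm (\<xi> - 0))\<^sup>2))) \<longlonglongrightarrow> complex_of_real (exp (- 0 * (norm (\<xi> - 0))\<^sup>2))"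
        by (intro tendsto_intros alim)
      then have "(\<lambda>n. atom (a n) 0 t \<xi>) \<longlonglongrightarrow> exp (\<i> * complex_of_real (\<xi> \<bullet> t)) * complex_of_real (exp (- 0 * (norm (\<xi> - 0))\<^sup>2))"
        unfolding atom_def by (intro tendsto_mult tendsto_const)
      then show "(\<lambda>n. fourier h \<xi> * atom (a n) 0 t \<xi>) \<longlonglongrightarrow> fourier h \<xi> * exp (\<i> * complex_of_real (t \<bullet> \<xi>))"
        by (intro tendsto_mult tendsto_const) (simp add: inner_commute)
    qed
    show "AE \<xi> in lborel. norm (fourier h \<xi> * atom (a n) 0 t \<xi>) \<le> cmod (fourier h \<xi>)" for n
      by (intro AE_I2) (simp add: norm_mult mult_left_le norm_atom_le_1[OF a])
  qed (use hh in \<open>auto intro!: integrable_norm\<close>)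
  have I: "?I n = complex_of_real ((4 * pi) powr (CARD('d) / 2)) *
      (LINT u|lborel. h (t + (1 / (real n + 1)) *\<^sub>R u) * complex_of_real (exp (- (norm u)\<^sup>2)))" for n
  proof -
    define b where "b = 1 / (real n + 1)"
    have b: "b > 0" and ab: "4 * a n = b\<^sup>2" by (auto simp: b_def a_def power_divide)
    have "?I n = (LINT s|lborel. h s * fourier (atom (a n) 0 t) s)"
      by (rule fourier_multiplication[symmetric, OF h integrable_atom[OF a]])
    also have "\<dots> = (LINT s|lborel. complex_of_real (sqrt (pi / a n) ^ CARD('d)) *
         (h s * complex_of_real (exp (- (norm (s - t))\<^sup>2 / b\<^sup>2))))"
      by (simp add: fourier_atom[OF a] ab[symmetric] mult_ac)
    also have "\<dots> = complex_of_real (sqrt (pi / a n) ^ CARD('d)) *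
       (LINT s|lborel. h s * complex_of_real (exp (- (norm (s - t))\<^sup>2 / b\<^sup>2)))"
      by (rule integral_mult_right_zero)
    also have "(LINT s|lborel. h s * complex_of_real (exp (- (norm (s - t))\<^sup>2 / b\<^sup>2)))
       = b ^ CARD('d) *\<^sub>R (LINT u|lborel. h (t + b *\<^sub>R u) * complex_of_real (exp (- (norm u)\<^sup>2)))"
      using b by (subst lborel_integral_affine[of _ b t]) (auto simp: power_mult_distrib)
    also have "sqrt (pi / a n) ^ CARD('d) * b ^ CARD('d) = (4 * pi) powr (CARD('d) / 2)"
    proof -
      have "sqrt (pi / a n) * b = sqrt (pi / a n * b\<^sup>2)" using b by (simp add: real_sqrt_mult real_sqrt_divide)
      also have "pi / a n * b\<^sup>2 = 4 * pi" using a[of n] by (simp add: ab[symmetric])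
      finally have "sqrt (pi / a n) ^ CARD('d) * b ^ CARD('d) = sqrt (4 * pi) ^ CARD('d)"
        by (simp flip: power_mult_distrib)
      also have "\<dots> = (4 * pi) powr (CARD('d) / 2)"
        by (simp add: powr_half_sqrt[symmetric] powr_powr flip: powr_realpow)
      finally show ?thesis .
    qed
    then have "complex_of_real (sqrt (pi / a n) ^ CARD('d)) * (b ^ CARD('d) *\<^sub>R X) = complex_of_real ((4 * pi) powr (CARD('d) / 2)) * X" for X
      by (metis (no_types, lifting) mult.assoc of_real_mult scaleR_conv_of_real)
    finally show ?thesis unfolding b_def .
  qed
  have "(\<lambda>n. (LINT u|lborel. h (t + (1 / (real n + 1)) *\<^sub>R u) * complex_of_real (exp (- (norm u)\<^sup>2))))
     \<longlonglongrightarrow> (LINT u|lborel. h t * complex_of_real (exp (- (norm (u::real^'d))\<^sup>2)))"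
  proof (rule integral_dominated_convergence[where w = "\<lambda>u. B * exp (- 1 * (norm (u - 0))\<^sup>2)"])
    show "integrable lborel (\<lambda>u::real^'d. B * exp (- 1 * (norm (u - 0))\<^sup>2))"
      by (intro integrable_mult_right integrable_gaussian) simp
    show "AE u in lborel. (\<lambda>n. h (t + (1 / (real n + 1)) *\<^sub>R u) * complex_of_real (exp (- (norm u)\<^sup>2)))
        \<longlonglongrightarrow> h t * complex_of_real (exp (- (norm u)\<^sup>2))"
    proof (intro AE_I2 tendsto_mult tendsto_const)
      fix u :: "real^'d"
      have "(\<lambda>n. t + (1 / (real n + 1)) *\<^sub>R u) \<longlonglongrightarrow> t + 0 *\<^sub>R u"
        by (intro tendsto_intros lim0)
      then show "(\<lambda>n. h (t + (1 / (real n + 1)) *\<^sub>R u)) \<longlonglongrightarrow> h t"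
        using c by (intro continuous_on_tendsto_compose[OF c]) auto
    qed
    show "AE u in lborel. norm (h (t + (1 / (real n + 1)) *\<^sub>R u) * complex_of_real (exp (- (norm u)\<^sup>2)))
        \<le> B * exp (- 1 * (norm (u - 0))\<^sup>2)" for n
      using bd by (intro AE_I2) (simp add: norm_mult mult_right_mono)
  qed measurable
  also have "(LINT u|lborel. h t * complex_of_real (exp (- (norm (u::real^'d))\<^sup>2))) = h t * complex_of_real (sqrt pi ^ CARD('d))"
    using integral_gaussian[of 1 "0::real^'d"] by simp
  finally have "?I \<longlonglongrightarrow> complex_of_real ((4 * pi) powr (CARD('d) / 2)) * (h t * complex_of_real (sqrt pi ^ CARD('d)))"
    unfolding I by (intro tendsto_mult tendsto_const)
  also have "complex_of_real ((4 * pi) powr (CARD('d) / 2)) * (h t * complex_of_real (sqrt pi ^ CARD('d)))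
     = complex_of_real ((4 * pi) powr (CARD('d) / 2) * sqrt pi ^ CARD('d)) * h t" by simp
  also have "(4 * pi) powr (CARD('d) / 2) * sqrt pi ^ CARD('d) = (2 * pi) ^ CARD('d)"
  proof -
    have "(4 * pi) powr (CARD('d) / 2) = sqrt (4 * pi) ^ CARD('d)"
      by (simp add: powr_half_sqrt[symmetric] powr_powr flip: powr_realpow)
    moreover have "sqrt (4 * pi) * sqrt pi = 2 * pi" by (simp add: real_sqrt_mult)
    ultimately show ?thesis by (simp only: power_mult_distrib[symmetric])
  qed
  finally show "?I \<longlonglongrightarrow> complex_of_real ((2 * pi) ^ CARD('d)) * h t" .
qed

section \<open>Decay of the short-time Fourier transform\<close>

lemma C_infinity_continuous: "C_infinity u \<Longrightarrow> continuous_on UNIV u"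
  unfolding C_infinity_def by (metis foldr_Nil id_apply)

lemma multi_deriv_0: "multi_deriv (\<lambda>_. 0) u = u"
proof -
  have "foldr (\<lambda>i. partial_deriv i ^^ 0) xs u = u" for xs :: "'a list" by (induction xs) auto
  then show ?thesis by (simp add: multi_deriv_def)
qed

lemma S_seminorm_upper:
  assumes "u \<in> S_omega \<omega>" "\<mu> > 0"
  shows "exp (\<mu> * \<omega> (norm x)) * cmod (multi_deriv \<alpha> u x) \<le> S_seminorm \<omega> \<mu> \<alpha> u"
    and "exp (\<mu> * \<omega> (norm x)) * cmod (multi_deriv \<alpha> (fourier u) x) \<le> S_seminorm \<omega> \<mu> \<alpha> (fourier u)"
  using assms unfolding S_seminorm_def S_omega_def by (auto intro!: cSUP_upper)

lemma gaussian_beats_exp: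
  fixes a c r :: real
  assumes "a > 0"
  shows "exp (c * r) * exp (- a * r\<^sup>2) \<le> exp (c\<^sup>2 / (2 * a)) * exp (- (a / 2) * r\<^sup>2)"
proof -
  have "0 \<le> (a * r - c)\<^sup>2 / (2 * a)" using assms by simp
  also have "\<dots> = a / 2 * r\<^sup>2 - c * r + c\<^sup>2 / (2 * a)"
    using assms by (simp add: power2_diff field_simps power2_eq_square)
  finally show ?thesis by (simp flip: exp_add)
qed

text \<open>Averaging against a Gaussian at \<open>p\<close> transports decay of \<open>u\<close> to decay in \<open>p\<close>: the weight at \<open>p\<close> is
moved to the integration variable at the price of \<open>exp |t - p|\<close>.\<close>
lemma gaussian_average_decay:
  fixes \<omega> :: "real \<Rightarrow> real"
  assumes w: "weight_function \<omega>" and k: "k > 0" and a: "a > 0"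
  obtains C \<mu> where "C > 0" "\<mu> > 0"
    "\<And>(u :: real^'d::finite \<Rightarrow> complex) S p q. u \<in> borel_measurable borel \<Longrightarrow>
       (\<And>t. exp (\<mu> * \<omega> (norm t)) * cmod (u t) \<le> S) \<Longrightarrow>
       exp (k * \<omega> (norm p)) * cmod (LINT t|lborel. u t * atom a p q t) \<le> C * S"
proof -
  obtain C \<mu> where C: "C > 0" "\<mu> > 0"
    "\<And>x y :: real^'d. exp (k * \<omega> (norm (x + y))) \<le> C * exp (\<mu> * \<omega> (norm x)) * exp (norm y)"
    using weight_exp_add[OF w k] by blast
  define D where "D = C * exp (1 / (2 * a)) * sqrt (pi / (a / 2)) ^ DIM(real^'d)"
  show ?thesis
  proof (rule that[of D \<mu>])
    show "D > 0" using C a by (simp add: D_def)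
    fix u :: "real^'d \<Rightarrow> complex" and S p q
    assume [measurable]: "u \<in> borel_measurable borel"
      and u: "\<And>t. exp (\<mu> * \<omega> (norm t)) * cmod (u t) \<le> S"
    have b: "exp (k * \<omega> (norm p)) * cmod (u t * atom a p q t) \<le> S * C * exp (1 / (2 * a)) * exp (- (a / 2) * (norm (t - p))\<^sup>2)" for t
    proof -
      have "exp (k * \<omega> (norm p)) \<le> C * exp (\<mu> * \<omega> (norm t)) * exp (norm (t - p))"
        using C(3)[of t "p - t"] by (simp add: norm_minus_commute)
      then have "exp (k * \<omega> (norm p)) * cmod (u t * atom a p q t) \<le> C * exp (\<mu> * \<omega> (norm t)) * exp (norm (t - p)) * (cmod (u t) * exp (- a * (norm (t - p))\<^sup>2))"
        by (simp add: norm_mult norm_atom mult_right_mono)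
      also have "\<dots> = C * (exp (\<mu> * \<omega> (norm t)) * cmod (u t)) * (exp (1 * norm (t - p)) * exp (- a * (norm (t - p))\<^sup>2))"
        by (simp add: mult_ac)
      also have "\<dots> \<le> C * S * (exp (1\<^sup>2 / (2 * a)) * exp (- (a / 2) * (norm (t - p))\<^sup>2))"
      proof -
        have "0 \<le> S" using u[of 0] by (meson exp_ge_zero mult_nonneg_nonneg norm_ge_zero order_trans)
        then show ?thesis using C(1) u[of t]
          by (intro mult_mono[OF mult_left_mono gaussian_beats_exp[OF a]]) auto
      qed
      finally show ?thesis by (simp add: mult_ac)
    qed
    have I: "integrable lborel (\<lambda>t. S * C * exp (1 / (2 * a)) * exp (- (a / 2) * (norm (t - p))\<^sup>2))"
      using a by (intro integrable_mult_right integrable_gaussian) simp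
    have "exp (k * \<omega> (norm p)) * cmod (LINT t|lborel. u t * atom a p q t)
       = norm (LINT t|lborel. complex_of_real (exp (k * \<omega> (norm p))) * (u t * atom a p q t))"
      by (simp add: norm_mult integral_mult_right_zero)
    also have "\<dots> \<le> (LINT t|lborel. S * C * exp (1 / (2 * a)) * exp (- (a / 2) * (norm (t - p))\<^sup>2))"
      using b by (intro norm_integral_le[OF _ I] integrable_dominated[OF I] AE_I2)
         (auto simp: norm_mult intro: order_trans[OF _ abs_ge_self])
    also have "\<dots> = D * S"
      using integral_gaussian[of "a / 2" p] a by (simp add: D_def)
    finally show "exp (k * \<omega> (norm p)) * cmod (LINT t|lborel. u t * atom a p q t) \<le> D * S" .
  qed (use C in auto)
qed

definition stft :: "(real^'d::finite \<Rightarrow> complex) \<Rightarrow> (real^'d) \<times> (real^'d) \<Rightarrow> complex" where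
  "stft f z = bracket f (time_freq_shift z gaussian)"

lemma time_freq_shift_gaussian: "time_freq_shift z gaussian = atom 1 (fst z) (snd z)"
  by (auto simp: time_freq_shift_def gaussian_def atom_def fun_eq_iff)

lemma cnj_atom: "cnj (atom a p q t) = atom a p (- q) t"
  by (simp add: atom_def exp_cnj)

lemma stft_eq: "stft f z = (LINT t|lborel. f t * atom 1 (fst z) (- snd z) t)"
  by (simp add: stft_def bracket_def time_freq_shift_gaussian cnj_atom)

lemma measurable_stft [measurable]:
  assumes [measurable]: "f \<in> borel_measurable borel"
  shows "stft f \<in> borel_measurable borel"
proof -
  have "(\<lambda>z. LINT t|lborel. f t * atom 1 (fst z) (- snd z) t) \<in> borel_measurable borel"
    by (rule lborel.borel_measurable_lebesgue_integral) measurable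
  then show ?thesis by (simp add: stft_eq[abs_def])
qed

text \<open>The view from the frequency side: it makes decay of the Fourier
transform visible as decay in the second phase space variable.\<close>
lemma stft_fourier:
  fixes f :: "real^'d::finite \<Rightarrow> complex"
  assumes f: "integrable lborel f"
  shows "stft f (x, \<xi>) = exp (- (\<i> * complex_of_real (x \<bullet> \<xi>))) / complex_of_real (sqrt (4 * pi) ^ CARD('d))
     * (LINT \<eta>|lborel. fourier f \<eta> * atom (1/4) \<xi> x \<eta>)"
proof -
  let ?c = "complex_of_real (sqrt (4 * pi) ^ CARD('d))"
  let ?e = "exp (- (\<i> * complex_of_real (x \<bullet> \<xi>)))"
  have c: "?c \<noteq> 0" by simp
  have four: "fourier (atom (1/4) \<xi> x) t = ?c * exp (\<i> * complex_of_real (\<xi> \<bullet> (x - t))) * complex_of_real (exp (- (norm (t - x))\<^sup>2))" for t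
    using fourier_atom[of "1/4" \<xi> x t] by (simp add: mult.commute[of pi])
  have "atom 1 x (- \<xi>) t = ?e / ?c * fourier (atom (1/4) \<xi> x) t" for t
    unfolding four using c
    by (simp add: atom_def inner_diff_right inner_commute algebra_simps flip: exp_add)
  then have "stft f (x, \<xi>) = (LINT t|lborel. ?e / ?c * (f t * fourier (atom (1/4) \<xi> x) t))"
    by (simp add: stft_eq mult_ac)
  also have "\<dots> = ?e / ?c * (LINT t|lborel. f t * fourier (atom (1/4) \<xi> x) t)"
    by (rule integral_mult_right_zero)
  also have "(LINT t|lborel. f t * fourier (atom (1/4) \<xi> x) t) = (LINT \<eta>|lborel. fourier f \<eta> * atom (1/4) \<xi> x \<eta>)"
    by (rule fourier_multiplication[OF f integrable_atom]) simp
  finally show ?thesis .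
qed

text \<open>Continuity of the analysis operator. Decay of \<open>f\<close> gives decay of the short-time Fourier transform in
the time variable, decay of the Fourier transform of \<open>f\<close> gives it in the frequency variable, and one of the two
variables carries at least half of \<open>|z|\<close>.\<close>
lemma stft_decay:
  fixes \<omega> :: "real \<Rightarrow> real"
  assumes w: "weight_function \<omega>" and k: "k > 0"
  obtains C \<mu> \<nu> where "C > 0" "\<mu> > 0" "\<nu> > 0"
    "\<And>(f :: real^'d::finite \<Rightarrow> complex) z. f \<in> S_omega \<omega> \<Longrightarrow>
       exp (k * \<omega> (norm z)) * cmod (stft f z) \<le> C * (S_seminorm \<omega> \<mu> (\<lambda>_. 0) f + S_seminorm \<omega> \<nu> (\<lambda>_. 0) (fourier f))"
proof -
  obtain L where L: "L \<ge> 1" "\<And>t. t \<ge> 0 \<Longrightarrow> \<omega> (2 * t) \<le> L * (\<omega> t + 1)"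
    using weight_doubling[OF w] by blast
  have kL: "k * L > 0" using k L by simp
  obtain C1 \<mu> where C1: "C1 > 0" "\<mu> > 0"
    "\<And>(u :: real^'d \<Rightarrow> complex) S p q. u \<in> borel_measurable borel \<Longrightarrow>
       (\<And>t. exp (\<mu> * \<omega> (norm t)) * cmod (u t) \<le> S) \<Longrightarrow>
       exp (k * L * \<omega> (norm p)) * cmod (LINT t|lborel. u t * atom 1 p q t) \<le> C1 * S"
    using gaussian_average_decay[OF w kL zero_less_one] by blast
  obtain C2 \<nu> where C2: "C2 > 0" "\<nu> > 0"
    "\<And>(u :: real^'d \<Rightarrow> complex) S p q. u \<in> borel_measurable borel \<Longrightarrow>
       (\<And>t. exp (\<nu> * \<omega> (norm t)) * cmod (u t) \<le> S) \<Longrightarrow>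
       exp (k * L * \<omega> (norm p)) * cmod (LINT t|lborel. u t * atom (1/4) p q t) \<le> C2 * S"
    using gaussian_average_decay[OF w kL, of "1/4"] by auto
  define C where "C = exp (k * L) * (C1 + C2 / sqrt (4 * pi) ^ CARD('d))"
  show ?thesis
  proof (rule that[of C \<mu> \<nu>])
    show "C > 0" using C1 C2 by (simp add: C_def add_pos_pos)
    fix f :: "real^'d \<Rightarrow> complex" and z :: "(real^'d) \<times> (real^'d)"
    assume f: "f \<in> S_omega \<omega>"
    then have fi: "integrable lborel f" and m: "f \<in> borel_measurable borel" "fourier f \<in> borel_measurable borel"
      by (auto simp: S_omega_def intro!: borel_measurable_continuous_onI dest: C_infinity_continuous)
    let ?S1 = "S_seminorm \<omega> \<mu> (\<lambda>_. 0) f" and ?S2 = "S_seminorm \<omega> \<nu> (\<lambda>_. 0) (fourier f)"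
    obtain x \<xi> where z: "z = (x, \<xi>)" by (cases z)
    have b1: "exp (k * L * \<omega> (norm x)) * cmod (stft f z) \<le> C1 * ?S1"
      using C1(3)[OF m(1) S_seminorm_upper(1)[OF f C1(2), of _ "\<lambda>_. 0", unfolded multi_deriv_0], of x "- \<xi>"]
      by (simp add: stft_eq z)
    have "exp (k * L * \<omega> (norm \<xi>)) * cmod (LINT \<eta>|lborel. fourier f \<eta> * atom (1/4) \<xi> x \<eta>) \<le> C2 * ?S2"
      by (rule C2(3)[OF m(2) S_seminorm_upper(2)[OF f C2(2), of _ "\<lambda>_. 0", unfolded multi_deriv_0]])
    then have b2: "exp (k * L * \<omega> (norm \<xi>)) * cmod (stft f z) \<le> C2 / sqrt (4 * pi) ^ CARD('d) * ?S2"
      unfolding z stft_fourier[OF fi] by (simp add: norm_mult norm_divide norm_power divide_right_mono)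
    have S: "?S1 \<ge> 0" "?S2 \<ge> 0"
      using S_seminorm_upper[OF f C1(2), of 0 "\<lambda>_. 0"] S_seminorm_upper[OF f C2(2), of 0 "\<lambda>_. 0"]
      by (meson exp_ge_zero mult_nonneg_nonneg norm_ge_zero order_trans)+
    have "\<omega> (norm z) \<le> L * (\<omega> (norm x) + 1) \<or> \<omega> (norm z) \<le> L * (\<omega> (norm \<xi>) + 1)"
      unfolding z by (intro weight_add[OF w L]) (auto simp: norm_Pair_le)
    moreover have "exp (k * \<omega> (norm z)) * cmod (stft f z) \<le> exp (k * L) * B"
      if v: "\<omega> (norm z) \<le> L * (v + 1)" and B: "exp (k * L * v) * cmod (stft f z) \<le> B" for v B
    proof -
      have "k * \<omega> (norm z) \<le> k * (L * (v + 1))" using v k by simp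
      then have "exp (k * \<omega> (norm z)) \<le> exp (k * L) * exp (k * L * v)"
        by (simp add: algebra_simps flip: exp_add)
      then have "exp (k * \<omega> (norm z)) * cmod (stft f z) \<le> exp (k * L) * (exp (k * L * v) * cmod (stft f z))"
        by (simp add: mult_right_mono flip: mult.assoc)
      also have "\<dots> \<le> exp (k * L) * B" using B by simp
      finally show ?thesis .
    qed
    moreover have "C1 * ?S1 \<ge> 0" "C2 / sqrt (4 * pi) ^ CARD('d) * ?S2 \<ge> 0" using C1(1) C2(1) S by auto
    then have "C1 * ?S1 \<le> C1 * ?S1 + C2 / sqrt (4 * pi) ^ CARD('d) * ?S2"
      "C2 / sqrt (4 * pi) ^ CARD('d) * ?S2 \<le> C1 * ?S1 + C2 / sqrt (4 * pi) ^ CARD('d) * ?S2" by linarith+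
    ultimately have "exp (k * \<omega> (norm z)) * cmod (stft f z) \<le> exp (k * L) * (C1 * ?S1 + C2 / sqrt (4 * pi) ^ CARD('d) * ?S2)"
      using order_trans[OF b1] order_trans[OF b2] by blast
    also have "\<dots> \<le> C * (?S1 + ?S2)"
    proof -
      define D where "D = C2 / sqrt (4 * pi) ^ CARD('d)"
      have "D \<ge> 0" using C2(1) by (simp add: D_def)
      then have "C1 * ?S1 + D * ?S2 \<le> (C1 + D) * (?S1 + ?S2)"
        using C1(1) S mult_nonneg_nonneg[of C1 ?S2] mult_nonneg_nonneg[of D ?S1] by (simp add: algebra_simps)
      then have "exp (k * L) * (C1 * ?S1 + D * ?S2) \<le> exp (k * L) * ((C1 + D) * (?S1 + ?S2))"
        by (rule mult_left_mono) simp
      then show ?thesis by (simp only: C_def D_def mult.assoc)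
    qed
    finally show "exp (k * \<omega> (norm z)) * cmod (stft f z) \<le> C * (?S1 + ?S2)" .
  qed (use C1 C2 in auto)
qed

section \<open>Synthesis and inversion of the short-time Fourier transform\<close>

text \<open>Logarithmic lower growth of \<open>\<omega>\<close> makes a large exponential weight dominate any power of \<open>1 + |z|\<close>.\<close>
lemma integrable_exp_neg_weight:
  assumes w: "weight_function \<omega>"
  obtains k where "k > 0" "integrable lborel (\<lambda>z::'a::euclidean_space. exp (- k * \<omega> (norm z)))"
proof -
  obtain C k where C: "C > 0" "k > 0" "\<And>t. t \<ge> 0 \<Longrightarrow> (1 + t) ^ (2 * DIM('a)) \<le> C * exp (k * \<omega> t)"
    using weight_polynomial[OF w] by blast
  have b: "exp (- k * \<omega> (norm z)) \<le> C * (1 / (1 + (norm z)\<^sup>2) ^ DIM('a))" for z :: 'a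
  proof -
    have "(1 + (norm z)\<^sup>2) ^ DIM('a) \<le> ((1 + norm z)\<^sup>2) ^ DIM('a)"
      by (intro power_mono) (auto simp: power2_sum)
    also have "\<dots> \<le> C * exp (k * \<omega> (norm z))"
      using C(3)[of "norm z"] by (simp add: power_mult)
    finally show ?thesis by (simp add: exp_minus field_simps pos_le_divide_eq add_pos_nonneg)
  qed
  have "integrable lborel (\<lambda>z::'a. exp (- k * \<omega> (norm z)))"
  proof (rule integrable_dominated[OF integrable_mult_right[OF integrable_inverse_power, of C]])
    show "(\<lambda>z::'a. exp (- k * \<omega> (norm z))) \<in> borel_measurable lborel"
      using weight_norm_measurable[OF w, measurable] by measurable
    show "AE z in lborel. norm (exp (- k * \<omega> (norm z))) \<le> norm (C * (1 / (1 + (norm (z::'a))\<^sup>2) ^ DIM('a)))"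
      using b C(1) by (intro AE_I2) (auto simp: abs_of_pos)
  qed
  then show ?thesis using that C by blast
qed

text \<open>The adjoint of the short-time Fourier transform.\<close>
definition synth :: "((real^'d::finite) \<times> (real^'d) \<Rightarrow> complex) \<Rightarrow> real^'d \<Rightarrow> complex" where
  "synth H t = (LINT z|lborel. H z * atom 1 (fst z) (snd z) t)"

lemma integrable_mult_atom:
  assumes H: "integrable lborel H"
  shows "integrable lborel (\<lambda>z. H z * atom 1 (fst z) (snd z) t)"
proof (rule integrable_dominated[OF integrable_norm[OF H]])
  have [measurable]: "H \<in> borel_measurable borel" using H by auto
  show "(\<lambda>z. H z * atom 1 (fst z) (snd z) t) \<in> borel_measurable lborel" by measurable
  show "AE z in lborel. norm (H z * atom 1 (fst z) (snd z) t) \<le> norm (norm (H z))"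
    by (intro AE_I2) (simp add: norm_mult mult_left_le norm_atom_le_1)
qed

lemma synth_bounded:
  assumes H: "integrable lborel H"
  shows "cmod (synth H t) \<le> (LINT z|lborel. cmod (H z))"
  unfolding synth_def
  by (rule norm_integral_le[OF integrable_mult_atom[OF H] integrable_norm[OF H]])
    (simp add: norm_mult mult_left_le norm_atom_le_1)

lemma synth_pairing:
  fixes H :: "(real^'d::finite) \<times> (real^'d) \<Rightarrow> complex"
  assumes H: "integrable lborel H" and b: "b \<in> borel_measurable borel" "\<And>t. cmod (b t) \<le> B"
  shows "(LINT t|lborel. synth H t * b t) = (LINT z|lborel. H z * (LINT t|lborel. atom 1 (fst z) (snd z) t * b t))"
    and "integrable lborel (\<lambda>t. synth H t * b t)"
proof -
  note [measurable] = b(1)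
  have [measurable]: "H \<in> borel_measurable borel" using H by auto
  have I: "integrable lborel (\<lambda>t. H z * atom 1 (fst z) (snd z) t * b t)" for z
  proof (rule integrable_dominated)
    show "integrable lborel (\<lambda>t. cmod (H z) * cmod (atom 1 (fst z) (snd z) t) * B)"
      by (intro integrable_mult_left integrable_mult_right integrable_norm integrable_atom) simp
    show "AE t in lborel. norm (H z * atom 1 (fst z) (snd z) t * b t) \<le> norm (cmod (H z) * cmod (atom 1 (fst z) (snd z) t) * B)"
      using b(2) by (intro AE_I2) (auto simp: norm_mult intro!: mult_left_mono intro: order_trans[OF _ abs_ge_self])
  qed measurable
  have bd: "(LINT t|lborel. cmod (H z * atom 1 (fst z) (snd z) t * b t)) \<le> cmod (H z) * (sqrt pi ^ CARD('d) * B)" for z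
  proof -
    have "(LINT t|lborel. cmod (H z * atom 1 (fst z) (snd z) t * b t)) \<le> (LINT t|lborel. cmod (H z) * B * exp (- 1 * (norm (t - fst z))\<^sup>2))"
    proof (intro integral_mono integrable_norm I integrable_mult_right integrable_gaussian)
      fix t
      show "cmod (H z * atom 1 (fst z) (snd z) t * b t) \<le> cmod (H z) * B * exp (- 1 * (norm (t - fst z))\<^sup>2)"
        using mult_left_mono[OF b(2)[of t], of "cmod (H z) * exp (- 1 * (norm (t - fst z))\<^sup>2)"]
        by (simp add: norm_mult norm_atom mult_ac)
    qed simp
    also have "\<dots> = cmod (H z) * (sqrt pi ^ CARD('d) * B)"
      using integral_gaussian[of 1 "fst z"] by simp
    finally show ?thesis .
  qed
  have m: "(\<lambda>(z, t). H z * atom 1 (fst z) (snd z) t * b t) \<in> borel_measurable (lborel \<Otimes>\<^sub>M lborel)"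
    by measurable
  note F = Fubini_bound[OF m integrable_mult_left[OF integrable_norm[OF H]] I bd]
  have eq: "synth H t * b t = (LINT z|lborel. H z * atom 1 (fst z) (snd z) t * b t)" for t
    unfolding synth_def by (rule integral_mult_left_zero[symmetric])
  show "integrable lborel (\<lambda>t. synth H t * b t)" unfolding eq by (rule F(2))
  have "(LINT t|lborel. synth H t * b t) = (LINT z|lborel. LINT t|lborel. H z * atom 1 (fst z) (snd z) t * b t)"
    unfolding eq by (rule F(1)[symmetric])
  also have "\<dots> = (LINT z|lborel. H z * (LINT t|lborel. atom 1 (fst z) (snd z) t * b t))"
    by (simp add: mult.assoc)
  finally show "(LINT t|lborel. synth H t * b t) = (LINT z|lborel. H z * (LINT t|lborel. atom 1 (fst z) (snd z) t * b t))" .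
qed

lemma integrable_synth: "integrable lborel H \<Longrightarrow> integrable lborel (synth H)"
  using synth_pairing(2)[of H "\<lambda>_. 1" 1] by simp

lemma S_omega_basic:
  assumes "f \<in> S_omega \<omega>"
  shows "integrable lborel f" "continuous_on UNIV f" "f \<in> borel_measurable borel"
  using assms by (auto simp: S_omega_def intro!: borel_measurable_continuous_onI dest: C_infinity_continuous)

lemma S_omega_bounded:
  assumes "f \<in> S_omega \<omega>" and w: "weight_function \<omega>"
  shows "cmod (f t) \<le> S_seminorm \<omega> 1 (\<lambda>_. 0) f"
proof -
  have "1 * cmod (f t) \<le> exp (1 * \<omega> (norm t)) * cmod (f t)"
    using weight_nonneg[OF w, of "norm t"] by (intro mult_right_mono) auto
  also have "\<dots> \<le> S_seminorm \<omega> 1 (\<lambda>_. 0) f"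
    using S_seminorm_upper(1)[OF assms(1), of 1 t "\<lambda>_. 0"] by (simp add: multi_deriv_0)
  finally show ?thesis by simp
qed

lemma stft_S_omega_decay:
  fixes f :: "real^'d::finite \<Rightarrow> complex"
  assumes w: "weight_function \<omega>" and f: "f \<in> S_omega \<omega>"
  obtains C where "C \<ge> 0" "\<And>z. exp (k * \<omega> (norm z)) * cmod (stft f z) \<le> C"
proof -
  have k: "max k 1 > 0" by simp
  obtain C \<mu> \<nu> where C: "C > 0" "\<mu> > 0" "\<nu> > 0"
    "\<And>(f :: real^'d \<Rightarrow> complex) z. f \<in> S_omega \<omega> \<Longrightarrow>
       exp (max k 1 * \<omega> (norm z)) * cmod (stft f z) \<le> C * (S_seminorm \<omega> \<mu> (\<lambda>_. 0) f + S_seminorm \<omega> \<nu> (\<lambda>_. 0) (fourier f))"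
    by (rule stft_decay[OF w k, where 'd='d]) (rule that, assumption+)
  let ?D = "C * (S_seminorm \<omega> \<mu> (\<lambda>_. 0) f + S_seminorm \<omega> \<nu> (\<lambda>_. 0) (fourier f))"
  have *: "exp (k * \<omega> (norm z)) * cmod (stft f z) \<le> ?D" for z
  proof -
    have "exp (k * \<omega> (norm z)) * cmod (stft f z) \<le> exp (max k 1 * \<omega> (norm z)) * cmod (stft f z)"
    proof -
      have "k * \<omega> (norm z) \<le> max k 1 * \<omega> (norm z)"
        by (rule mult_right_mono[OF max.cobounded1 weight_nonneg[OF w norm_ge_zero]])
      then have "exp (k * \<omega> (norm z)) \<le> exp (max k 1 * \<omega> (norm z))" by (rule exp_le_cancel_iff[THEN iffD2])
      then show ?thesis by (rule mult_right_mono) simp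
    qed
    then show ?thesis using C(4)[OF f, of z] by simp
  qed
  have "?D \<ge> 0" using *[of 0] by (meson exp_ge_zero mult_nonneg_nonneg norm_ge_zero order_trans)
  then show ?thesis using that * by blast
qed

lemma integrable_weighted_stft:
  fixes f :: "real^'d::finite \<Rightarrow> complex"
  assumes w: "weight_function \<omega>" and f: "f \<in> S_omega \<omega>"
  shows "integrable lborel (\<lambda>z. exp (k * \<omega> (norm z)) * cmod (stft f z))"
proof -
  obtain l where l: "l > 0" "integrable lborel (\<lambda>z::(real^'d) \<times> (real^'d). exp (- l * \<omega> (norm z)))"
    using integrable_exp_neg_weight[OF w] by blast
  obtain C where C: "C \<ge> 0" "\<And>z. exp ((k + l) * \<omega> (norm z)) * cmod (stft f z) \<le> C"
    using stft_S_omega_decay[OF w f] by blast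
  have b: "exp (k * \<omega> (norm z)) * cmod (stft f z) \<le> C * exp (- l * \<omega> (norm z))" for z
  proof -
    have "exp (k * \<omega> (norm z)) * cmod (stft f z) = (exp ((k + l) * \<omega> (norm z)) * cmod (stft f z)) * exp (- l * \<omega> (norm z))"
    proof -
      have "exp (k * \<omega> (norm z)) = exp ((k + l) * \<omega> (norm z)) * exp (- l * \<omega> (norm z))"
        by (simp add: algebra_simps flip: exp_add)
      then show ?thesis by (simp only: mult_ac)
    qed
    then show ?thesis using mult_right_mono[OF C(2)[of z], of "exp (- l * \<omega> (norm z))"] by (simp only: exp_ge_zero simp_thms)
  qed
  show ?thesis
  proof (rule integrable_dominated[OF integrable_mult_right[OF l(2), of C]])
    show "(\<lambda>z. exp (k * \<omega> (norm z)) * cmod (stft f z)) \<in> borel_measurable lborel"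
      using weight_norm_measurable[OF w, measurable] S_omega_basic(3)[OF f, measurable] by measurable
    show "AE z in lborel. norm (exp (k * \<omega> (norm z)) * cmod (stft f z)) \<le> norm (C * exp (- l * \<omega> (norm z)))"
      using b by (intro AE_I2) (auto intro: order_trans[OF _ abs_ge_self])
  qed
qed

lemma integrable_stft:
  assumes w: "weight_function \<omega>" and f: "f \<in> S_omega \<omega>"
  shows "integrable lborel (stft f)"
proof -
  have "integrable lborel (\<lambda>z. norm (stft f z))" using integrable_weighted_stft[OF w f, of 0] by simp
  then show ?thesis using S_omega_basic(3)[OF f, measurable] by (subst (asm) integrable_norm_iff) auto
qed

text \<open>For fixed \<open>x\<close> the function \<open>\<xi> \<mapsto> stft f (x, \<xi>)\<close> is the Fourier transform of \<open>f\<close> times the window at \<open>x\<close>.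
Inverting it recovers this product, and multiplying by the window once more and integrating in \<open>x\<close>
leaves a multiple of \<open>f\<close>, the factor being the squared norm of the window times \<open>(2 pi)\<close> to the dimension.\<close>
theorem stft_inversion:
  fixes f :: "real^'d::finite \<Rightarrow> complex"
  assumes w: "weight_function \<omega>" and f: "f \<in> S_omega \<omega>"
  shows "synth (stft f) t = complex_of_real ((2 * pi) ^ CARD('d) * sqrt (pi / 2) ^ CARD('d)) * f t"
proof -
  note S = S_omega_basic[OF f]
  note [measurable] = S(3)
  let ?h = "\<lambda>x s. f s * atom 1 x 0 s"
  have h: "fourier (?h x) \<xi> = stft f (x, \<xi>)" for x \<xi>
    unfolding fourier_def stft_eq
    by (intro Bochner_Integration.integral_cong refl) (simp add: atom_def mult_ac flip: exp_add)
  have hI: "integrable lborel (?h x)" for x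
    by (rule integrable_dominated[OF integrable_norm[OF S(1)]])
      (auto simp: norm_mult mult_left_le norm_atom_le_1)
  have hC: "continuous_on UNIV (?h x)" for x
    unfolding atom_def by (intro continuous_intros S(2))
  have hB: "cmod (?h x s) \<le> S_seminorm \<omega> 1 (\<lambda>_. 0) f" for x s
    using S_omega_bounded[OF f w, of s] norm_atom_le_1[of 1 x 0 s]
    by (simp add: norm_mult) (meson mult_left_le norm_ge_zero order_trans)
  have FI: "integrable lborel (fourier (?h x))" for x
  proof -
    obtain l where l: "l > 0" "integrable lborel (\<lambda>z::real^'d. exp (- l * \<omega> (norm z)))"
      using integrable_exp_neg_weight[OF w] by blast
    obtain C where C: "C \<ge> 0" "\<And>z. exp (l * \<omega> (norm z)) * cmod (stft f z) \<le> C"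
      using stft_S_omega_decay[OF w f] by blast
    show ?thesis
    proof (rule integrable_dominated[OF integrable_mult_right[OF l(2), of C]])
      show "fourier (?h x) \<in> borel_measurable lborel" unfolding h by measurable
      show "AE \<xi> in lborel. norm (fourier (?h x) \<xi>) \<le> norm (C * exp (- l * \<omega> (norm \<xi>)))"
      proof (intro AE_I2)
        fix \<xi> :: "real^'d"
        have "norm \<xi> \<le> norm (x, \<xi>)" by (metis norm_snd_le snd_conv)
        then have "exp (l * \<omega> (norm \<xi>)) * cmod (stft f (x, \<xi>)) \<le> exp (l * \<omega> (norm (x, \<xi>))) * cmod (stft f (x, \<xi>))"
          using l(1) weight_mono[OF w, of "norm \<xi>" "norm (x, \<xi>)"] by (intro mult_right_mono) auto
        then have "exp (l * \<omega> (norm \<xi>)) * cmod (stft f (x, \<xi>)) \<le> C" using C(2)[of "(x, \<xi>)"] by simp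
        then show "norm (fourier (?h x) \<xi>) \<le> norm (C * exp (- l * \<omega> (norm \<xi>)))"
          unfolding h using C(1) by (simp add: exp_minus field_simps)
      qed
    qed
  qed
  let ?H = "\<lambda>z. stft f z * atom 1 (fst z) (snd z) t"
  have I: "integrable (lborel \<Otimes>\<^sub>M lborel) ?H"
    unfolding lborel_prod by (rule integrable_mult_atom[OF integrable_stft[OF w f]])
  have "synth (stft f) t = (LINT x|lborel. LINT \<xi>|lborel. ?H (x, \<xi>))"
    using lborel_pair.integral_fst'[OF I] by (simp add: synth_def lborel_prod)
  also have "\<dots> = (LINT x|lborel. complex_of_real (exp (- (norm (t - x))\<^sup>2)) * (complex_of_real ((2 * pi) ^ CARD('d)) * ?h x t))"
  proof (intro Bochner_Integration.integral_cong refl)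
    fix x :: "real^'d"
    have "(LINT \<xi>|lborel. ?H (x, \<xi>)) = (LINT \<xi>|lborel. complex_of_real (exp (- (norm (t - x))\<^sup>2)) * (fourier (?h x) \<xi> * exp (\<i> * complex_of_real (t \<bullet> \<xi>))))"
      unfolding h by (simp add: atom_def mult_ac)
    also have "\<dots> = complex_of_real (exp (- (norm (t - x))\<^sup>2)) * (LINT \<xi>|lborel. fourier (?h x) \<xi> * exp (\<i> * complex_of_real (t \<bullet> \<xi>)))"
      by (rule integral_mult_right_zero)
    finally show "(LINT \<xi>|lborel. ?H (x, \<xi>)) = complex_of_real (exp (- (norm (t - x))\<^sup>2)) * (complex_of_real ((2 * pi) ^ CARD('d)) * ?h x t)"
      unfolding fourier_inversion[OF hC hB hI FI] .
  qed
  also have "\<dots> = (LINT x|lborel. (complex_of_real ((2 * pi) ^ CARD('d)) * f t) * complex_of_real (exp (- 2 * (norm (x - t))\<^sup>2)))"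
    by (intro Bochner_Integration.integral_cong refl)
      (simp add: atom_def norm_minus_commute mult_ac flip: of_real_mult exp_add)
  also have "\<dots> = (complex_of_real ((2 * pi) ^ CARD('d)) * f t) * complex_of_real (LINT x|lborel. exp (- 2 * (norm (x - t))\<^sup>2))"
    by (subst integral_mult_right_zero) (simp only: integral_complex_of_real)
  also have "\<dots> = complex_of_real ((2 * pi) ^ CARD('d) * sqrt (pi / 2) ^ CARD('d)) * f t"
    by (subst integral_gaussian) (auto simp: mult_ac)
  finally show ?thesis .
qed

section \<open>Reproducing kernel and Schur test\<close>

text \<open>The reproducing kernel of the Gaussian short-time Fourier transform is Gaussian in the phase space
distance: the product of two Gaussians at \<open>x\<close> and \<open>y\<close> is a narrower Gaussian at the midpoint times
\<open>exp (- |x - y|\<^sup>2 / 2)\<close>, and the Fourier transform of the former supplies the decay in frequency.\<close>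
lemma stft_atom_bound:
  fixes z w :: "(real^'d::finite) \<times> (real^'d)"
  shows "cmod (LINT t|lborel. atom 1 (fst z) (snd z) t * atom 1 (fst w) (- snd w) t)
           \<le> sqrt (pi / 2) ^ CARD('d) * exp (- (norm (z - w))\<^sup>2 / 8)"
proof -
  obtain x \<xi> where z: "z = (x, \<xi>)" by (cases z)
  obtain y \<eta> where w: "w = (y, \<eta>)" by (cases w)
  define c where "c = (1/2) *\<^sub>R (x + y)"
  have sq: "(norm (t - x))\<^sup>2 + (norm (t - y))\<^sup>2 = 2 * (norm (t - c))\<^sup>2 + (norm (x - y))\<^sup>2 / 2" for t
    unfolding power2_norm_eq_inner c_def
    by (simp add: inner_add_left inner_add_right inner_diff_left inner_diff_right inner_commute field_simps)
  have "atom 1 x \<xi> t * atom 1 y (- \<eta>) t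
      = complex_of_real (exp (- (norm (x - y))\<^sup>2 / 2)) * (atom 2 c \<xi> t * exp (- (\<i> * complex_of_real (t \<bullet> \<eta>))))" for t
  proof -
    have "exp (- (norm (t - x))\<^sup>2) * exp (- (norm (t - y))\<^sup>2) = exp (- ((norm (t - x))\<^sup>2 + (norm (t - y))\<^sup>2))"
      by (simp flip: exp_add)
    also have "\<dots> = exp (- 2 * (norm (t - c))\<^sup>2) * exp (- (norm (x - y))\<^sup>2 / 2)"
      unfolding sq by (simp flip: exp_add)
    finally show ?thesis unfolding atom_def by (simp add: mult_ac flip: of_real_mult)
  qed
  then have "(LINT t|lborel. atom 1 x \<xi> t * atom 1 y (- \<eta>) t)
      = complex_of_real (exp (- (norm (x - y))\<^sup>2 / 2)) * fourier (atom 2 c \<xi>) \<eta>"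
    unfolding fourier_def by simp
  then have "cmod (LINT t|lborel. atom 1 x \<xi> t * atom 1 y (- \<eta>) t)
     = sqrt (pi / 2) ^ CARD('d) * (exp (- (norm (x - y))\<^sup>2 / 2) * exp (- (norm (\<eta> - \<xi>))\<^sup>2 / 8))"
    by (simp add: fourier_atom norm_mult norm_power)
  also have "\<dots> \<le> sqrt (pi / 2) ^ CARD('d) * exp (- (norm (z - w))\<^sup>2 / 8)"
  proof (intro mult_left_mono)
    have "(norm (z - w))\<^sup>2 = (norm (x - y))\<^sup>2 + (norm (\<eta> - \<xi>))\<^sup>2"
      by (simp add: z w norm_Pair norm_minus_commute[of \<xi>])
    then show "exp (- (norm (x - y))\<^sup>2 / 2) * exp (- (norm (\<eta> - \<xi>))\<^sup>2 / 8) \<le> exp (- (norm (z - w))\<^sup>2 / 8)"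
      by (simp add: field_simps flip: exp_add)
  qed simp
  finally show ?thesis by (simp add: z w)
qed

lemma stft_synth:
  assumes H: "integrable lborel H"
  shows "stft (synth H) w = (LINT z|lborel. H z * (LINT t|lborel. atom 1 (fst z) (snd z) t * atom 1 (fst w) (- snd w) t))"
  unfolding stft_eq by (rule synth_pairing(1)[OF H, of _ 1]) (auto simp: norm_atom_le_1)

text \<open>The energy of a superposition, computed in phase space without Plancherel's theorem: synthesis is
the adjoint of analysis.\<close>
lemma synth_energy:
  assumes H: "integrable lborel H"
  shows "complex_of_real (LINT t|lborel. (cmod (synth H t))\<^sup>2) = (LINT z|lborel. H z * cnj (stft (synth H) z))"
    and "integrable lborel (\<lambda>t. (cmod (synth H t))\<^sup>2)"
proof -
  have [measurable]: "synth H \<in> borel_measurable borel" using integrable_synth[OF H] by auto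
  have m: "(\<lambda>t. cnj (synth H t)) \<in> borel_measurable borel"
    by (rule measurable_compose[OF \<open>synth H \<in> borel_measurable borel\<close>
          borel_measurable_continuous_onI[OF continuous_on_cnj[OF continuous_on_id]]])
  have b: "cmod (cnj (synth H t)) \<le> (LINT z|lborel. cmod (H z))" for t using synth_bounded[OF H] by simp
  note P = synth_pairing[OF H m b]
  have sq: "synth H t * cnj (synth H t) = complex_of_real ((cmod (synth H t))\<^sup>2)" for t
    by (simp only: complex_norm_square)
  have "(LINT t|lborel. atom 1 (fst z) (snd z) t * cnj (synth H t)) = cnj (stft (synth H) z)" for z
  proof -
    have "cnj (stft (synth H) z) = (LINT t|lborel. cnj (synth H t * atom 1 (fst z) (- snd z) t))"
      unfolding stft_eq by (rule Bochner_Integration.integral_cnj[symmetric])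
    then show ?thesis by (simp add: cnj_atom mult.commute)
  qed
  then show "complex_of_real (LINT t|lborel. (cmod (synth H t))\<^sup>2) = (LINT z|lborel. H z * cnj (stft (synth H) z))"
    using P(1) unfolding sq integral_complex_of_real by simp
  show "integrable lborel (\<lambda>t. (cmod (synth H t))\<^sup>2)"
    using P(2) unfolding sq complex_of_real_integrable_eq .
qed

lemma Cauchy_Schwarz_weight:
  fixes G q :: "'a::euclidean_space \<Rightarrow> real"
  assumes G: "G \<in> borel_measurable borel" "\<And>z. \<bar>G z\<bar> \<le> B"
    and q: "integrable lborel q" "\<And>z. q z \<ge> 0" "(LINT z|lborel. q z) > 0"
  shows "integrable lborel (\<lambda>z. G z * q z)" "integrable lborel (\<lambda>z. (G z)\<^sup>2 * q z)"
    and "(LINT z|lborel. G z * q z)\<^sup>2 \<le> (LINT z|lborel. q z) * (LINT z|lborel. (G z)\<^sup>2 * q z)"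
proof -
  note [measurable] = G(1)
  have [measurable]: "q \<in> borel_measurable borel" using q by auto
  show 1: "integrable lborel (\<lambda>z. G z * q z)"
    by (rule integrable_dominated[OF integrable_mult_right[OF q(1), of B]])
      (use G(2) q(2) in \<open>auto simp: abs_mult intro!: AE_I2 mult_right_mono intro: order_trans[OF _ abs_ge_self]\<close>)
  show 2: "integrable lborel (\<lambda>z. (G z)\<^sup>2 * q z)"
  proof (rule integrable_dominated[OF integrable_mult_right[OF q(1), of "B\<^sup>2"]])
    show "AE z in lborel. norm ((G z)\<^sup>2 * q z) \<le> norm (B\<^sup>2 * q z)"
      using abs_le_square_iff[of "G _" B] G(2) q(2)
      by (intro AE_I2) (auto simp: abs_mult intro!: mult_right_mono intro: order_trans[OF _ abs_ge_self])
  qed measurable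
  define Q T where "Q = (LINT z|lborel. q z)" and "T = (LINT z|lborel. G z * q z)"
  have "0 \<le> (LINT z|lborel. (G z - T / Q)\<^sup>2 * q z)"
    using q(2) by (intro integral_nonneg_AE AE_I2) simp
  also have "\<dots> = (LINT z|lborel. (G z)\<^sup>2 * q z - 2 * (T / Q) * (G z * q z) + (T / Q)\<^sup>2 * q z)"
    by (intro Bochner_Integration.integral_cong refl) (simp add: power2_diff algebra_simps)
  also have "\<dots> = (LINT z|lborel. (G z)\<^sup>2 * q z) - 2 * (T / Q) * T + (T / Q)\<^sup>2 * Q"
    unfolding T_def Q_def
    by (subst Bochner_Integration.integral_add Bochner_Integration.integral_diff; (intro integrable_mult_right Bochner_Integration.integrable_diff 1 2 q(1))?)+ simp
  also have "\<dots> = (LINT z|lborel. (G z)\<^sup>2 * q z) - T\<^sup>2 / Q"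
    using q(3) by (simp add: Q_def[symmetric] power2_eq_square field_simps)
  finally have "T\<^sup>2 / Q \<le> (LINT z|lborel. (G z)\<^sup>2 * q z)" by simp
  then show "(LINT z|lborel. G z * q z)\<^sup>2 \<le> (LINT z|lborel. q z) * (LINT z|lborel. (G z)\<^sup>2 * q z)"
    using q(3) unfolding Q_def[symmetric] T_def[symmetric] by (simp add: pos_divide_le_eq mult.commute)
qed

text \<open>Schur's test for convolution with \<open>q\<close>, both for integration over the whole space and for sampling on
a set on which the sums of translates of \<open>q\<close> are uniformly bounded.\<close>
lemma Schur_bounds:
  fixes G q :: "'a::euclidean_space \<Rightarrow> real"
  assumes G: "G \<in> borel_measurable borel" "\<And>z. 0 \<le> G z" "\<And>z. G z \<le> B" "integrable lborel (\<lambda>z. (G z)\<^sup>2)"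
    and q: "integrable lborel q" "\<And>z. q z \<ge> 0" "(LINT z|lborel. q z) > 0" "\<And>z. q (- z) = q z"
  defines "T \<equiv> \<lambda>w. LINT z|lborel. G z * q (z - w)"
  defines "Q \<equiv> LINT z|lborel. q z"
  shows "\<And>w. integrable lborel (\<lambda>z. G z * q (z - w))"
    and "integrable lborel (\<lambda>w. G w * T w)"
    and "(LINT w|lborel. G w * T w) \<le> Q * (LINT z|lborel. (G z)\<^sup>2)"
    and "\<And>S R. finite S \<Longrightarrow> (\<And>z. (\<Sum>\<sigma>\<in>S. q (\<sigma> - z)) \<le> R) \<Longrightarrow> (\<Sum>\<sigma>\<in>S. (T \<sigma>)\<^sup>2) \<le> Q * (R * (LINT z|lborel. (G z)\<^sup>2))"
proof -
  note [measurable] = G(1)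
  have qm[measurable]: "q \<in> borel_measurable borel" using q by auto
  have Gb: "\<bar>G z\<bar> \<le> B" for z using G(2,3) by simp
  have qw: "integrable lborel (\<lambda>z. q (z - w))" "(LINT z|lborel. q (z - w)) = Q" for w
    using lborel_translate[OF qm, of w] q(1) by (auto simp: Q_def)
  have Q: "Q > 0" using q(3) by (simp add: Q_def)
  have qw3: "(LINT z|lborel. q (z - w)) > 0" for w using Q qw by simp
  note CS = Cauchy_Schwarz_weight[OF G(1) Gb qw(1) q(2) qw3]
  show "integrable lborel (\<lambda>z. G z * q (z - w))" for w by (rule CS(1))
  define U where "U = (\<lambda>w. LINT z|lborel. (G z)\<^sup>2 * q (z - w))"
  have TU: "(T w)\<^sup>2 \<le> Q * U w" for w using CS(3)[of w] unfolding T_def U_def qw(2) .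
  have [measurable]: "T \<in> borel_measurable borel"
    unfolding T_def using lborel.borel_measurable_lebesgue_integral[of "\<lambda>w z. G z * q (z - w)" borel] by measurable
  let ?k = "\<lambda>z w. (G z)\<^sup>2 * q (z - w)"
  have sw: "q (z - w) = q (w - z)" for z w using q(4)[of "z - w"] by simp
  have I1: "integrable lborel (?k z)" for z
    unfolding sw by (intro integrable_mult_right qw(1))
  have b1: "(LINT w|lborel. norm (?k z w)) \<le> (G z)\<^sup>2 * Q" for z
    unfolding sw using qw(2)[of z] q(2) by (simp add: abs_mult)
  have m: "(\<lambda>(z, w). ?k z w) \<in> borel_measurable (lborel \<Otimes>\<^sub>M lborel)" by measurable
  note F = Fubini_bound[OF m integrable_mult_left[OF G(4)] I1 b1]
  have U: "integrable lborel U" unfolding U_def by (rule F(2))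
  have iU: "(LINT w|lborel. U w) = Q * (LINT z|lborel. (G z)\<^sup>2)"
  proof -
    have *: "(LINT w|lborel. ?k z w) = Q * (G z)\<^sup>2" for z
      unfolding sw[of z] by (simp add: qw(2))
    show ?thesis unfolding U_def F(1)[symmetric] * by (rule integral_mult_right_zero)
  qed
  have T0: "T w \<ge> 0" for w unfolding T_def using G(2) q(2) by simp
  have GT: "G w * T w \<le> (Q * (G w)\<^sup>2 + U w) / 2" for w
  proof -
    have "0 \<le> (Q * G w - T w)\<^sup>2" by simp
    also have "\<dots> \<le> Q * (Q * (G w)\<^sup>2 - 2 * (G w * T w) + U w)"
      using TU[of w] by (simp add: power2_diff power2_eq_square algebra_simps)
    finally show ?thesis using Q by (simp add: zero_le_mult_iff)
  qed
  have I2: "integrable lborel (\<lambda>w. (Q * (G w)\<^sup>2 + U w) / 2)"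
    by (intro integrable_divide Bochner_Integration.integrable_add integrable_mult_right G(4) U)
  show I3: "integrable lborel (\<lambda>w. G w * T w)"
    by (rule integrable_dominated[OF I2])
      (use GT G(2) T0 in \<open>auto intro!: AE_I2 intro: order_trans[OF _ abs_ge_self]\<close>)
  have "(LINT w|lborel. G w * T w) \<le> (LINT w|lborel. (Q * (G w)\<^sup>2 + U w) / 2)"
    by (rule integral_mono[OF I3 I2 GT])
  also have "\<dots> = Q * (LINT z|lborel. (G z)\<^sup>2)"
    using G(4) U by (simp add: iU)
  finally show "(LINT w|lborel. G w * T w) \<le> Q * (LINT z|lborel. (G z)\<^sup>2)" .
  show "(\<Sum>\<sigma>\<in>S. (T \<sigma>)\<^sup>2) \<le> Q * (R * (LINT z|lborel. (G z)\<^sup>2))"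
    if S: "finite S" "\<And>z. (\<Sum>\<sigma>\<in>S. q (\<sigma> - z)) \<le> R" for S R
  proof -
    have "(\<Sum>\<sigma>\<in>S. (T \<sigma>)\<^sup>2) \<le> (\<Sum>\<sigma>\<in>S. Q * U \<sigma>)" by (intro sum_mono TU)
    also have "\<dots> = Q * (LINT z|lborel. (\<Sum>\<sigma>\<in>S. (G z)\<^sup>2 * q (z - \<sigma>)))"
      unfolding U_def by (subst Bochner_Integration.integral_sum) (auto intro: CS(2) simp: sum_distrib_left)
    also have "(LINT z|lborel. (\<Sum>\<sigma>\<in>S. (G z)\<^sup>2 * q (z - \<sigma>))) \<le> (LINT z|lborel. (G z)\<^sup>2 * R)"
    proof (intro integral_mono Bochner_Integration.integrable_sum CS(2) integrable_mult_left G(4))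
      fix z
      show "(\<Sum>\<sigma>\<in>S. (G z)\<^sup>2 * q (z - \<sigma>)) \<le> (G z)\<^sup>2 * R"
        unfolding sw[of z] sum_distrib_left[symmetric] by (intro mult_left_mono S(2)) simp
    qed
    finally show ?thesis using Q by (simp add: mult.commute)
  qed
qed

lemma gabor_lattice_separated:
  assumes "a > 0" "b > 0" and x: "x \<in> gabor_lattice a b" and y: "y \<in> gabor_lattice a b" and ne: "x \<noteq> y"
  shows "dist x y \<ge> min a b"
proof -
  obtain m n where x: "x = (a *\<^sub>R m, b *\<^sub>R n)" and mn: "\<And>i. m $ i \<in> \<int>" "\<And>i. n $ i \<in> \<int>"
    using x unfolding gabor_lattice_def by blast
  obtain m' n' where y: "y = (a *\<^sub>R m', b *\<^sub>R n')" and mn': "\<And>i. m' $ i \<in> \<int>" "\<And>i. n' $ i \<in> \<int>"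
    using y unfolding gabor_lattice_def by blast
  have int1: "1 \<le> norm (u - v)" if uv: "\<And>i. u $ i \<in> \<int>" "\<And>i. v $ i \<in> \<int>" "u \<noteq> v" for u v :: "real^'a"
  proof -
    obtain i where "u $ i \<noteq> v $ i" using uv(3) by (auto simp: vec_eq_iff)
    then have "u $ i - v $ i \<noteq> 0" by simp
    moreover have "u $ i - v $ i \<in> \<int>" using uv by simp
    ultimately have "1 \<le> \<bar>u $ i - v $ i\<bar>" by (metis Ints_nonzero_abs_ge1)
    also have "\<dots> \<le> norm (u - v)" using component_le_norm_cart[of "u - v" i] by simp
    finally show ?thesis .
  qed
  show ?thesis
  proof (cases "m = m'")
    case False
    then have "a * 1 \<le> a * norm (m - m')" using assms(1) int1[OF mn(1) mn'(1)] by (intro mult_left_mono) auto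
    also have "\<dots> = dist (fst x) (fst y)" using assms(1) by (simp add: x y dist_norm flip: scaleR_diff_right)
    also have "\<dots> \<le> dist x y" by (rule dist_fst_le)
    finally show ?thesis by simp
  next
    case True
    then have "n \<noteq> n'" using ne x y by auto
    then have "b * 1 \<le> b * norm (n - n')" using assms(2) int1[OF mn(2) mn'(2)] by (intro mult_left_mono) auto
    also have "\<dots> = dist (snd x) (snd y)" using assms(2) by (simp add: x y dist_norm flip: scaleR_diff_right)
    also have "\<dots> \<le> dist x y" by (rule dist_snd_le)
    finally show ?thesis by simp
  qed
qed

section \<open>Weighted localisation of the frame inequality\<close>

lemma sum_weight_separated:
  fixes \<Lambda> :: "'a::euclidean_space set"
  assumes w: "weight_function \<omega>" and r: "r > 0"
    and sep: "\<And>x y. x \<in> \<Lambda> \<Longrightarrow> y \<in> \<Lambda> \<Longrightarrow> x \<noteq> y \<Longrightarrow> dist x y \<ge> r"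
  obtains l M where "l > 0" "M \<ge> 0" "\<And>S. finite S \<Longrightarrow> S \<subseteq> \<Lambda> \<Longrightarrow> (\<Sum>\<sigma>\<in>S. exp (- l * \<omega> (norm \<sigma>))) \<le> M"
proof -
  obtain k where k: "k > 0" "integrable lborel (\<lambda>z::'a. exp (- k * \<omega> (norm z)))"
    using integrable_exp_neg_weight[OF w] by blast
  obtain C l where C: "C > 0" "l > 0"
    "\<And>x y :: 'a. exp (k * \<omega> (norm (x + y))) \<le> C * exp (l * \<omega> (norm x)) * exp (norm y)"
    using weight_exp_add[OF w k(1)] by blast
  let ?q = "\<lambda>y::'a. C * exp (r / 2) * exp (- k * \<omega> (norm y))"
  have "\<exists>M\<ge>0. \<forall>S. finite S \<longrightarrow> S \<subseteq> \<Lambda> \<longrightarrow> (\<forall>z. (\<Sum>\<sigma>\<in>S. exp (- l * \<omega> (norm (\<sigma> - z)))) \<le> M)"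
  proof (rule sum_separated_le_integral[OF r sep, where q = ?q])
    fix x y :: 'a assume d: "dist x y < r / 2"
    have "exp (k * \<omega> (norm y)) \<le> C * exp (l * \<omega> (norm x)) * exp (norm (y - x))"
      using C(3)[of x "y - x"] by simp
    also have "\<dots> \<le> C * exp (l * \<omega> (norm x)) * exp (r / 2)"
      using d C(1) by (intro mult_left_mono) (auto simp: dist_norm norm_minus_commute)
    finally show "exp (- l * \<omega> (norm x)) \<le> C * exp (r / 2) * exp (- k * \<omega> (norm y))"
      by (simp add: exp_minus field_simps)
  qed (use k C in auto)
  then obtain M where M: "M \<ge> 0"
    "\<forall>S. finite S \<longrightarrow> S \<subseteq> \<Lambda> \<longrightarrow> (\<forall>z. (\<Sum>\<sigma>\<in>S. exp (- l * \<omega> (norm (\<sigma> - z)))) \<le> M)"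
    by (elim exE conjE)
  show ?thesis
  proof (rule that[OF C(2) M(1)])
    show "(\<Sum>\<sigma>\<in>S. exp (- l * \<omega> (norm \<sigma>))) \<le> M" if "finite S" "S \<subseteq> \<Lambda>" for S
      using M(2)[rule_format, OF that, of 0] by simp
  qed
qed

lemma analysis_operator_eq: "\<sigma> \<in> \<Lambda> \<Longrightarrow> analysis_operator gaussian \<Lambda> f \<sigma> = stft f \<sigma>"
  by (simp add: analysis_operator_def stft_def)

lemma analysis_operator_in_Lambda_omega:
  assumes w: "weight_function \<omega>" and f: "f \<in> S_omega \<omega>"
  shows "analysis_operator gaussian \<Lambda> f \<in> Lambda_omega \<omega> \<Lambda>"
proof -
  have "bdd_above ((\<lambda>\<sigma>. cmod (analysis_operator gaussian \<Lambda> f \<sigma>) * exp (real k * \<omega> (norm \<sigma>))) ` \<Lambda>)" for k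
  proof -
    obtain C where "C \<ge> 0" "\<And>z. exp (real k * \<omega> (norm z)) * cmod (stft f z) \<le> C"
      using stft_S_omega_decay[OF w f] by blast
    then show ?thesis by (intro bdd_aboveI[of _ C]) (auto simp: analysis_operator_eq mult.commute)
  qed
  then show ?thesis by (auto simp: Lambda_omega_def analysis_operator_def)
qed

lemma Lambda_norm_upper:
  assumes "c \<in> Lambda_omega \<omega> \<Lambda>" "\<sigma> \<in> \<Lambda>"
  shows "cmod (c \<sigma>) * exp (real k * \<omega> (norm \<sigma>)) \<le> Lambda_norm \<omega> \<Lambda> k c"
  using assms unfolding Lambda_norm_def Lambda_omega_def by (auto intro!: cSUP_upper)

text \<open>Let \<open>k\<close> be the reproducing kernel. Since \<open>c \<cdot> stft f y\<close> is the integral of \<open>stft f z \<cdot> k z y\<close>, analysing the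
superposition with coefficients \<open>H = m \<cdot> stft f\<close> reproduces \<open>c \<cdot> H\<close> up to the integral of
\<open>(m z - m y) \<cdot> stft f z \<cdot> k z y\<close>. Slow variation of \<open>m\<close> bounds \<open>|m z - m y|\<close> by \<open>\<epsilon> \<cdot> m z \<cdot> exp (2 |z - y|)\<close>, and the
Gaussian decay of \<open>k\<close> absorbs the exponential; completing the square produces the constant \<open>exp 16\<close>.\<close>
lemma weighted_localization:
  fixes f :: "real^'d::finite \<Rightarrow> complex" and m :: "(real^'d) \<times> (real^'d) \<Rightarrow> real"
  assumes w: "weight_function \<omega>" and f: "f \<in> S_omega \<omega>"
    and m: "m \<in> borel_measurable borel" "\<And>z. m z > 0" "\<And>z. m z \<le> exp (\<nu> * \<omega> (norm z))"
    and \<epsilon>: "0 < \<epsilon>" "\<epsilon> \<le> 1" and slow: "\<And>z y. m z \<le> m y * exp (\<epsilon> * norm (z - y))"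
  defines "c \<equiv> (2 * pi) ^ CARD('d) * sqrt (pi / 2) ^ CARD('d)"
  defines "H \<equiv> \<lambda>z. complex_of_real (m z) * stft f z"
  defines "T \<equiv> \<lambda>y. LINT z|lborel. cmod (H z) * exp (- (1/16) * (norm (z - y))\<^sup>2)"
  shows "integrable lborel H"
    and "cmod (stft (synth H) y - complex_of_real c * H y) \<le> \<epsilon> * (sqrt (pi / 2) ^ CARD('d) * exp 16) * T y"
proof -
  note [measurable] = m(1) S_omega_basic(3)[OF f]
  have nH: "cmod (H z) = m z * cmod (stft f z)" for z
    using m(2)[of z] by (simp add: H_def norm_mult)
  have H1: "cmod (H z) \<le> exp (\<nu> * \<omega> (norm z)) * cmod (stft f z)" for z
    unfolding nH using m(3) by (intro mult_right_mono) auto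
  show HI: "integrable lborel H"
    by (rule integrable_dominated[OF integrable_weighted_stft[OF w f, of \<nu>]])
      (use H1 in \<open>auto simp: H_def[abs_def] intro!: AE_I2\<close>)
  let ?k = "\<lambda>z. LINT t|lborel. atom 1 (fst z) (snd z) t * atom 1 (fst y) (- snd y) t"
  let ?K = "sqrt (pi / 2) ^ CARD('d)"
  have km [measurable]: "?k \<in> borel_measurable borel"
    using lborel.borel_measurable_lebesgue_integral[of "\<lambda>z t. atom 1 (fst z) (snd z) t * atom 1 (fst y) (- snd y) t" borel]
    by measurable
  have kb: "cmod (?k z) \<le> ?K * exp (- (norm (z - y))\<^sup>2 / 8)" for z by (rule stft_atom_bound)
  have kb1: "cmod (?k z) \<le> ?K" for z
    using kb[of z] by (rule order_trans) (simp add: mult_left_le)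
  have I: "integrable lborel (\<lambda>z. X z * ?k z)" if X: "integrable lborel X" for X
  proof (rule integrable_dominated[OF integrable_mult_right[OF integrable_norm[OF X], of ?K]])
    have [measurable]: "X \<in> borel_measurable borel" using X by auto
    show "(\<lambda>z. X z * ?k z) \<in> borel_measurable lborel" by measurable
    show "AE z in lborel. norm (X z * ?k z) \<le> norm (?K * norm (X z))"
      using kb1 by (intro AE_I2) (auto simp: norm_mult abs_mult mult.commute intro!: mult_left_mono)
  qed
  have rep: "complex_of_real c * stft f y = (LINT z|lborel. stft f z * ?k z)"
  proof -
    have "synth (stft f) = (\<lambda>t. complex_of_real c * f t)"
      using stft_inversion[OF w f] by (auto simp: c_def)
    then have "stft (synth (stft f)) y = complex_of_real c * stft f y"
      by (simp add: stft_eq mult.assoc)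
    then show ?thesis using stft_synth[OF integrable_stft[OF w f], of y] by simp
  qed
  have "stft (synth H) y - complex_of_real c * H y = (LINT z|lborel. H z * ?k z) - complex_of_real (m y) * (LINT z|lborel. stft f z * ?k z)"
    unfolding rep[symmetric] stft_synth[OF HI] by (simp add: H_def)
  also have "\<dots> = (LINT z|lborel. H z * ?k z - complex_of_real (m y) * (stft f z * ?k z))"
    by (subst Bochner_Integration.integral_diff) (auto intro!: I HI integrable_stft[OF w f] integrable_mult_right simp del: integrable_mult_right_iff)
  finally have E: "stft (synth H) y - complex_of_real c * H y = (LINT z|lborel. H z * ?k z - complex_of_real (m y) * (stft f z * ?k z))" .
  have point: "cmod (H z * ?k z - complex_of_real (m y) * (stft f z * ?k z))
      \<le> \<epsilon> * (?K * exp 16) * (cmod (H z) * exp (- (1/16) * (norm (z - y))\<^sup>2))" for z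
  proof -
    define r where "r = norm (z - y)"
    have "\<bar>m z - m y\<bar> \<le> m z * (exp (\<epsilon> * r) - 1)"
    proof -
      have "m y \<le> m z * exp (\<epsilon> * r)" using slow[of y z] by (simp add: r_def norm_minus_commute)
      moreover have "m z - m y \<le> m z * (1 - exp (- (\<epsilon> * r)))"
        using slow[of z y] by (simp add: r_def exp_minus field_simps)
      moreover have "1 - exp (- (\<epsilon> * r)) \<le> exp (\<epsilon> * r) - 1"
        using exp_ge_add_one_self[of "\<epsilon> * r"] exp_ge_add_one_self[of "- (\<epsilon> * r)"] by linarith
      then have "m z * (1 - exp (- (\<epsilon> * r))) \<le> m z * (exp (\<epsilon> * r) - 1)"
        using m(2)[of z] by (intro mult_left_mono) auto
      ultimately show ?thesis by (simp add: algebra_simps)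
    qed
    also have "\<dots> \<le> m z * (\<epsilon> * exp (2 * r))"
    proof (intro mult_left_mono)
      have r: "r \<ge> 0" by (simp add: r_def)
      have "exp (\<epsilon> * r) * (1 - \<epsilon> * r) \<le> exp (\<epsilon> * r) * exp (- (\<epsilon> * r))"
        using exp_ge_add_one_self[of "- (\<epsilon> * r)"] by (intro mult_left_mono) auto
      then have "exp (\<epsilon> * r) - 1 \<le> \<epsilon> * (r * exp (\<epsilon> * r))" by (simp add: exp_minus algebra_simps)
      also have "\<dots> \<le> \<epsilon> * (exp r * exp r)"
      proof -
        have "r \<le> exp r" using exp_ge_add_one_self[of r] by linarith
        then show ?thesis using \<epsilon> r by (intro mult_left_mono mult_mono) (auto simp: mult_left_le_one_le)
      qed
      finally show "exp (\<epsilon> * r) - 1 \<le> \<epsilon> * exp (2 * r)" by (simp flip: exp_add)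
    qed (use m(2)[of z] in simp)
    finally have d: "\<bar>m z - m y\<bar> \<le> m z * (\<epsilon> * exp (2 * r))" .
    have "cmod (H z * ?k z - complex_of_real (m y) * (stft f z * ?k z)) = \<bar>m z - m y\<bar> * cmod (stft f z) * cmod (?k z)"
    proof -
      have "H z * ?k z - complex_of_real (m y) * (stft f z * ?k z) = complex_of_real (m z - m y) * stft f z * ?k z"
        by (simp add: H_def algebra_simps)
      then show ?thesis by (simp only: norm_mult norm_of_real)
    qed
    also have "\<dots> \<le> (m z * (\<epsilon> * exp (2 * r))) * cmod (stft f z) * (?K * exp (- (1/8) * r\<^sup>2))"
      using d kb[of z] m(2)[of z] \<epsilon> by (intro mult_mono mult_right_mono) (auto simp: r_def)
    also have "\<dots> = \<epsilon> * ?K * cmod (H z) * (exp (2 * r) * exp (- (1/8) * r\<^sup>2))"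
      by (simp add: nH mult_ac)
    also have "\<dots> \<le> \<epsilon> * ?K * cmod (H z) * (exp 16 * exp (- (1/16) * r\<^sup>2))"
      using gaussian_beats_exp[of "1/8" 2 r] \<epsilon> by (intro mult_left_mono) auto
    finally show ?thesis by (simp add: r_def mult_ac)
  qed
  show "cmod (stft (synth H) y - complex_of_real c * H y) \<le> \<epsilon> * (?K * exp 16) * T y"
  proof -
    have HT: "integrable lborel (\<lambda>z. cmod (H z) * exp (- (1/16) * (norm (z - y))\<^sup>2))"
    proof (rule integrable_dominated[OF integrable_norm[OF HI]])
      show "AE z in lborel. norm (cmod (H z) * exp (- (1/16) * (norm (z - y))\<^sup>2)) \<le> norm (norm (H z))"
        by (intro AE_I2) (simp add: abs_mult mult_left_le)
      have [measurable]: "H \<in> borel_measurable borel" using HI by auto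
      show "(\<lambda>z. cmod (H z) * exp (- (1/16) * (norm (z - y))\<^sup>2)) \<in> borel_measurable lborel" by measurable
    qed
    have "cmod (stft (synth H) y - complex_of_real c * H y)
       \<le> (LINT z|lborel. \<epsilon> * (?K * exp 16) * (cmod (H z) * exp (- (1/16) * (norm (z - y))\<^sup>2)))"
      unfolding E
      by (intro norm_integral_le point Bochner_Integration.integrable_diff
           I HI integrable_mult_right integrable_stft[OF w f] HT)
    also have "\<dots> = \<epsilon> * (?K * exp 16) * T y" unfolding T_def by (rule integral_mult_right_zero)
    finally show ?thesis .
  qed
qed

text \<open>The lower frame bound is applied to the superposition \<open>g\<close> with coefficients
\<open>H = m \<cdot> stft f\<close> instead of to \<open>f\<close>. Up to errors of size \<open>\<epsilon>\<close> times the energy \<open>N2\<close> of \<open>H\<close>, the energy of \<open>g\<close>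
is \<open>c \<cdot> N2\<close> and the samples of \<open>stft g\<close> are those of \<open>c \<cdot> H\<close>. Hence \<open>N2\<close> is bounded by the weighted samples of
\<open>stft f\<close> plus a small multiple of itself. As \<open>f\<close> belongs to the space, \<open>N2\<close> is known to be finite beforehand, so the
small multiple can be absorbed.\<close>
theorem weighted_stft_bound:
  fixes \<omega> :: "real \<Rightarrow> real" and \<Lambda> :: "((real^'d::finite) \<times> (real^'d)) set"
  assumes w: "weight_function \<omega>" and r: "r > 0" and ne: "\<Lambda> \<noteq> {}"
    and sep: "\<And>x y. x \<in> \<Lambda> \<Longrightarrow> y \<in> \<Lambda> \<Longrightarrow> x \<noteq> y \<Longrightarrow> dist x y \<ge> r"
    and frame: "gabor_frame gaussian \<Lambda>" and l: "l \<ge> 0"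
  obtains C k where "C \<ge> 0"
    "\<And>f. f \<in> S_omega \<omega> \<Longrightarrow> (LINT z|lborel. exp (l * \<omega> (norm z)) * cmod (stft f z))
       \<le> C * Lambda_norm \<omega> \<Lambda> k (analysis_operator gaussian \<Lambda> f)"
proof -
  let ?q = "\<lambda>u::(real^'d) \<times> (real^'d). exp (- (1/16) * (norm u)\<^sup>2)"
  define c where "c = (2 * pi) ^ CARD('d) * sqrt (pi / 2) ^ CARD('d)"
  define K where "K = sqrt (pi / 2) ^ CARD('d) * exp 16"
  define Q where "Q = (LINT u|lborel. ?q u)"
  have c: "c > 0" and K: "K > 0" by (auto simp: c_def K_def)
  have qI: "integrable lborel ?q" using integrable_gaussian[of "1/16" "0::(real^'d) \<times> (real^'d)"] by simp
  have Q: "Q > 0" using integral_gaussian[of "1/16" "0::(real^'d) \<times> (real^'d)"] by (simp add: Q_def)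
  obtain R where R: "R \<ge> 0" "\<forall>S. finite S \<longrightarrow> S \<subseteq> \<Lambda> \<longrightarrow> (\<forall>z. (\<Sum>\<sigma>\<in>S. ?q (\<sigma> - z)) \<le> R)"
  proof -
    have "\<exists>R\<ge>0. \<forall>S. finite S \<longrightarrow> S \<subseteq> \<Lambda> \<longrightarrow> (\<forall>z. (\<Sum>\<sigma>\<in>S. ?q (\<sigma> - z)) \<le> R)"
    proof (rule sum_separated_le_integral[OF r sep, where q = "\<lambda>y. exp (r\<^sup>2 / 64) * exp (- (1/32) * (norm (y - 0))\<^sup>2)"])
      show "integrable lborel (\<lambda>y::(real^'d) \<times> (real^'d). exp (r\<^sup>2 / 64) * exp (- (1/32) * (norm (y - 0))\<^sup>2))"
        by (intro integrable_mult_right integrable_gaussian) simp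
      fix x y :: "(real^'d) \<times> (real^'d)" assume "dist x y < r / 2"
      then have "norm y \<le> norm x + r / 2" using norm_triangle_ineq2[of y x] by (simp add: dist_norm norm_minus_commute)
      then have "(norm y)\<^sup>2 \<le> (norm x + r / 2)\<^sup>2" by (intro power_mono) auto
      also have "\<dots> \<le> 2 * (norm x)\<^sup>2 + r\<^sup>2 / 2"
        using sum_squares_ge_zero[of "norm x - r / 2" 0] by (simp add: power2_eq_square algebra_simps)
      finally show "?q x \<le> exp (r\<^sup>2 / 64) * exp (- (1/32) * (norm (y - 0))\<^sup>2)"
        by (simp flip: exp_add)
    qed auto
    then show ?thesis using that by (elim exE conjE)
  qed
  obtain A where A: "A > 0" "\<And>g. g \<in> borel_measurable lborel \<Longrightarrow> integrable lborel (\<lambda>x. (cmod (g x))\<^sup>2) \<Longrightarrow>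
      (\<lambda>\<sigma>. (cmod (stft g \<sigma>))\<^sup>2) summable_on \<Lambda> \<and>
      A * (LINT x|lborel. (cmod (g x))\<^sup>2) \<le> (\<Sum>\<^sub>\<infinity>\<sigma>\<in>\<Lambda>. (cmod (stft g \<sigma>))\<^sup>2)"
    using frame unfolding gabor_frame_def stft_def by blast
  \<comment> \<open>\<open>\<epsilon> D N2\<close> collects the two error terms, from the energy and from the samples; it has to stay below
    half of the main term \<open>A c N2\<close>.\<close>
  define D where "D = A * K * Q + 2 * K\<^sup>2 * (Q * R)"
  have D: "D > 0" using A K Q R by (simp add: D_def add_pos_nonneg)
  define \<epsilon> where "\<epsilon> = min 1 (A * c / (2 * D))"
  have \<epsilon>: "0 < \<epsilon>" "\<epsilon> \<le> 1" using A c D by (auto simp: \<epsilon>_def)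
  have "\<epsilon> * D \<le> A * c / (2 * D) * D" using D by (intro mult_right_mono) (auto simp: \<epsilon>_def)
  then have \<epsilon>D: "\<epsilon> * D \<le> A * c / 2" using D by simp
  obtain l1 where l1: "l1 > 0" "integrable lborel (\<lambda>z::(real^'d) \<times> (real^'d). exp (- l1 * \<omega> (norm z)))"
    using integrable_exp_neg_weight[OF w] by blast
  define Q' where "Q' = (LINT z|lborel. exp (- l1 * \<omega> (norm (z::(real^'d) \<times> (real^'d)))))"
  have Q': "Q' > 0"
  proof -
    have "Q' \<ge> 0" unfolding Q'_def by (intro integral_nonneg_AE AE_I2) simp
    moreover have "Q' \<noteq> 0"
    proof
      assume "Q' = 0"
      then have "AE z in lborel. exp (- l1 * \<omega> (norm (z::(real^'d) \<times> (real^'d)))) = 0"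
        unfolding Q'_def by (subst (asm) integral_nonneg_eq_0_iff_AE[OF l1(2)]) auto
      then have "AE z::(real^'d) \<times> (real^'d) in lborel. False" by simp
      then show False by (simp add: AE_iff_measurable[OF _ refl])
    qed
    ultimately show ?thesis by simp
  qed
  \<comment> \<open>The additional \<open>l1\<close> pays for the passage from the square integral of \<open>H\<close> to a weighted integral.\<close>
  have ll: "l + l1 > 0" using l l1 by simp
  obtain \<nu> where \<nu>: "\<nu> > 0" and sv: "\<And>\<epsilon>. \<epsilon> > 0 \<Longrightarrow> \<exists>m C. C > 0 \<and> m \<in> borel_measurable borel \<and> (\<forall>z::(real^'d) \<times> (real^'d). m z > 0 \<and>
       m z \<le> exp (\<nu> * \<omega> (norm z)) \<and> exp ((l + l1) * \<omega> (norm z)) \<le> C * m z) \<and>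
       (\<forall>z y. m z \<le> m y * exp (\<epsilon> * norm (z - y)))"
    by (rule slowly_varying_weight[OF w ll]) (rule that, assumption+)
  obtain m C1 where C1: "C1 > 0" and m: "m \<in> borel_measurable borel"
       "\<And>z::(real^'d) \<times> (real^'d). m z > 0" "\<And>z. m z \<le> exp (\<nu> * \<omega> (norm z))"
       "\<And>z. exp ((l + l1) * \<omega> (norm z)) \<le> C1 * m z" "\<And>z y. m z \<le> m y * exp (\<epsilon> * norm (z - y))"
    using sv[OF \<epsilon>(1)] by metis
  obtain l2 M where M: "l2 > 0" "M \<ge> 0" "\<And>S. finite S \<Longrightarrow> S \<subseteq> \<Lambda> \<Longrightarrow> (\<Sum>\<sigma>\<in>S. exp (- l2 * \<omega> (norm \<sigma>))) \<le> M"
    by (rule sum_weight_separated[of \<omega> r \<Lambda>, OF w r]) (rule sep, assumption+, rule that, assumption+)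
  \<comment> \<open>The samples carry a factor \<open>exp (\<nu> \<omega>)\<close> from \<open>m\<close>, and \<open>exp (- l2 \<omega>)\<close> must remain for summability.\<close>
  define k where "k = nat \<lceil>\<nu> + l2\<rceil>"
  have k: "real k \<ge> \<nu> + l2" unfolding k_def by linarith
  define C where "C = C1 * sqrt (Q' * (4 * c / A * M))"
  show ?thesis
  proof (rule that[of C k])
    show "C \<ge> 0" using C1 Q' c A M by (simp add: C_def)
    fix f :: "real^'d \<Rightarrow> complex" assume f: "f \<in> S_omega \<omega>"
    note [measurable] = m(1) S_omega_basic(3)[OF f]
    define n where "n = Lambda_norm \<omega> \<Lambda> k (analysis_operator gaussian \<Lambda> f)"
    define H where "H = (\<lambda>z. complex_of_real (m z) * stft f z)"
    define T where "T y = (LINT z|lborel. cmod (H z) * ?q (z - y))" for y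
    define N2 where "N2 = (LINT z|lborel. (cmod (H z))\<^sup>2)"
    define g where "g = synth H"
    note L = weighted_localization[OF w f m(1,2,3) \<epsilon> m(5)]
    have HI: "integrable lborel H" unfolding H_def by (rule L(1))
    have loc: "cmod (stft g y - complex_of_real c * H y) \<le> \<epsilon> * K * T y" for y
      unfolding g_def T_def H_def c_def K_def by (rule L(2))
    have [measurable]: "H \<in> borel_measurable borel" using HI by auto
    have nH: "cmod (H z) = m z * cmod (stft f z)" for z
      using m(2)[of z] by (simp add: H_def norm_mult)
    obtain B where B: "B \<ge> 0" "\<And>z. cmod (H z) \<le> B"
    proof -
      obtain B where B: "B \<ge> 0" "\<And>z. exp (\<nu> * \<omega> (norm z)) * cmod (stft f z) \<le> B"
        using stft_S_omega_decay[OF w f] by blast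
      have "cmod (H z) \<le> B" for z
        using mult_right_mono[OF m(3)[of z], of "cmod (stft f z)"] B(2)[of z] by (simp add: nH)
      then show ?thesis using that B(1) by blast
    qed
    have H2: "integrable lborel (\<lambda>z. (cmod (H z))\<^sup>2)"
      by (rule integrable_dominated[OF integrable_mult_right[OF integrable_norm[OF HI], of B]])
        (use B in \<open>auto simp: power2_eq_square intro!: AE_I2 mult_right_mono\<close>)
    have N2: "N2 \<ge> 0" unfolding N2_def by (intro integral_nonneg_AE AE_I2) simp
    have nHm: "(\<lambda>z. cmod (H z)) \<in> borel_measurable borel" by measurable
    have qs: "?q (- z) = ?q z" for z :: "(real^'d) \<times> (real^'d)" by simp
    note Sch = Schur_bounds[OF nHm norm_ge_zero B(2) H2 qI exp_ge_zero Q[unfolded Q_def] qs, folded T_def Q_def N2_def]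
    have energy: "(c - \<epsilon> * K * Q) * N2 \<le> (LINT t|lborel. (cmod (g t))\<^sup>2)"
    proof -
      let ?d = "\<lambda>z. H z * cnj (stft g z) - complex_of_real (c * (cmod (H z))\<^sup>2)"
      have d: "?d z = H z * cnj (stft g z - complex_of_real c * H z)" for z
        by (simp add: complex_norm_square[symmetric] algebra_simps)
      have db: "cmod (?d z) \<le> \<epsilon> * K * (cmod (H z) * T z)" for z
        unfolding d using mult_left_mono[OF loc[of z] norm_ge_zero[of "H z"]]
        by (simp add: norm_mult mult_ac del: complex_cnj_diff)
      have [measurable]: "stft g \<in> borel_measurable borel"
        using integrable_synth[OF HI] unfolding g_def by (intro measurable_stft) auto
      have dm: "?d \<in> borel_measurable borel"
      proof -
        have "(\<lambda>z. cnj (stft g z)) \<in> borel_measurable borel"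
          by (rule measurable_compose[OF \<open>stft g \<in> borel_measurable borel\<close>
              borel_measurable_continuous_onI[OF continuous_on_cnj[OF continuous_on_id]]])
        note [measurable] = this
        show ?thesis by measurable
      qed
      have TI: "integrable lborel (\<lambda>z. \<epsilon> * K * (cmod (H z) * T z))"
        by (intro integrable_mult_right Sch(2))
      have dI: "integrable lborel ?d"
        by (rule integrable_dominated[OF TI])
          (use dm db in \<open>auto intro!: AE_I2 intro: order_trans[OF _ abs_ge_self]\<close>)
      have cI: "integrable lborel (\<lambda>z. complex_of_real (c * (cmod (H z))\<^sup>2))"
        by (intro integrable_of_real integrable_mult_right H2)
      have "(LINT z|lborel. H z * cnj (stft g z)) = (LINT z|lborel. ?d z + complex_of_real (c * (cmod (H z))\<^sup>2))"
        by simp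
      also have "\<dots> = (LINT z|lborel. ?d z) + (LINT z|lborel. complex_of_real (c * (cmod (H z))\<^sup>2))"
        by (rule Bochner_Integration.integral_add[OF dI cI])
      also have "(LINT z|lborel. complex_of_real (c * (cmod (H z))\<^sup>2)) = complex_of_real (c * N2)"
        unfolding integral_complex_of_real N2_def by (simp only: integral_mult_right_zero)
      finally have "complex_of_real ((LINT t|lborel. (cmod (g t))\<^sup>2) - c * N2) = (LINT z|lborel. ?d z)"
        using synth_energy(1)[OF HI] by (simp add: g_def)
      from arg_cong[OF this, of cmod]
      have "\<bar>(LINT t|lborel. (cmod (g t))\<^sup>2) - c * N2\<bar> = cmod (LINT z|lborel. ?d z)"
        by (simp only: norm_of_real)
      also have "\<dots> \<le> (LINT z|lborel. \<epsilon> * K * (cmod (H z) * T z))"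
        by (intro norm_integral_le dI TI db)
      also have "\<dots> = \<epsilon> * K * (LINT z|lborel. cmod (H z) * T z)" by (rule integral_mult_right_zero)
      also have "\<dots> \<le> \<epsilon> * K * (Q * N2)" using \<epsilon>(1) K by (intro mult_left_mono Sch(3)) auto
      finally show ?thesis by (simp add: algebra_simps)
    qed
    have n0: "\<sigma> \<in> \<Lambda> \<Longrightarrow> n \<ge> 0" for \<sigma>
      using Lambda_norm_upper[OF analysis_operator_in_Lambda_omega[OF w f], of \<sigma> \<Lambda> k]
      unfolding n_def by (meson exp_ge_zero mult_nonneg_nonneg norm_ge_zero order_trans)
    have samples: "(\<Sum>\<sigma>\<in>S. (cmod (H \<sigma>))\<^sup>2) \<le> M * n\<^sup>2" if S: "finite S" "S \<subseteq> \<Lambda>" for S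
    proof -
      have "(cmod (H \<sigma>))\<^sup>2 \<le> n\<^sup>2 * exp (- l2 * \<omega> (norm \<sigma>))" if \<sigma>: "\<sigma> \<in> \<Lambda>" for \<sigma>
      proof -
        let ?w = "\<omega> (norm \<sigma>)"
        have w0: "?w \<ge> 0" using weight_nonneg[OF w] by simp
        have "cmod (stft f \<sigma>) * exp (real k * ?w) \<le> n"
          using Lambda_norm_upper[OF analysis_operator_in_Lambda_omega[OF w f] \<sigma>, of k]
          by (simp add: analysis_operator_eq[OF \<sigma>] n_def)
        then have "cmod (stft f \<sigma>) \<le> n * exp (- (real k * ?w))" by (simp add: exp_minus field_simps)
        then have "cmod (H \<sigma>) \<le> exp (\<nu> * ?w) * (n * exp (- (real k * ?w)))"
          unfolding nH using m(2)[of \<sigma>] m(3)[of \<sigma>] by (intro mult_mono) auto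
        also have "\<dots> = n * exp (\<nu> * ?w - real k * ?w)" by (simp add: exp_diff exp_minus field_simps)
        also have "\<dots> \<le> n * exp (- (l2 / 2) * ?w)"
        proof (intro mult_left_mono n0[OF \<sigma>] exp_le_cancel_iff[THEN iffD2])
          have "(\<nu> + l2 / 2 - real k) * ?w \<le> 0" using k M(1) w0 by (intro mult_nonpos_nonneg) auto
          then show "\<nu> * ?w - real k * ?w \<le> - (l2 / 2) * ?w" by (simp add: algebra_simps)
        qed
        finally have "(cmod (H \<sigma>))\<^sup>2 \<le> (n * exp (- (l2 / 2) * ?w))\<^sup>2" by (intro power_mono) auto
        also have "\<dots> = n\<^sup>2 * exp (- l2 * ?w)" by (simp add: power_mult_distrib flip: exp_double)
        finally show ?thesis .
      qed
      then have "(\<Sum>\<sigma>\<in>S. (cmod (H \<sigma>))\<^sup>2) \<le> (\<Sum>\<sigma>\<in>S. n\<^sup>2 * exp (- l2 * \<omega> (norm \<sigma>)))"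
        using S by (intro sum_mono) auto
      also have "\<dots> \<le> n\<^sup>2 * M" using M(3)[OF S] by (simp add: mult_left_mono flip: sum_distrib_left)
      finally show ?thesis by (simp add: mult.commute)
    qed
    have lattice: "(\<Sum>\<sigma>\<in>S. (cmod (stft g \<sigma>))\<^sup>2) \<le> 2 * c\<^sup>2 * (M * n\<^sup>2) + 2 * (\<epsilon> * K)\<^sup>2 * (Q * (R * N2))"
      if S: "finite S" "S \<subseteq> \<Lambda>" for S
    proof -
      have p: "(cmod (stft g y))\<^sup>2 \<le> 2 * c\<^sup>2 * (cmod (H y))\<^sup>2 + 2 * (\<epsilon> * K)\<^sup>2 * (T y)\<^sup>2" for y
      proof -
        have "cmod (stft g y) \<le> cmod (complex_of_real c * H y) + cmod (stft g y - complex_of_real c * H y)"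
          using norm_triangle_ineq[of "complex_of_real c * H y" "stft g y - complex_of_real c * H y"] by simp
        also have "\<dots> \<le> c * cmod (H y) + \<epsilon> * K * T y" using loc[of y] c by (simp add: norm_mult)
        finally have "(cmod (stft g y))\<^sup>2 \<le> (c * cmod (H y) + \<epsilon> * K * T y)\<^sup>2" by (intro power_mono) auto
        also have "\<dots> \<le> 2 * (c * cmod (H y))\<^sup>2 + 2 * (\<epsilon> * K * T y)\<^sup>2"
          using sum_squares_ge_zero[of "c * cmod (H y) - \<epsilon> * K * T y" 0] by (simp add: power2_eq_square algebra_simps)
        finally show ?thesis by (simp only: power_mult_distrib mult.assoc)
      qed
      have "(\<Sum>\<sigma>\<in>S. (cmod (stft g \<sigma>))\<^sup>2) \<le> (\<Sum>\<sigma>\<in>S. 2 * c\<^sup>2 * (cmod (H \<sigma>))\<^sup>2 + 2 * (\<epsilon> * K)\<^sup>2 * (T \<sigma>)\<^sup>2)"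
        by (intro sum_mono p)
      also have "\<dots> = 2 * c\<^sup>2 * (\<Sum>\<sigma>\<in>S. (cmod (H \<sigma>))\<^sup>2) + 2 * (\<epsilon> * K)\<^sup>2 * (\<Sum>\<sigma>\<in>S. (T \<sigma>)\<^sup>2)"
        by (simp only: sum.distrib sum_distrib_left)
      also have "\<dots> \<le> 2 * c\<^sup>2 * (M * n\<^sup>2) + 2 * (\<epsilon> * K)\<^sup>2 * (Q * (R * N2))"
        using R(2) S by (intro add_mono mult_left_mono samples Sch(4)) auto
      finally show ?thesis .
    qed
    have gm: "g \<in> borel_measurable lborel" using integrable_synth[OF HI] by (auto simp: g_def)
    have g2: "integrable lborel (\<lambda>t. (cmod (g t))\<^sup>2)" unfolding g_def by (rule synth_energy(2)[OF HI])
    have "A * ((c - \<epsilon> * K * Q) * N2) \<le> A * (LINT t|lborel. (cmod (g t))\<^sup>2)"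
      using A(1) energy by (intro mult_left_mono) auto
    also have "\<dots> \<le> (\<Sum>\<^sub>\<infinity>\<sigma>\<in>\<Lambda>. (cmod (stft g \<sigma>))\<^sup>2)" using A(2)[OF gm g2] by simp
    also have "\<dots> \<le> 2 * c\<^sup>2 * (M * n\<^sup>2) + 2 * (\<epsilon> * K)\<^sup>2 * (Q * (R * N2))"
      using A(2)[OF gm g2] by (intro infsum_le_finite_sums lattice) auto
    also have "2 * (\<epsilon> * K)\<^sup>2 * (Q * (R * N2)) \<le> \<epsilon> * (2 * K\<^sup>2 * (Q * R)) * N2"
    proof -
      have "\<epsilon>\<^sup>2 \<le> \<epsilon>" using \<epsilon> by (simp add: power2_eq_square mult_left_le)
      then have "\<epsilon>\<^sup>2 * (2 * K\<^sup>2 * (Q * R) * N2) \<le> \<epsilon> * (2 * K\<^sup>2 * (Q * R) * N2)"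
        using K Q R N2 by (intro mult_right_mono) auto
      then show ?thesis by (simp add: power_mult_distrib mult_ac)
    qed
    finally have "A * c * N2 \<le> 2 * c\<^sup>2 * (M * n\<^sup>2) + (\<epsilon> * D) * N2"
      by (simp add: D_def algebra_simps)
    also have "(\<epsilon> * D) * N2 \<le> A * c / 2 * N2" using \<epsilon>D N2 by (rule mult_right_mono)
    finally have "N2 \<le> 4 * c / A * M * n\<^sup>2"
      using A(1) c by (simp add: field_simps power2_eq_square)
    moreover have "(LINT z|lborel. exp (l * \<omega> (norm z)) * cmod (stft f z)) \<le> C1 * sqrt (Q' * N2)"
    proof -
      let ?p = "\<lambda>z::(real^'d) \<times> (real^'d). exp (- l1 * \<omega> (norm z))"
      have Bn: "\<bar>cmod (H z)\<bar> \<le> B" for z using B by simp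
      note CS = Cauchy_Schwarz_weight[OF nHm Bn l1(2) exp_ge_zero Q'[unfolded Q'_def], folded Q'_def]
      have "(LINT z|lborel. (cmod (H z))\<^sup>2 * ?p z) \<le> N2"
        unfolding N2_def using weight_nonneg[OF w] l1(1)
        by (intro integral_mono CS(2) H2) (simp add: mult_left_le)
      then have "(LINT z|lborel. cmod (H z) * ?p z)\<^sup>2 \<le> Q' * N2"
        using CS(3) Q' by (meson mult_left_mono less_imp_le order_trans)
      then have *: "(LINT z|lborel. cmod (H z) * ?p z) \<le> sqrt (Q' * N2)" by (rule real_le_rsqrt)
      have "(LINT z|lborel. exp (l * \<omega> (norm z)) * cmod (stft f z)) \<le> (LINT z|lborel. C1 * (cmod (H z) * ?p z))"
      proof (intro integral_mono integrable_weighted_stft[OF w f] integrable_mult_right CS(1))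
        fix z :: "(real^'d) \<times> (real^'d)"
        have "exp (l * \<omega> (norm z)) = exp ((l + l1) * \<omega> (norm z)) * ?p z"
          by (simp add: algebra_simps flip: exp_add)
        also have "\<dots> \<le> C1 * m z * ?p z" by (intro mult_right_mono m(4)) simp
        finally have "exp (l * \<omega> (norm z)) * cmod (stft f z) \<le> C1 * m z * ?p z * cmod (stft f z)"
          by (rule mult_right_mono) simp
        then show "exp (l * \<omega> (norm z)) * cmod (stft f z) \<le> C1 * (cmod (H z) * ?p z)"
          by (simp add: nH mult_ac)
      qed
      also have "\<dots> = C1 * (LINT z|lborel. cmod (H z) * ?p z)" by (rule integral_mult_right_zero)
      also have "\<dots> \<le> C1 * sqrt (Q' * N2)" using * C1 by (intro mult_left_mono) auto
      finally show ?thesis .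
    qed
    moreover have "n \<ge> 0" using ne n0 by blast
    ultimately show "(LINT z|lborel. exp (l * \<omega> (norm z)) * cmod (stft f z)) \<le> C * n"
    proof -
      assume N: "N2 \<le> 4 * c / A * M * n\<^sup>2" and I: "(LINT z|lborel. exp (l * \<omega> (norm z)) * cmod (stft f z)) \<le> C1 * sqrt (Q' * N2)"
        and n: "n \<ge> 0"
      have "sqrt (Q' * N2) \<le> sqrt (Q' * (4 * c / A * M) * n\<^sup>2)"
        using mult_left_mono[OF N less_imp_le[OF Q']] by (simp only: real_sqrt_le_iff mult.assoc)
      also have "\<dots> = sqrt (Q' * (4 * c / A * M)) * n" using n by (simp only: real_sqrt_mult real_sqrt_abs abs_of_nonneg)
      finally have "C1 * sqrt (Q' * N2) \<le> C1 * (sqrt (Q' * (4 * c / A * M)) * n)" using C1 by (intro mult_left_mono) auto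
      then show ?thesis using I by (simp add: C_def mult.assoc)
    qed
  qed
qed

section \<open>Derivatives of superpositions of Gaussians\<close>

lemma has_vector_derivative_iff_slope:
  fixes f :: "real \<Rightarrow> 'a::real_normed_vector"
  shows "(f has_vector_derivative d) (at 0) \<longleftrightarrow> ((\<lambda>h. (f h - f 0) /\<^sub>R h) \<longlongrightarrow> d) (at 0)"
proof -
  have eq: "norm (f (0 + h) - f 0 - h *\<^sub>R d) / norm h = norm ((f h - f 0) /\<^sub>R h - d)" if "h \<noteq> 0" for h
  proof -
    have "(f h - f 0) /\<^sub>R h - d = (f h - f 0 - h *\<^sub>R d) /\<^sub>R h"
      using that by (simp add: scaleR_diff_right)
    then show ?thesis by (simp add: divide_inverse mult.commute)
  qed
  have "((\<lambda>h. norm (f (0 + h) - f 0 - h *\<^sub>R d) / norm h) \<longlongrightarrow> 0) (at 0)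
      \<longleftrightarrow> ((\<lambda>h. norm ((f h - f 0) /\<^sub>R h - d)) \<longlongrightarrow> 0) (at 0)"
    by (intro filterlim_cong refl, unfold eventually_at_filter, intro always_eventually) (use eq in simp)
  also have "\<dots> \<longleftrightarrow> ((\<lambda>h. (f h - f 0) /\<^sub>R h) \<longlongrightarrow> d) (at 0)"
    by (simp only: tendsto_norm_zero_iff LIM_zero_iff)
  finally show ?thesis
    by (simp add: has_vector_derivative_def has_derivative_at bounded_linear_scaleR_left)
qed

text \<open>Difference quotients are dominated by \<open>W\<close> through the mean value inequality.\<close>
lemma has_vector_derivative_integral:
  fixes \<Phi> \<Phi>' :: "real \<Rightarrow> 'a \<Rightarrow> complex"
  assumes I: "\<And>s. integrable M (\<Phi> s)"
    and D: "\<And>s z. ((\<lambda>s. \<Phi> s z) has_vector_derivative \<Phi>' s z) (at s)"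
    and m: "\<Phi>' 0 \<in> borel_measurable M"
    and W: "integrable M W" and b: "\<And>s z. cmod (\<Phi>' s z) \<le> W z"
  shows "((\<lambda>s. LINT z|M. \<Phi> s z) has_vector_derivative (LINT z|M. \<Phi>' 0 z)) (at 0)"
proof -
  have lip: "cmod (\<Phi> s z - \<Phi> 0 z) \<le> W z * \<bar>s\<bar>" for s z
  proof -
    have "norm (\<Phi> s z - \<Phi> 0 z) \<le> W z * norm (s - 0)"
    proof (rule differentiable_bound[of UNIV "\<lambda>s. \<Phi> s z" "\<lambda>s h. h *\<^sub>R \<Phi>' s z"])
      show "((\<lambda>s. \<Phi> s z) has_derivative (\<lambda>h. h *\<^sub>R \<Phi>' t z)) (at t within UNIV)" for t
        using D[where z = z and s = t] by (simp add: has_vector_derivative_def)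
      show "onorm (\<lambda>h. h *\<^sub>R \<Phi>' t z) \<le> W z" for t
      proof (rule onorm_bound)
        show "0 \<le> W z" using b[of 0 z] norm_ge_zero by (rule order_trans[rotated])
        show "norm (h *\<^sub>R \<Phi>' t z) \<le> W z * norm h" for h
          using mult_left_mono[OF b[of t z], of "norm h"] by (simp add: mult.commute)
      qed
    qed auto
    then show ?thesis by simp
  qed
  have "((\<lambda>s. (LINT z|M. (\<Phi> s z - \<Phi> 0 z) /\<^sub>R s)) \<longlongrightarrow> (LINT z|M. \<Phi>' 0 z)) (at 0)"
    unfolding LIMSEQ_SEQ_conv[symmetric]
  proof (intro allI impI, elim conjE)
    fix x :: "nat \<Rightarrow> real" assume x: "\<forall>n. x n \<noteq> 0" "x \<longlonglongrightarrow> 0"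
    show "(\<lambda>n. LINT z|M. (\<Phi> (x n) z - \<Phi> 0 z) /\<^sub>R x n) \<longlonglongrightarrow> (LINT z|M. \<Phi>' 0 z)"
    proof (rule integral_dominated_convergence[OF m _ W])
      show "(\<lambda>z. (\<Phi> (x n) z - \<Phi> 0 z) /\<^sub>R x n) \<in> borel_measurable M" for n
        using I by (intro borel_measurable_scaleR borel_measurable_diff borel_measurable_const) auto
      show "AE z in M. (\<lambda>n. (\<Phi> (x n) z - \<Phi> 0 z) /\<^sub>R x n) \<longlonglongrightarrow> \<Phi>' 0 z"
      proof (intro AE_I2)
        fix z
        have "((\<lambda>s. (\<Phi> s z - \<Phi> 0 z) /\<^sub>R s) \<longlongrightarrow> \<Phi>' 0 z) (at 0)"
          using D[where z = z and s = 0] by (simp only: has_vector_derivative_iff_slope)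
        then show "(\<lambda>n. (\<Phi> (x n) z - \<Phi> 0 z) /\<^sub>R x n) \<longlonglongrightarrow> \<Phi>' 0 z"
          using x unfolding LIMSEQ_SEQ_conv[symmetric] by blast
      qed
      show "AE z in M. norm ((\<Phi> (x n) z - \<Phi> 0 z) /\<^sub>R x n) \<le> W z" for n
      proof (intro AE_I2)
        fix z
        have "\<bar>x n\<bar> > 0" using x by simp
        moreover have "norm ((\<Phi> (x n) z - \<Phi> 0 z) /\<^sub>R x n) = cmod (\<Phi> (x n) z - \<Phi> 0 z) / \<bar>x n\<bar>"
          by (simp add: divide_inverse mult.commute)
        ultimately show "norm ((\<Phi> (x n) z - \<Phi> 0 z) /\<^sub>R x n) \<le> W z"
          using lip[where s = "x n" and z = z] by (simp only: pos_divide_le_eq)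
      qed
    qed
  qed
  moreover have eq: "(LINT z|M. (\<Phi> s z - \<Phi> 0 z) /\<^sub>R s) = ((LINT z|M. \<Phi> s z) - (LINT z|M. \<Phi> 0 z)) /\<^sub>R s" for s
    using I by simp
  ultimately show ?thesis unfolding has_vector_derivative_iff_slope eq by blast
qed

text \<open>Derivatives of \<open>atom a p q\<close> at \<open>t\<close> are polynomials in
\<open>t - p\<close> and \<open>q\<close> times the atom, and the class is closed under the product rule, so derivatives of
all orders are treated at once.\<close>
inductive symbol :: "(real^'d::finite \<Rightarrow> real^'d \<Rightarrow> complex) \<Rightarrow> bool" where
  symbol_const: "symbol (\<lambda>s q. c)"
| symbol_fst: "symbol (\<lambda>s q. complex_of_real (s $ i))"
| symbol_snd: "symbol (\<lambda>s q. complex_of_real (q $ i))"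
| symbol_add: "symbol k \<Longrightarrow> symbol l \<Longrightarrow> symbol (\<lambda>s q. k s q + l s q)"
| symbol_mult: "symbol k \<Longrightarrow> symbol l \<Longrightarrow> symbol (\<lambda>s q. k s q * l s q)"

lemma symbol_derivative:
  assumes "symbol k"
  shows "\<exists>k'. symbol k' \<and> (\<forall>s q t. ((\<lambda>t. k (s + t *\<^sub>R axis i 1) q) has_vector_derivative k' (s + t *\<^sub>R axis i 1) q) (at t))"
  using assms
proof (induction rule: symbol.induct)
  case (symbol_const c)
  then show ?case by (intro exI[of _ "\<lambda>s q. 0"]) (auto intro: symbol.symbol_const)
next
  case (symbol_fst j)
  have "((\<lambda>t. complex_of_real ((s + t *\<^sub>R axis i 1) $ j)) has_vector_derivative (if i = j then 1 else 0)) (at t)" for s :: "real^'a" and t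
    by (cases "i = j") (auto simp: axis_def intro!: derivative_eq_intros)
  then show ?case by (intro exI[of _ "\<lambda>s q. if i = j then 1 else 0"]) (auto intro: symbol.symbol_const)
next
  case (symbol_snd j)
  then show ?case by (intro exI[of _ "\<lambda>s q. 0"]) (auto intro: symbol.symbol_const)
next
  case (symbol_add k l)
  then obtain k' l' where *: "symbol k'" "symbol l'"
    "\<And>s q t. ((\<lambda>t. k (s + t *\<^sub>R axis i 1) q) has_vector_derivative k' (s + t *\<^sub>R axis i 1) q) (at t)"
    "\<And>s q t. ((\<lambda>t. l (s + t *\<^sub>R axis i 1) q) has_vector_derivative l' (s + t *\<^sub>R axis i 1) q) (at t)"
    by blast
  show ?case
    by (intro exI[of _ "\<lambda>s q. k' s q + l' s q"]) (auto intro!: symbol.symbol_add * has_vector_derivative_add)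
next
  case (symbol_mult k l)
  then obtain k' l' where *: "symbol k'" "symbol l'"
    "\<And>s q t. ((\<lambda>t. k (s + t *\<^sub>R axis i 1) q) has_vector_derivative k' (s + t *\<^sub>R axis i 1) q) (at t)"
    "\<And>s q t. ((\<lambda>t. l (s + t *\<^sub>R axis i 1) q) has_vector_derivative l' (s + t *\<^sub>R axis i 1) q) (at t)"
    by blast
  show ?case
    by (intro exI[of _ "\<lambda>s q. k s q * l' s q + k' s q * l s q"])
      (auto intro!: symbol.symbol_add symbol.symbol_mult * symbol_mult has_vector_derivative_mult)
qed

lemma symbol_bound:
  assumes "symbol k"
  shows "\<exists>C n. C \<ge> 0 \<and> (\<forall>s q. cmod (k s q) \<le> C * exp (real n * norm s) * (1 + norm q) ^ n)"
  using assms
proof (induction rule: symbol.induct)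
  case (symbol_const c)
  show ?case by (rule exI[of _ "cmod c"], rule exI[of _ 0]) simp
next
  case (symbol_fst i)
  have "cmod (complex_of_real (s $ i)) \<le> 1 * exp (real 1 * norm s) * (1 + norm q) ^ 1" for s q :: "real^'a"
  proof -
    have "\<bar>s $ i\<bar> \<le> exp (norm s) * 1"
      using component_le_norm_cart[of s i] exp_ge_add_one_self[of "norm s"] by linarith
    also have "\<dots> \<le> exp (norm s) * (1 + norm q)" by (intro mult_left_mono) auto
    finally show ?thesis by simp
  qed
  from this show ?case by (metis zero_le_one)
next
  case (symbol_snd i)
  have "cmod (complex_of_real (q $ i)) \<le> 1 * exp (real 1 * norm s) * (1 + norm q) ^ 1" for s q :: "real^'a"
  proof -
    have "\<bar>q $ i\<bar> \<le> 1 * (1 + norm q)" using component_le_norm_cart[of q i] by simp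
    also have "\<dots> \<le> exp (norm s) * (1 + norm q)" by (intro mult_right_mono) auto
    finally show ?thesis by simp
  qed
  from this show ?case by (metis zero_le_one)
next
  case (symbol_add k l)
  then obtain C n D m where *: "C \<ge> 0" "D \<ge> 0"
    "\<And>s q. cmod (k s q) \<le> C * exp (real n * norm s) * (1 + norm q) ^ n"
    "\<And>s q. cmod (l s q) \<le> D * exp (real m * norm s) * (1 + norm q) ^ m" by blast
  have "cmod (k s q + l s q) \<le> (C + D) * exp (real (n + m) * norm s) * (1 + norm q) ^ (n + m)" for s q
  proof -
    have "C * exp (real n * norm s) * (1 + norm q) ^ n \<le> C * exp (real (n + m) * norm s) * (1 + norm q) ^ (n + m)"
      using *(1) by (intro mult_mono power_increasing) (auto simp: mult_right_mono)
    moreover have "D * exp (real m * norm s) * (1 + norm q) ^ m \<le> D * exp (real (n + m) * norm s) * (1 + norm q) ^ (n + m)"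
      using *(2) by (intro mult_mono power_increasing) (auto simp: mult_right_mono)
    ultimately show ?thesis using norm_triangle_ineq[of "k s q" "l s q"] *(3)[of s q] *(4)[of s q]
      by (simp only: distrib_right)
  qed
  then show ?case using *(1,2) by (intro exI[of _ "C + D"] exI[of _ "n + m"]) auto
next
  case (symbol_mult k l)
  then obtain C n D m where *: "C \<ge> 0" "D \<ge> 0"
    "\<And>s q. cmod (k s q) \<le> C * exp (real n * norm s) * (1 + norm q) ^ n"
    "\<And>s q. cmod (l s q) \<le> D * exp (real m * norm s) * (1 + norm q) ^ m" by blast
  have "cmod (k s q * l s q) \<le> (C * D) * exp (real (n + m) * norm s) * (1 + norm q) ^ (n + m)" for s q
  proof -
    have "cmod (k s q * l s q) \<le> (C * exp (real n * norm s) * (1 + norm q) ^ n) * (D * exp (real m * norm s) * (1 + norm q) ^ m)"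
      unfolding norm_mult using *(1,2) by (intro mult_mono *) auto
    also have "\<dots> = (C * D) * exp (real (n + m) * norm s) * (1 + norm q) ^ (n + m)"
    proof -
      have "exp (real (n + m) * norm s) = exp (real n * norm s) * exp (real m * norm s)"
        by (simp add: distrib_right flip: exp_add)
      then show ?thesis by (simp only: power_add mult_ac)
    qed
    finally show ?thesis .
  qed
  then show ?case using *(1,2) by (intro exI[of _ "C * D"] exI[of _ "n + m"]) auto
qed

lemma symbol_measurable:
  assumes "symbol k" and [measurable]: "S \<in> borel_measurable M" "Q \<in> borel_measurable M"
  shows "(\<lambda>z. k (S z) (Q z)) \<in> borel_measurable M"
  using assms(1)
proof (induction rule: symbol.induct)
  case (symbol_fst i)
  have "(\<lambda>x::real^'a. x $ i) \<in> borel_measurable borel" by (intro borel_measurable_continuous_onI continuous_intros)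
  from measurable_compose[OF assms(2) this] show ?case by measurable
next
  case (symbol_snd i)
  have "(\<lambda>x::real^'a. x $ i) \<in> borel_measurable borel" by (intro borel_measurable_continuous_onI continuous_intros)
  from measurable_compose[OF assms(3) this] show ?case by measurable
qed auto

text \<open>The Gaussian swallows the polynomial growth in \<open>s\<close> and a further exponential, which is later spent on
moving the weight; what remains is polynomial in the frequency \<open>q\<close>.\<close>
lemma symbol_times_gaussian_bound:
  assumes k: "symbol k" and a: "a > 0"
  obtains C n where "C \<ge> 0" "\<And>s q. cmod (k s q) * exp (norm s) * exp (- a * (norm s)\<^sup>2) \<le> C * (1 + norm q) ^ n"
proof -
  obtain C n where C: "C \<ge> 0" "\<And>s q. cmod (k s q) \<le> C * exp (real n * norm s) * (1 + norm q) ^ n"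
    using symbol_bound[OF k] by blast
  let ?D = "C * exp ((real n + 1)\<^sup>2 / (2 * a))"
  show ?thesis
  proof (rule that[of ?D n])
    fix s q
    have "cmod (k s q) * exp (norm s) * exp (- a * (norm s)\<^sup>2)
       \<le> (C * exp (real n * norm s) * (1 + norm q) ^ n) * exp (norm s) * exp (- a * (norm s)\<^sup>2)"
      by (intro mult_right_mono C) auto
    also have "\<dots> = C * (1 + norm q) ^ n * (exp ((real n + 1) * norm s) * exp (- a * (norm s)\<^sup>2))"
    proof -
      have "exp ((real n + 1) * norm s) = exp (real n * norm s) * exp (norm s)"
        by (simp add: distrib_right flip: exp_add)
      then show ?thesis by (simp only: mult_ac)
    qed
    also have "\<dots> \<le> C * (1 + norm q) ^ n * (exp ((real n + 1)\<^sup>2 / (2 * a)) * 1)"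
    proof (intro mult_left_mono order_trans[OF gaussian_beats_exp[OF a]])
      show "exp (- (a / 2) * (norm s)\<^sup>2) \<le> 1" using a by simp
    qed (use C in auto)
    finally show "cmod (k s q) * exp (norm s) * exp (- a * (norm s)\<^sup>2) \<le> ?D * (1 + norm q) ^ n"
      by (simp add: mult_ac)
  qed (use C in simp)
qed

lemma atom_has_vector_derivative:
  "((\<lambda>s. atom a p q (t + s *\<^sub>R axis i 1)) has_vector_derivative
     (\<i> * complex_of_real (q $ i) + complex_of_real (- 2 * a) * complex_of_real ((t + s *\<^sub>R axis i 1 - p) $ i)) *
       atom a p q (t + s *\<^sub>R axis i 1)) (at s)"
proof -
  let ?c0 = "\<i> * complex_of_real (t \<bullet> q) - complex_of_real (a * (norm (t - p))\<^sup>2)"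
  let ?c1 = "\<i> * complex_of_real (q $ i) - complex_of_real (2 * a * (t - p) $ i)"
  let ?g = "\<lambda>s. exp (?c0 + ?c1 * s - complex_of_real a * s\<^sup>2)"
  have e: "atom a p q (t + s *\<^sub>R axis i 1) = ?g (complex_of_real s)" for s
  proof -
    have 1: "(t + s *\<^sub>R axis i 1) \<bullet> q = t \<bullet> q + s * (q $ i)"
      by (simp add: inner_add_left inner_axis' )
    have 2: "(norm (t + s *\<^sub>R axis i 1 - p))\<^sup>2 = (norm (t - p))\<^sup>2 + 2 * s * ((t - p) $ i) + s\<^sup>2"
    proof -
      have "t + s *\<^sub>R axis i 1 - p = (t - p) + s *\<^sub>R axis i 1" by simp
      then have "(norm (t + s *\<^sub>R axis i 1 - p))\<^sup>2 = (t - p) \<bullet> (t - p) + 2 * ((t - p) \<bullet> (s *\<^sub>R axis i 1)) + (s *\<^sub>R axis i 1) \<bullet> (s *\<^sub>R axis i (1::real))"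
        by (simp only: power2_norm_eq_inner inner_add_left inner_add_right inner_commute)
      then have "(norm (t + s *\<^sub>R axis i 1 - p))\<^sup>2 = (t - p) \<bullet> (t - p) + 2 * s * ((t - p) $ i) + s\<^sup>2"
        by (simp add: inner_axis inner_axis_axis power2_eq_square[of s])
      then show ?thesis unfolding power2_norm_eq_inner[of "t - p"] .
    qed
    show ?thesis unfolding atom_def 1 2
      by (simp add: exp_of_real[symmetric] algebra_simps flip: exp_add)
  qed
  have "(?g has_field_derivative (?c1 - complex_of_real a * (2 * complex_of_real s)) * ?g (complex_of_real s)) (at (complex_of_real s))"
    by (auto intro!: derivative_eq_intros)
  from has_vector_derivative_real_field[OF this]
  have D: "((\<lambda>s. atom a p q (t + s *\<^sub>R axis i 1)) has_vector_derivative
      (?c1 - complex_of_real a * (2 * complex_of_real s)) * ?g (complex_of_real s)) (at s)"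
    unfolding e .
  have E: "?c1 - complex_of_real a * (2 * complex_of_real s) =
     \<i> * complex_of_real (q $ i) + complex_of_real (- 2 * a) * complex_of_real ((t + s *\<^sub>R axis i 1 - p) $ i)"
    by (simp add: axis_def algebra_simps)
  show ?thesis using D unfolding E e .
qed

lemma symbol_atom_derivative:
  assumes "symbol k"
  obtains k' where "symbol k'"
    "\<And>p q t s. ((\<lambda>s. k (t + s *\<^sub>R axis i 1 - p) q * atom a p q (t + s *\<^sub>R axis i 1)) has_vector_derivative
       k' (t + s *\<^sub>R axis i 1 - p) q * atom a p q (t + s *\<^sub>R axis i 1)) (at s)"
proof -
  obtain k1 where k1: "symbol k1"
    "\<And>s q t. ((\<lambda>t. k (s + t *\<^sub>R axis i 1) q) has_vector_derivative k1 (s + t *\<^sub>R axis i 1) q) (at t)"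
    using symbol_derivative[OF assms] by blast
  let ?k = "\<lambda>s q. k s q * (\<i> * complex_of_real (q $ i) + complex_of_real (- 2 * a) * complex_of_real (s $ i)) + k1 s q"
  show ?thesis
  proof (rule that[of ?k])
    show "symbol ?k"
      by (intro symbol.intros assms k1(1))
    fix p q t :: "real^'a" and s
    have "((\<lambda>s. k (t - p + s *\<^sub>R axis i 1) q) has_vector_derivative k1 (t - p + s *\<^sub>R axis i 1) q) (at s)"
      by (rule k1(2))
    then have "((\<lambda>s. k (t + s *\<^sub>R axis i 1 - p) q) has_vector_derivative k1 (t + s *\<^sub>R axis i 1 - p) q) (at s)"
      by (simp add: algebra_simps)
    from has_vector_derivative_mult[OF this atom_has_vector_derivative[of a p q t i s]]
    show "((\<lambda>s. k (t + s *\<^sub>R axis i 1 - p) q * atom a p q (t + s *\<^sub>R axis i 1)) has_vector_derivative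
       ?k (t + s *\<^sub>R axis i 1 - p) q * atom a p q (t + s *\<^sub>R axis i 1)) (at s)"
      by (simp only: distrib_right mult.assoc)
  qed
qed

text \<open>Differentiation of a superposition under the integral sign. The symbol depends on the order of the
derivatives alone and not on the coefficients \<open>H\<close>; therefore the estimates derived from it are uniform in \<open>H\<close>.\<close>
lemma partial_derivs_superposition:
  fixes P Q :: "(real^'d::finite) \<times> (real^'d) \<Rightarrow> real^'d"
  assumes a: "a > 0" and [measurable]: "P \<in> borel_measurable borel" "Q \<in> borel_measurable borel"
    and Q: "\<And>z. norm (Q z) \<le> norm z"
  shows "\<exists>k. symbol k \<and> (\<forall>H. (\<forall>n. integrable lborel (\<lambda>z. (1 + norm z) ^ n * cmod (H z))) \<longrightarrow> H \<in> borel_measurable borel \<longrightarrow>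
     foldr partial_deriv is (\<lambda>t. LINT z|lborel. H z * atom a (P z) (Q z) t)
      = (\<lambda>t. LINT z|lborel. H z * (k (t - P z) (Q z) * atom a (P z) (Q z) t)))"
proof (induction "is")
  case Nil
  show ?case by (intro exI[of _ "\<lambda>s q. 1"] conjI symbol_const) simp
next
  case (Cons i "is")
  then obtain k where k: "symbol k" and IH: "\<And>H. (\<And>n. integrable lborel (\<lambda>z. (1 + norm z) ^ n * cmod (H z))) \<Longrightarrow> H \<in> borel_measurable borel \<Longrightarrow>
     foldr partial_deriv is (\<lambda>t. LINT z|lborel. H z * atom a (P z) (Q z) t)
      = (\<lambda>t. LINT z|lborel. H z * (k (t - P z) (Q z) * atom a (P z) (Q z) t))" by blast
  obtain k' where k': "symbol k'" and der:
    "\<And>p q t s. ((\<lambda>s. k (t + s *\<^sub>R axis i 1 - p) q * atom a p q (t + s *\<^sub>R axis i 1)) has_vector_derivative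
       k' (t + s *\<^sub>R axis i 1 - p) q * atom a p q (t + s *\<^sub>R axis i 1)) (at s)"
    using symbol_atom_derivative[OF k] by blast
  have dom: "\<exists>C n. \<forall>H t z. cmod (H z * (j (t - P z) (Q z) * atom a (P z) (Q z) t)) \<le> C * ((1 + norm z) ^ n * cmod (H z))"
    if j: "symbol j" for j
  proof -
    obtain C n where C: "C \<ge> 0" "\<And>s q. cmod (j s q) * exp (norm s) * exp (- a * (norm s)\<^sup>2) \<le> C * (1 + norm q) ^ n"
      using symbol_times_gaussian_bound[OF j a] by blast
    have "cmod (j (t - P z) (Q z)) * cmod (atom a (P z) (Q z) t) \<le> C * (1 + norm z) ^ n" for t z
    proof -
      have "cmod (j (t - P z) (Q z)) * cmod (atom a (P z) (Q z) t)
         \<le> cmod (j (t - P z) (Q z)) * exp (norm (t - P z)) * exp (- a * (norm (t - P z))\<^sup>2)"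
        unfolding norm_atom by (intro mult_right_mono) (auto simp: mult_le_cancel_left1)
      also have "\<dots> \<le> C * (1 + norm (Q z)) ^ n" by (rule C(2))
      also have "\<dots> \<le> C * (1 + norm z) ^ n" using C(1) Q by (intro mult_left_mono power_mono) auto
      finally show ?thesis .
    qed
    from mult_right_mono[OF this norm_ge_zero]
    have "cmod (H z * (j (t - P z) (Q z) * atom a (P z) (Q z) t)) \<le> C * ((1 + norm z) ^ n * cmod (H z))" for H :: "_ \<Rightarrow> complex" and t z
      by (simp add: norm_mult mult_ac)
    then show ?thesis by blast
  qed
  show ?case
  proof (intro exI[of _ k'] conjI k' allI impI)
    fix H :: "(real^'d) \<times> (real^'d) \<Rightarrow> complex"
    assume "\<forall>n. integrable lborel (\<lambda>z. (1 + norm z) ^ n * cmod (H z))" and Hm [measurable]: "H \<in> borel_measurable borel"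
    then have H: "integrable lborel (\<lambda>z. (1 + norm z) ^ n * cmod (H z))" for n by blast
    have ji: "integrable lborel (\<lambda>z. H z * (j (t - P z) (Q z) * atom a (P z) (Q z) t))"
       and jm: "(\<lambda>z. H z * (j (t - P z) (Q z) * atom a (P z) (Q z) t)) \<in> borel_measurable lborel" if j: "symbol j" for j t
    proof -
      have [measurable]: "(\<lambda>z. j (t - P z) (Q z)) \<in> borel_measurable borel"
        by (rule symbol_measurable[OF j]) measurable
      show m: "(\<lambda>z. H z * (j (t - P z) (Q z) * atom a (P z) (Q z) t)) \<in> borel_measurable lborel" by measurable
      obtain C n where C: "\<And>t z. cmod (H z * (j (t - P z) (Q z) * atom a (P z) (Q z) t)) \<le> C * ((1 + norm z) ^ n * cmod (H z))"
        using dom[OF j] by blast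
      show "integrable lborel (\<lambda>z. H z * (j (t - P z) (Q z) * atom a (P z) (Q z) t))"
        by (rule integrable_dominated[OF integrable_mult_right[OF H[of n], of C] m])
          (use C in \<open>auto intro!: AE_I2 intro: order_trans[OF _ abs_ge_self]\<close>)
    qed
    obtain C n where C: "\<And>t z. cmod (H z * (k' (t - P z) (Q z) * atom a (P z) (Q z) t)) \<le> C * ((1 + norm z) ^ n * cmod (H z))"
      using dom[OF k'] by blast
    show "foldr partial_deriv (i # is) (\<lambda>t. LINT z|lborel. H z * atom a (P z) (Q z) t)
      = (\<lambda>t. LINT z|lborel. H z * (k' (t - P z) (Q z) * atom a (P z) (Q z) t))"
    proof
      fix t :: "real^'d"
      let ?\<Phi> = "\<lambda>j s z. H z * (j (t + s *\<^sub>R axis i 1 - P z) (Q z) * atom a (P z) (Q z) (t + s *\<^sub>R axis i 1))"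
      have "((\<lambda>s. LINT z|lborel. ?\<Phi> k s z) has_vector_derivative (LINT z|lborel. ?\<Phi> k' 0 z)) (at 0)"
      proof (rule has_vector_derivative_integral[where W = "\<lambda>z. C * ((1 + norm z) ^ n * cmod (H z))"])
        show "integrable lborel (?\<Phi> k s)" for s by (rule ji[OF k])
        show "?\<Phi> k' 0 \<in> borel_measurable lborel" by (rule jm[OF k'])
        show "((\<lambda>s. ?\<Phi> k s z) has_vector_derivative ?\<Phi> k' s z) (at s)" for s z
          by (intro has_vector_derivative_mult_right der)
        show "integrable lborel (\<lambda>z. C * ((1 + norm z) ^ n * cmod (H z)))" by (intro integrable_mult_right H)
        show "cmod (?\<Phi> k' s z) \<le> C * ((1 + norm z) ^ n * cmod (H z))" for s z by (rule C)
      qed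
      from vector_derivative_at[OF this]
      show "foldr partial_deriv (i # is) (\<lambda>t. LINT z|lborel. H z * atom a (P z) (Q z) t) t
        = (LINT z|lborel. H z * (k' (t - P z) (Q z) * atom a (P z) (Q z) t))"
        by (simp add: IH[OF H Hm] partial_deriv_def)
    qed
  qed
qed

lemma multi_deriv_eq_foldr:
  obtains "is" where "\<And>u. multi_deriv \<alpha> u = foldr partial_deriv is u"
proof -
  have f: "foldr (\<lambda>i. partial_deriv i ^^ \<alpha> i) L u = foldr partial_deriv (concat (map (\<lambda>i. replicate (\<alpha> i) i) L)) u" for L u
    by (induction L) auto
  show ?thesis by (rule that) (unfold multi_deriv_def f, rule refl)
qed

text \<open>The centres \<open>P\<close> and \<open>Q\<close> are general so that the same estimate applies to \<open>f\<close> and to its Fourier transform,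
which is a superposition of atoms with the two phase space coordinates exchanged.\<close>
lemma weighted_derivative_bound:
  fixes P Q :: "(real^'d::finite) \<times> (real^'d) \<Rightarrow> real^'d"
  assumes w: "weight_function \<omega>" and \<mu>: "\<mu> > 0"
    and a: "a > 0" and PQ: "P \<in> borel_measurable borel" "Q \<in> borel_measurable borel"
    and P: "\<And>z. norm (P z) \<le> norm z" and Q: "\<And>z. norm (Q z) \<le> norm z"
  shows "\<exists>C l. C \<ge> 0 \<and> l \<ge> 0 \<and> (\<forall>H t. H \<in> borel_measurable borel \<longrightarrow>
      (\<forall>l. integrable lborel (\<lambda>z. exp (l * \<omega> (norm z)) * cmod (H z))) \<longrightarrow>
      exp (\<mu> * \<omega> (norm t)) * cmod (multi_deriv \<alpha> (\<lambda>t. LINT z|lborel. H z * atom a (P z) (Q z) t) t)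
        \<le> C * (LINT z|lborel. exp (l * \<omega> (norm z)) * cmod (H z)))"
proof -
  obtain "is" where mdi: "\<And>u::real^'d \<Rightarrow> complex. multi_deriv \<alpha> u = foldr partial_deriv is u"
    using multi_deriv_eq_foldr[of \<alpha>] by blast
  obtain k where k: "symbol k" and foldr: "\<And>H. (\<And>n. integrable lborel (\<lambda>z. (1 + norm z) ^ n * cmod (H z))) \<Longrightarrow> H \<in> borel_measurable borel \<Longrightarrow>
     foldr partial_deriv is (\<lambda>t. LINT z|lborel. H z * atom a (P z) (Q z) t)
      = (\<lambda>t. LINT z|lborel. H z * (k (t - P z) (Q z) * atom a (P z) (Q z) t))"
    using partial_derivs_superposition[OF a PQ Q] by blast
  obtain C1 \<mu>' where C1: "C1 > 0" "\<mu>' > 0"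
    "\<And>x y :: real^'d. exp (\<mu> * \<omega> (norm (x + y))) \<le> C1 * exp (\<mu>' * \<omega> (norm x)) * exp (norm y)"
    using weight_exp_add[OF w \<mu>] by blast
  obtain C2 n where C2: "C2 \<ge> 0" "\<And>s q. cmod (k s q) * exp (norm s) * exp (- a * (norm s)\<^sup>2) \<le> C2 * (1 + norm q) ^ n"
    using symbol_times_gaussian_bound[OF k a] by blast
  obtain C3 l3 where C3: "C3 > 0" "l3 > 0" "\<And>t. t \<ge> 0 \<Longrightarrow> (1 + t) ^ n \<le> C3 * exp (l3 * \<omega> t)"
    using weight_polynomial[OF w] by blast
  let ?l = "\<mu>' + l3" and ?C = "C1 * C2 * C3"
  show ?thesis
  proof (rule exI[of _ ?C], rule exI[of _ ?l], intro conjI allI impI)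
    show "?C \<ge> 0" "?l \<ge> 0" using C1 C2 C3 by auto
    fix H :: "(real^'d) \<times> (real^'d) \<Rightarrow> complex" and t :: "real^'d"
    assume Hm: "H \<in> borel_measurable borel" and "\<forall>l. integrable lborel (\<lambda>z. exp (l * \<omega> (norm z)) * cmod (H z))"
    then have H: "integrable lborel (\<lambda>z. exp (l * \<omega> (norm z)) * cmod (H z))" for l by blast
    have Hn: "integrable lborel (\<lambda>z. (1 + norm z) ^ n * cmod (H z))" for n
    proof -
      obtain C k where C: "C > 0" "k > 0" "\<And>t. t \<ge> 0 \<Longrightarrow> (1 + t) ^ n \<le> C * exp (k * \<omega> t)"
        using weight_polynomial[OF w] by blast
      show ?thesis
      proof (rule integrable_dominated[OF integrable_mult_right[OF H[of k], of C]])
        show "(\<lambda>z. (1 + norm z) ^ n * cmod (H z)) \<in> borel_measurable lborel" using Hm by measurable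
        have "(1 + norm z) ^ n * cmod (H z) \<le> C * (exp (k * \<omega> (norm z)) * cmod (H z))" for z
          using mult_right_mono[OF C(3)[of "norm z"], of "cmod (H z)"] by (simp add: mult.assoc)
        then show "AE z in lborel. norm ((1 + norm z) ^ n * cmod (H z)) \<le> norm (C * (exp (k * \<omega> (norm z)) * cmod (H z)))"
          by (intro AE_I2) (auto intro: order_trans[OF _ abs_ge_self])
      qed
    qed
    have pt: "cmod (complex_of_real (exp (\<mu> * \<omega> (norm t))) * (H z * (k (t - P z) (Q z) * atom a (P z) (Q z) t)))
        \<le> ?C * (exp (?l * \<omega> (norm z)) * cmod (H z))" for z
    proof -
      have "exp (\<mu> * \<omega> (norm t)) \<le> C1 * exp (\<mu>' * \<omega> (norm (P z))) * exp (norm (t - P z))"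
        using C1(3)[of "P z" "t - P z"] by simp
      also have "\<dots> \<le> C1 * exp (\<mu>' * \<omega> (norm z)) * exp (norm (t - P z))"
        using C1 weight_mono[OF w norm_ge_zero P[of z]] by (intro mult_right_mono mult_left_mono) auto
      finally have "exp (\<mu> * \<omega> (norm t)) * (cmod (H z) * (cmod (k (t - P z) (Q z)) * exp (- a * (norm (t - P z))\<^sup>2)))
        \<le> (C1 * exp (\<mu>' * \<omega> (norm z)) * exp (norm (t - P z))) * (cmod (H z) * (cmod (k (t - P z) (Q z)) * exp (- a * (norm (t - P z))\<^sup>2)))"
        by (intro mult_right_mono) auto
      also have "\<dots> = C1 * exp (\<mu>' * \<omega> (norm z)) * cmod (H z) * (cmod (k (t - P z) (Q z)) * exp (norm (t - P z)) * exp (- a * (norm (t - P z))\<^sup>2))"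
        by (simp only: mult_ac)
      also have "\<dots> \<le> C1 * exp (\<mu>' * \<omega> (norm z)) * cmod (H z) * (C2 * (C3 * exp (l3 * \<omega> (norm z))))"
      proof (intro mult_left_mono)
        have "cmod (k (t - P z) (Q z)) * exp (norm (t - P z)) * exp (- a * (norm (t - P z))\<^sup>2) \<le> C2 * (1 + norm (Q z)) ^ n"
          by (rule C2(2))
        also have "\<dots> \<le> C2 * (1 + norm z) ^ n" using C2(1) Q by (intro mult_left_mono power_mono) auto
        also have "\<dots> \<le> C2 * (C3 * exp (l3 * \<omega> (norm z)))" using C2(1) by (intro mult_left_mono C3(3)) auto
        finally show "cmod (k (t - P z) (Q z)) * exp (norm (t - P z)) * exp (- a * (norm (t - P z))\<^sup>2) \<le> C2 * (C3 * exp (l3 * \<omega> (norm z)))" .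
      qed (use C1 in auto)
      finally show ?thesis by (simp add: norm_mult norm_atom distrib_right exp_add mult_ac)
    qed
    have I: "integrable lborel (\<lambda>z. ?C * (exp (?l * \<omega> (norm z)) * cmod (H z)))" by (intro integrable_mult_right H)
    have m: "(\<lambda>z. complex_of_real (exp (\<mu> * \<omega> (norm t))) * (H z * (k (t - P z) (Q z) * atom a (P z) (Q z) t))) \<in> borel_measurable lborel"
    proof -
      note [measurable] = Hm PQ
      have [measurable]: "(\<lambda>z. k (t - P z) (Q z)) \<in> borel_measurable borel"
        by (rule symbol_measurable[OF k]) measurable
      show ?thesis by measurable
    qed
    have "exp (\<mu> * \<omega> (norm t)) * cmod (multi_deriv \<alpha> (\<lambda>t. LINT z|lborel. H z * atom a (P z) (Q z) t) t)
       = cmod (LINT z|lborel. complex_of_real (exp (\<mu> * \<omega> (norm t))) * (H z * (k (t - P z) (Q z) * atom a (P z) (Q z) t)))"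
      unfolding mdi foldr[OF Hn Hm] by (subst integral_mult_right_zero) (simp add: norm_mult)
    also have "\<dots> \<le> (LINT z|lborel. ?C * (exp (?l * \<omega> (norm z)) * cmod (H z)))"
    proof (intro norm_integral_le pt I)
      show "integrable lborel (\<lambda>z. complex_of_real (exp (\<mu> * \<omega> (norm t))) * (H z * (k (t - P z) (Q z) * atom a (P z) (Q z) t)))"
        by (rule integrable_dominated[OF I m])
          (use pt in \<open>auto intro!: AE_I2 intro: order_trans[OF _ abs_ge_self]\<close>)
    qed
    also have "\<dots> = ?C * (LINT z|lborel. exp (?l * \<omega> (norm z)) * cmod (H z))" by (rule integral_mult_right_zero)
    finally show "exp (\<mu> * \<omega> (norm t)) * cmod (multi_deriv \<alpha> (\<lambda>t. LINT z|lborel. H z * atom a (P z) (Q z) t) t)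
        \<le> ?C * (LINT z|lborel. exp (?l * \<omega> (norm z)) * cmod (H z))" .
  qed
qed

text \<open>By the inversion formula \<open>f\<close> is the superposition with coefficients \<open>stft f\<close>.\<close>
lemma S_seminorm_le_stft:
  assumes w: "weight_function \<omega>" and \<mu>: "\<mu> > 0"
  obtains C l where "C \<ge> 0" "l \<ge> 0"
    "\<And>f :: real^'d::finite \<Rightarrow> complex. f \<in> S_omega \<omega> \<Longrightarrow>
       S_seminorm \<omega> \<mu> \<alpha> f \<le> C * (LINT z|lborel. exp (l * \<omega> (norm z)) * cmod (stft f z))"
proof -
  let ?c = "complex_of_real ((2 * pi) ^ CARD('d) * sqrt (pi / 2) ^ CARD('d))"
  have c: "?c \<noteq> 0" by simp
  have nf: "norm (fst z) \<le> norm z" "norm (snd z) \<le> norm z" for z :: "(real^'d) \<times> (real^'d)"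
    by (cases z, simp add: norm_fst_le norm_snd_le)+
  obtain C l where C: "C \<ge> 0" "l \<ge> 0" "\<forall>(H :: (real^'d) \<times> (real^'d) \<Rightarrow> complex) t. H \<in> borel_measurable borel \<longrightarrow>
      (\<forall>l. integrable lborel (\<lambda>z. exp (l * \<omega> (norm z)) * cmod (H z))) \<longrightarrow>
      exp (\<mu> * \<omega> (norm t)) * cmod (multi_deriv \<alpha> (\<lambda>t. LINT z|lborel. H z * atom 1 (fst z) (snd z) t) t)
        \<le> C * (LINT z|lborel. exp (l * \<omega> (norm z)) * cmod (H z))"
    using weighted_derivative_bound[OF w \<mu> zero_less_one measurable_fst_borel measurable_snd_borel nf, of \<alpha>] by (elim exE conjE)
  show ?thesis
  proof (rule that[of "C / cmod ?c" l])
    fix f :: "real^'d \<Rightarrow> complex" assume f: "f \<in> S_omega \<omega>"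
    note [measurable] = S_omega_basic(3)[OF f]
    let ?H = "\<lambda>z. stft f z / ?c"
    have eq: "f = (\<lambda>t. LINT z|lborel. ?H z * atom 1 (fst z) (snd z) t)"
    proof
      fix t
      have "(LINT z|lborel. ?H z * atom 1 (fst z) (snd z) t) = (LINT z|lborel. (1 / ?c) * (stft f z * atom 1 (fst z) (snd z) t))"
        by (simp add: field_simps)
      also have "\<dots> = 1 / ?c * synth (stft f) t" unfolding synth_def by (rule integral_mult_right_zero)
      finally show "f t = (LINT z|lborel. ?H z * atom 1 (fst z) (snd z) t)"
        using c by (simp only: stft_inversion[OF w f]) simp
    qed
    have Hm: "?H \<in> borel_measurable borel" by measurable
    have e: "exp (l * \<omega> (norm z)) * cmod (?H z) = 1 / cmod ?c * (exp (l * \<omega> (norm z)) * cmod (stft f z))" for l z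
      by (simp only: norm_divide times_divide_eq_left times_divide_eq_right mult_1)
    let ?I = "LINT z|lborel. exp (l * \<omega> (norm z)) * cmod (stft f z)" and ?J = "LINT z|lborel. exp (l * \<omega> (norm z)) * cmod (?H z)"
    have HI: "integrable lborel (\<lambda>z. exp (l * \<omega> (norm z)) * cmod (?H z))" for l
      unfolding e by (intro integrable_mult_right integrable_weighted_stft[OF w f])
    have "exp (\<mu> * \<omega> (norm t)) * cmod (multi_deriv \<alpha> f t) \<le> C * ?J" for t
      using C(3)[rule_format, OF Hm HI, of t] eq by simp
    then have "S_seminorm \<omega> \<mu> \<alpha> f \<le> C * ?J"
      unfolding S_seminorm_def by (intro cSUP_least) auto
    also have "\<dots> = C * (1 / cmod ?c * ?I)"
      unfolding e by (simp only: integral_mult_right_zero)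
    finally show "S_seminorm \<omega> \<mu> \<alpha> f \<le> C / cmod ?c * ?I"
      by (simp only: times_divide_eq_left times_divide_eq_right mult_1)
  qed (use C in auto)
qed

text \<open>The Fourier transform of the atom at \<open>(x, \<xi>)\<close> is, up to the unimodular factor \<open>exp (\<i> x \<bullet> \<xi>)\<close> and a
constant, the atom of width 1/4 at \<open>(\<xi>, - x)\<close>.\<close>
lemma S_seminorm_fourier_le_stft:
  assumes w: "weight_function \<omega>" and \<mu>: "\<mu> > 0"
  obtains C l where "C \<ge> 0" "l \<ge> 0"
    "\<And>f :: real^'d::finite \<Rightarrow> complex. f \<in> S_omega \<omega> \<Longrightarrow>
       S_seminorm \<omega> \<mu> \<alpha> (fourier f) \<le> C * (LINT z|lborel. exp (l * \<omega> (norm z)) * cmod (stft f z))"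
proof -
  let ?c = "complex_of_real ((2 * pi) ^ CARD('d) * sqrt (pi / 2) ^ CARD('d))"
  let ?d = "complex_of_real (sqrt pi ^ CARD('d)) / ?c"
  have c: "?c \<noteq> 0" by simp
  have nf: "norm (snd z) \<le> norm z" "norm (- fst z) \<le> norm z" for z :: "(real^'d) \<times> (real^'d)"
    by (cases z, simp add: norm_fst_le norm_snd_le)+
  have q: "(1/4::real) > 0" by simp
  have mf: "(\<lambda>z. - fst z) \<in> borel_measurable (borel :: ((real^'d) \<times> (real^'d)) measure)" by measurable
  obtain C l where C: "C \<ge> 0" "l \<ge> 0" "\<forall>(H :: (real^'d) \<times> (real^'d) \<Rightarrow> complex) t. H \<in> borel_measurable borel \<longrightarrow>
      (\<forall>l. integrable lborel (\<lambda>z. exp (l * \<omega> (norm z)) * cmod (H z))) \<longrightarrow>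
      exp (\<mu> * \<omega> (norm t)) * cmod (multi_deriv \<alpha> (\<lambda>t. LINT z|lborel. H z * atom (1/4) (snd z) (- fst z) t) t)
        \<le> C * (LINT z|lborel. exp (l * \<omega> (norm z)) * cmod (H z))"
    using weighted_derivative_bound[OF w \<mu> q measurable_snd_borel mf nf, of \<alpha>] by (elim exE conjE)
  show ?thesis
  proof (rule that[of "C * cmod ?d" l])
    fix f :: "real^'d \<Rightarrow> complex" assume f: "f \<in> S_omega \<omega>"
    note [measurable] = S_omega_basic(3)[OF f]
    let ?H = "\<lambda>z. ?d * (stft f z * exp (\<i> * complex_of_real (fst z \<bullet> snd z)))"
    have eq: "fourier f = (\<lambda>t. LINT z|lborel. ?H z * atom (1/4) (snd z) (- fst z) t)"
    proof
      fix t :: "real^'d"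
      let ?b = "\<lambda>y. exp (- (\<i> * complex_of_real (y \<bullet> t)))"
      have b: "?b \<in> borel_measurable borel" by measurable
      have at: "(LINT y|lborel. atom 1 (fst z) (snd z) y * ?b y)
          = complex_of_real (sqrt pi ^ CARD('d)) * (exp (\<i> * complex_of_real (fst z \<bullet> snd z)) * atom (1/4) (snd z) (- fst z) t)" for z
        using fourier_atom[of 1 "fst z" "snd z" t]
        by (simp add: fourier_def atom_def inner_diff_right inner_commute algebra_simps flip: exp_add)
      have "?c * fourier f t = fourier (synth (stft f)) t"
        unfolding fourier_def stft_inversion[OF w f] mult.assoc by (rule integral_mult_right_zero[symmetric])
      also have "\<dots> = (LINT z|lborel. stft f z * (LINT y|lborel. atom 1 (fst z) (snd z) y * ?b y))"
        unfolding fourier_def by (rule synth_pairing(1)[OF integrable_stft[OF w f] b, of 1]) simp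
      also have "\<dots> = (LINT z|lborel. ?c * (?H z * atom (1/4) (snd z) (- fst z) t))"
        unfolding at using c by (simp add: mult_ac)
      also have "\<dots> = ?c * (LINT z|lborel. ?H z * atom (1/4) (snd z) (- fst z) t)"
        by (rule integral_mult_right_zero)
      finally show "fourier f t = (LINT z|lborel. ?H z * atom (1/4) (snd z) (- fst z) t)"
        using c by (simp only: mult_cancel_left) simp
    qed
    have Hm: "?H \<in> borel_measurable borel" by measurable
    have e: "exp (l * \<omega> (norm z)) * cmod (?H z) = cmod ?d * (exp (l * \<omega> (norm z)) * cmod (stft f z))" for l z
      by (simp only: norm_mult norm_exp_i_times mult_1_right) (simp only: mult_ac)
    let ?I = "LINT z|lborel. exp (l * \<omega> (norm z)) * cmod (stft f z)" and ?J = "LINT z|lborel. exp (l * \<omega> (norm z)) * cmod (?H z)"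
    have HI: "integrable lborel (\<lambda>z. exp (l * \<omega> (norm z)) * cmod (?H z))" for l
      unfolding e by (intro integrable_mult_right integrable_weighted_stft[OF w f])
    have "exp (\<mu> * \<omega> (norm t)) * cmod (multi_deriv \<alpha> (fourier f) t) \<le> C * ?J" for t
      unfolding eq by (rule C(3)[rule_format, OF Hm HI])
    then have "S_seminorm \<omega> \<mu> \<alpha> (fourier f) \<le> C * ?J"
      unfolding S_seminorm_def by (intro cSUP_least) auto
    also have "\<dots> = C * (cmod ?d * ?I)"
      unfolding e by (simp only: integral_mult_right_zero)
    finally show "S_seminorm \<omega> \<mu> \<alpha> (fourier f) \<le> C * cmod ?d * ?I"
      by (simp only: mult.assoc)
  qed (use C in auto)
qed

section \<open>Continuity in seminorm topologies\<close>

text \<open>A linear map is continuous if each seminorm of the image is bounded by a multiple of seminorms of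
the argument. The source carries a subspace topology so that the criterion also covers the inverse map, which
is only defined on the image of the analysis operator.\<close>
lemma continuous_map_seminorm_topology:
  assumes M: "M \<subseteq> W" "\<And>c c'. c \<in> M \<Longrightarrow> c' \<in> M \<Longrightarrow> (\<lambda>x. c x - c' x) \<in> M"
    and V: "\<And>f g. f \<in> V \<Longrightarrow> g \<in> V \<Longrightarrow> (\<lambda>x. f x - g x) \<in> V"
    and h: "\<And>c. c \<in> M \<Longrightarrow> h c \<in> V" "\<And>c c'. c \<in> M \<Longrightarrow> c' \<in> M \<Longrightarrow> h (\<lambda>x. c x - c' x) = (\<lambda>y. h c y - h c' y)"
    and P: "P \<noteq> {}" "\<And>p f g. p \<in> P \<Longrightarrow> f \<in> V \<Longrightarrow> g \<in> V \<Longrightarrow> p (\<lambda>x. f x + g x) \<le> p f + p g"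
    and Q: "\<And>q. q \<in> Q \<Longrightarrow> q (\<lambda>x. 0) = 0"
    and bound: "\<And>p. p \<in> P \<Longrightarrow> \<exists>q\<in>Q. \<exists>q'\<in>Q. \<exists>C\<ge>0. \<forall>c\<in>M. p (h c) \<le> C * (q c + q' c)"
  shows "continuous_map (subtopology (seminorm_topology W Q) M) (seminorm_topology V P) h"
proof -
  obtain p0 where "p0 \<in> P" using P(1) by blast
  then have "Q \<noteq> {}" using bound by blast
  then have top: "topspace (subtopology (seminorm_topology W Q) M) = M"
    using M(1) by (auto simp: topspace_seminorm_topology)
  show ?thesis
    unfolding seminorm_topology_def[of V P] continuous_on_generated_topo_iff top
  proof (intro conjI allI impI)
    have VU: "\<Union> {{g \<in> V. p (\<lambda>x. g x - f x) < \<epsilon>} |p f \<epsilon>. p \<in> P \<and> f \<in> V \<and> 0 < \<epsilon>} = V"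
      using topspace_seminorm_topology[OF P(1), of V]
      unfolding seminorm_topology_def topology_generated_by_topspace .
    show "h ` M \<subseteq> \<Union> {{g \<in> V. p (\<lambda>x. g x - f x) < \<epsilon>} |p f \<epsilon>. p \<in> P \<and> f \<in> V \<and> 0 < \<epsilon>}"
      unfolding VU using h(1) by (rule image_subsetI)
    fix U assume "U \<in> {{g \<in> V. p (\<lambda>x. g x - f x) < \<epsilon>} |p f \<epsilon>. p \<in> P \<and> f \<in> V \<and> 0 < \<epsilon>}"
    then obtain p f \<epsilon> where U: "U = {g \<in> V. p (\<lambda>x. g x - f x) < \<epsilon>}" and p: "p \<in> P" and f: "f \<in> V" by blast
    show "openin (subtopology (seminorm_topology W Q) M) (h -` U \<inter> M)"
    proof (subst openin_subopen, intro ballI)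
      fix c1 assume c1: "c1 \<in> h -` U \<inter> M"
      obtain q q' C where q: "q \<in> Q" "q' \<in> Q" and C: "C \<ge> 0" "\<And>c. c \<in> M \<Longrightarrow> p (h c) \<le> C * (q c + q' c)"
        using bound[OF p] by blast
      define \<delta> where "\<delta> = (\<epsilon> - p (\<lambda>x. h c1 x - f x)) / (2 * (C + 1))"
      have \<delta>: "\<delta> > 0" using c1 C(1) by (simp add: U \<delta>_def)
      let ?B = "\<lambda>q. {c \<in> W. q (\<lambda>x. c x - c1 x) < \<delta>}"
      have c1W: "c1 \<in> W" "c1 \<in> M" using c1 M by auto
      have opB: "openin (seminorm_topology W Q) (?B q)" if "q \<in> Q" for q
        unfolding seminorm_topology_def using that c1W \<delta> by (intro topology_generated_by_Basis) blast
      show "\<exists>T. openin (subtopology (seminorm_topology W Q) M) T \<and> c1 \<in> T \<and> T \<subseteq> h -` U \<inter> M"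
      proof (intro exI conjI)
        show "openin (subtopology (seminorm_topology W Q) M) ((?B q \<inter> ?B q') \<inter> M)"
          by (intro openin_subtopology_Int openin_Int opB q)
        show "c1 \<in> (?B q \<inter> ?B q') \<inter> M" using c1W \<delta> Q[OF q(1)] Q[OF q(2)] by simp
        show "(?B q \<inter> ?B q') \<inter> M \<subseteq> h -` U \<inter> M"
        proof
          fix c assume c: "c \<in> (?B q \<inter> ?B q') \<inter> M"
          then have cM: "c \<in> M" by simp
          have "p (\<lambda>x. h c x - f x) = p (\<lambda>x. (h c x - h c1 x) + (h c1 x - f x))" by simp
          also have "\<dots> \<le> p (\<lambda>x. h c x - h c1 x) + p (\<lambda>x. h c1 x - f x)"
            using cM c1W f by (intro P(2) p V h(1))
          also have "p (\<lambda>x. h c x - h c1 x) \<le> C * (q (\<lambda>x. c x - c1 x) + q' (\<lambda>x. c x - c1 x))"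
            using C(2)[OF M(2)[OF cM c1W(2)]] h(2)[OF cM c1W(2)] by simp
          also have "\<dots> \<le> C * (\<delta> + \<delta>)" using c C(1) by (intro mult_left_mono add_mono) auto
          also have "\<dots> < (C + 1) * (\<delta> + \<delta>)" using \<delta> by simp
          also have "\<dots> = \<epsilon> - p (\<lambda>x. h c1 x - f x)"
          proof -
            have "2 * (C + 1) \<noteq> 0" using C(1) by simp
            then have "2 * (C + 1) * \<delta> = \<epsilon> - p (\<lambda>x. h c1 x - f x)"
              unfolding \<delta>_def times_divide_eq_right by (rule nonzero_mult_div_cancel_left)
            then show ?thesis by (simp add: algebra_simps)
          qed
          finally show "c \<in> h -` U \<inter> M" using cM h(1) by (simp add: U)
        qed
      qed
    qed
  qed
qed

section \<open>Linear structure of the spaces\<close>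

lemma partial_derivs_add:
  assumes "C_infinity f" "C_infinity g"
  shows "foldr partial_deriv is (\<lambda>x. f x + g x) = (\<lambda>x. foldr partial_deriv is f x + foldr partial_deriv is g x)"
proof (induction "is")
  case (Cons i "is")
  show ?case
  proof
    fix x
    have "(\<lambda>t. foldr partial_deriv is f (x + t *\<^sub>R axis i 1)) differentiable (at 0)"
      "(\<lambda>t. foldr partial_deriv is g (x + t *\<^sub>R axis i 1)) differentiable (at 0)"
      using assms unfolding C_infinity_def by blast+
    then show "foldr partial_deriv (i # is) (\<lambda>x. f x + g x) x = foldr partial_deriv (i # is) f x + foldr partial_deriv (i # is) g x"
      by (simp add: Cons.IH partial_deriv_def[of i])
  qed
qed simp

lemma partial_derivs_scale:
  assumes "C_infinity f"
  shows "foldr partial_deriv is (\<lambda>x. a * f x) = (\<lambda>x. a * foldr partial_deriv is f x)"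
proof (induction "is")
  case (Cons i "is")
  show ?case
  proof
    fix x
    have "(\<lambda>t. foldr partial_deriv is f (x + t *\<^sub>R axis i 1)) differentiable (at 0)"
      using assms unfolding C_infinity_def by blast
    then have "((\<lambda>t. a * foldr partial_deriv is f (x + t *\<^sub>R axis i 1)) has_vector_derivative
        a * vector_derivative (\<lambda>t. foldr partial_deriv is f (x + t *\<^sub>R axis i 1)) (at 0)) (at 0)"
      by (intro has_vector_derivative_mult_right) (simp add: vector_derivative_works)
    from vector_derivative_at[OF this]
    show "foldr partial_deriv (i # is) (\<lambda>x. a * f x) x = a * foldr partial_deriv (i # is) f x"
      by (simp add: Cons.IH partial_deriv_def[of i])
  qed
qed simp

lemma C_infinity_add: "C_infinity f \<Longrightarrow> C_infinity g \<Longrightarrow> C_infinity (\<lambda>x. f x + g x)"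
  unfolding C_infinity_def[of "\<lambda>x. f x + g x"] partial_derivs_add
  by (auto simp: C_infinity_def intro!: continuous_intros differentiable_add)

lemma C_infinity_scale: "C_infinity f \<Longrightarrow> C_infinity (\<lambda>x. a * f x)"
  unfolding C_infinity_def[of "\<lambda>x. a * f x"] partial_derivs_scale
  by (auto simp: C_infinity_def intro!: continuous_intros differentiable_mult)

lemma multi_deriv_add:
  assumes "C_infinity f" "C_infinity g"
  shows "multi_deriv \<alpha> (\<lambda>x. f x + g x) = (\<lambda>x. multi_deriv \<alpha> f x + multi_deriv \<alpha> g x)"
proof -
  obtain "is" where "\<And>u. multi_deriv \<alpha> u = foldr partial_deriv is u" using multi_deriv_eq_foldr[of \<alpha>] by metis
  then show ?thesis by (simp add: partial_derivs_add[OF assms])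
qed

lemma multi_deriv_scale:
  assumes "C_infinity f"
  shows "multi_deriv \<alpha> (\<lambda>x. a * f x) = (\<lambda>x. a * multi_deriv \<alpha> f x)"
proof -
  obtain "is" where "\<And>u. multi_deriv \<alpha> u = foldr partial_deriv is u" using multi_deriv_eq_foldr[of \<alpha>] by metis
  then show ?thesis by (simp add: partial_derivs_scale[OF assms])
qed

lemma fourier_add:
  assumes "integrable lborel f" "integrable lborel g"
  shows "fourier (\<lambda>x. f x + g x) = (\<lambda>y. fourier f y + fourier g y)"
proof
  fix y
  have I: "integrable lborel (\<lambda>x. u x * exp (- (\<i> * complex_of_real (x \<bullet> y))))" if u: "integrable lborel u" for u :: "real^'a \<Rightarrow> complex"
  proof -
    have [measurable]: "u \<in> borel_measurable borel" using u by auto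
    show ?thesis by (rule integrable_dominated[OF integrable_norm[OF u]]) (auto simp: norm_mult)
  qed
  show "fourier (\<lambda>x. f x + g x) y = fourier f y + fourier g y"
    unfolding fourier_def distrib_right by (intro Bochner_Integration.integral_add I assms)
qed

lemma fourier_scale: "fourier (\<lambda>x. a * f x) = (\<lambda>y. a * fourier f y)"
  unfolding fourier_def mult.assoc by (simp only: integral_mult_right_zero)

lemma S_omegaD:
  assumes "f \<in> S_omega \<omega>"
  shows "integrable lborel f" "C_infinity f" "C_infinity (fourier f)"
  using assms unfolding S_omega_def by auto

lemma S_seminorm_add_pointwise:
  assumes f: "f \<in> S_omega \<omega>" and g: "g \<in> S_omega \<omega>" and \<mu>: "\<mu> > 0"
  shows "exp (\<mu> * \<omega> (norm x)) * cmod (multi_deriv \<alpha> (\<lambda>x. f x + g x) x) \<le> S_seminorm \<omega> \<mu> \<alpha> f + S_seminorm \<omega> \<mu> \<alpha> g"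
    "exp (\<mu> * \<omega> (norm x)) * cmod (multi_deriv \<alpha> (fourier (\<lambda>x. f x + g x)) x)
       \<le> S_seminorm \<omega> \<mu> \<alpha> (fourier f) + S_seminorm \<omega> \<mu> \<alpha> (fourier g)"
proof -
  have t: "exp s * cmod (a + b) \<le> A + B" if "exp s * cmod a \<le> A" "exp s * cmod b \<le> B" for s a b A B
    using mult_left_mono[OF norm_triangle_ineq[of a b] exp_ge_zero[of s]] that by (simp add: distrib_left)
  show "exp (\<mu> * \<omega> (norm x)) * cmod (multi_deriv \<alpha> (\<lambda>x. f x + g x) x) \<le> S_seminorm \<omega> \<mu> \<alpha> f + S_seminorm \<omega> \<mu> \<alpha> g"
    unfolding multi_deriv_add[OF S_omegaD(2)[OF f] S_omegaD(2)[OF g]] by (intro t S_seminorm_upper f g \<mu>)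
  show "exp (\<mu> * \<omega> (norm x)) * cmod (multi_deriv \<alpha> (fourier (\<lambda>x. f x + g x)) x)
       \<le> S_seminorm \<omega> \<mu> \<alpha> (fourier f) + S_seminorm \<omega> \<mu> \<alpha> (fourier g)"
    unfolding fourier_add[OF S_omegaD(1)[OF f] S_omegaD(1)[OF g]] multi_deriv_add[OF S_omegaD(3)[OF f] S_omegaD(3)[OF g]]
    by (intro t S_seminorm_upper f g \<mu>)
qed

lemma S_omega_add:
  assumes f: "f \<in> S_omega \<omega>" and g: "g \<in> S_omega \<omega>"
  shows "(\<lambda>x. f x + g x) \<in> S_omega \<omega>"
proof -
  have "C_infinity (fourier (\<lambda>x. f x + g x))"
    unfolding fourier_add[OF S_omegaD(1)[OF f] S_omegaD(1)[OF g]] by (intro C_infinity_add S_omegaD(3)[OF f] S_omegaD(3)[OF g])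
  then show ?thesis
    unfolding S_omega_def
    by (auto intro!: Bochner_Integration.integrable_add C_infinity_add S_omegaD[OF f] S_omegaD[OF g]
        bdd_aboveI2[OF S_seminorm_add_pointwise(1)[OF f g]] bdd_aboveI2[OF S_seminorm_add_pointwise(2)[OF f g]])
qed

lemma S_omega_scale:
  assumes f: "f \<in> S_omega \<omega>"
  shows "(\<lambda>x. a * f x) \<in> S_omega \<omega>"
proof -
  have e: "exp s * cmod (a * b) = cmod a * (exp s * cmod b)" for s b by (simp add: norm_mult)
  have "exp (\<mu> * \<omega> (norm x)) * cmod (multi_deriv \<alpha> (\<lambda>x. a * f x) x) \<le> cmod a * S_seminorm \<omega> \<mu> \<alpha> f"
    and "exp (\<mu> * \<omega> (norm x)) * cmod (multi_deriv \<alpha> (fourier (\<lambda>x. a * f x)) x) \<le> cmod a * S_seminorm \<omega> \<mu> \<alpha> (fourier f)"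
    if "\<mu> > 0" for \<mu> \<alpha> x
    unfolding fourier_scale multi_deriv_scale[OF S_omegaD(2)[OF f]] multi_deriv_scale[OF S_omegaD(3)[OF f]] e
    by (intro mult_left_mono S_seminorm_upper[OF f that] norm_ge_zero)+
  note b = this
  have "C_infinity (fourier (\<lambda>x. a * f x))"
    unfolding fourier_scale by (intro C_infinity_scale S_omegaD(3)[OF f])
  then show ?thesis
    unfolding S_omega_def
    by (auto intro!: C_infinity_scale S_omegaD[OF f] integrable_mult_right bdd_aboveI2[OF b(1)] bdd_aboveI2[OF b(2)])
qed

lemma C_infinity_zero: "C_infinity (\<lambda>x. 0)"
proof -
  have "foldr partial_deriv is (\<lambda>x. 0) = (\<lambda>x. 0)" for "is" :: "'a list"
    by (induction "is") (auto simp: partial_deriv_def)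
  then show ?thesis by (auto simp: C_infinity_def)
qed

lemma multi_deriv_zero: "multi_deriv \<alpha> (\<lambda>x. 0) = (\<lambda>x. 0)"
  using multi_deriv_scale[OF C_infinity_zero, of \<alpha> 0] by simp

lemma fourier_zero: "fourier (\<lambda>x. 0) = (\<lambda>y. 0)"
  by (simp add: fourier_def fun_eq_iff)

lemma S_omega_zero: "(\<lambda>x. 0) \<in> S_omega \<omega>"
  by (simp add: S_omega_def fourier_zero C_infinity_zero multi_deriv_zero)

lemma S_omega_diff:
  assumes "f \<in> S_omega \<omega>" "g \<in> S_omega \<omega>"
  shows "(\<lambda>x. f x - g x) \<in> S_omega \<omega>"
  using S_omega_add[OF assms(1) S_omega_scale[OF assms(2), of "-1"]] by simp

lemma S_seminorms_zero: "p \<in> S_seminorms \<omega> \<Longrightarrow> p (\<lambda>x. 0) = 0"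
  by (auto simp: S_seminorms_def S_seminorm_def fourier_zero multi_deriv_zero)

lemma S_seminorms_add:
  assumes "p \<in> S_seminorms \<omega>" and f: "f \<in> S_omega \<omega>" and g: "g \<in> S_omega \<omega>"
  shows "p (\<lambda>x. f x + g x) \<le> p f + p g"
  using assms(1) unfolding S_seminorms_def
proof (elim UnE CollectE exE conjE)
  fix \<mu> \<alpha> assume p: "p = S_seminorm \<omega> \<mu> \<alpha>" and \<mu>: "\<mu> > 0"
  show ?thesis unfolding p S_seminorm_def[of \<omega> \<mu> \<alpha> "\<lambda>x. f x + g x"]
    by (intro cSUP_least S_seminorm_add_pointwise f g \<mu>) simp
next
  fix \<mu> \<alpha> assume p: "p = (\<lambda>u. S_seminorm \<omega> \<mu> \<alpha> (fourier u))" and \<mu>: "\<mu> > 0"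
  show ?thesis unfolding p S_seminorm_def[of \<omega> \<mu> \<alpha> "fourier (\<lambda>x. f x + g x)"]
    by (intro cSUP_least S_seminorm_add_pointwise f g \<mu>) simp
qed

lemma Lambda_norm_add_pointwise:
  assumes "c \<in> Lambda_omega \<omega> \<Lambda>" "d \<in> Lambda_omega \<omega> \<Lambda>" "\<sigma> \<in> \<Lambda>"
  shows "cmod (c \<sigma> + d \<sigma>) * exp (real k * \<omega> (norm \<sigma>)) \<le> Lambda_norm \<omega> \<Lambda> k c + Lambda_norm \<omega> \<Lambda> k d"
  using mult_right_mono[OF norm_triangle_ineq[of "c \<sigma>" "d \<sigma>"] exp_ge_zero[of "real k * \<omega> (norm \<sigma>)"]]
    Lambda_norm_upper[OF assms(1,3), of k] Lambda_norm_upper[OF assms(2,3), of k] by (simp add: distrib_right)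

lemma Lambda_omega_add:
  assumes "c \<in> Lambda_omega \<omega> \<Lambda>" "d \<in> Lambda_omega \<omega> \<Lambda>"
  shows "(\<lambda>\<sigma>. c \<sigma> + d \<sigma>) \<in> Lambda_omega \<omega> \<Lambda>"
  unfolding Lambda_omega_def using assms
  by (auto intro!: bdd_aboveI2[OF Lambda_norm_add_pointwise[OF assms]] simp: Lambda_omega_def)

lemma Lambda_omega_scale:
  assumes c: "c \<in> Lambda_omega \<omega> \<Lambda>"
  shows "(\<lambda>\<sigma>. a * c \<sigma>) \<in> Lambda_omega \<omega> \<Lambda>"
proof -
  have "cmod (a * c \<sigma>) * exp (real k * \<omega> (norm \<sigma>)) \<le> cmod a * Lambda_norm \<omega> \<Lambda> k c" if "\<sigma> \<in> \<Lambda>" for \<sigma> k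
    using mult_left_mono[OF Lambda_norm_upper[OF c that, of k] norm_ge_zero[of a]] by (simp add: norm_mult mult.assoc)
  note b = this
  show ?thesis unfolding Lambda_omega_def using c
    by (auto intro!: bdd_aboveI2[OF b] simp: Lambda_omega_def)
qed

lemma Lambda_omega_diff:
  assumes "c \<in> Lambda_omega \<omega> \<Lambda>" "d \<in> Lambda_omega \<omega> \<Lambda>"
  shows "(\<lambda>\<sigma>. c \<sigma> - d \<sigma>) \<in> Lambda_omega \<omega> \<Lambda>"
  using Lambda_omega_add[OF assms(1) Lambda_omega_scale[OF assms(2), of "-1"]] by simp

lemma Lambda_norm_add:
  assumes "\<Lambda> \<noteq> {}" "c \<in> Lambda_omega \<omega> \<Lambda>" "d \<in> Lambda_omega \<omega> \<Lambda>"
  shows "Lambda_norm \<omega> \<Lambda> k (\<lambda>\<sigma>. c \<sigma> + d \<sigma>) \<le> Lambda_norm \<omega> \<Lambda> k c + Lambda_norm \<omega> \<Lambda> k d"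
  unfolding Lambda_norm_def[of \<omega> \<Lambda> k "\<lambda>\<sigma>. c \<sigma> + d \<sigma>"]
  by (intro cSUP_least Lambda_norm_add_pointwise assms)

lemma Lambda_norm_zero: "\<Lambda> \<noteq> {} \<Longrightarrow> Lambda_norm \<omega> \<Lambda> k (\<lambda>\<sigma>. 0) = 0"
  by (simp add: Lambda_norm_def)

lemma stft_add:
  assumes "integrable lborel f" "integrable lborel g"
  shows "stft (\<lambda>x. f x + g x) z = stft f z + stft g z"
proof -
  have I: "integrable lborel (\<lambda>t. u t * atom 1 (fst z) (- snd z) t)" if u: "integrable lborel u" for u
  proof -
    have [measurable]: "u \<in> borel_measurable borel" using u by auto
    show ?thesis
      by (rule integrable_dominated[OF integrable_norm[OF u]])
        (auto simp: norm_mult mult_left_le norm_atom_le_1)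
  qed
  show ?thesis unfolding stft_eq distrib_right by (intro Bochner_Integration.integral_add I assms)
qed

lemma stft_scale: "stft (\<lambda>x. a * f x) z = a * stft f z"
  unfolding stft_eq mult.assoc by (rule integral_mult_right_zero)

lemma analysis_operator_add:
  assumes "f \<in> S_omega \<omega>" "g \<in> S_omega \<omega>"
  shows "analysis_operator gaussian \<Lambda> (\<lambda>x. f x + g x) = (\<lambda>\<sigma>. analysis_operator gaussian \<Lambda> f \<sigma> + analysis_operator gaussian \<Lambda> g \<sigma>)"
  using stft_add[OF S_omegaD(1)[OF assms(1)] S_omegaD(1)[OF assms(2)]]
  by (auto simp: fun_eq_iff analysis_operator_def stft_def)

lemma analysis_operator_scale:
  "analysis_operator gaussian \<Lambda> (\<lambda>x. a * f x) = (\<lambda>\<sigma>. a * analysis_operator gaussian \<Lambda> f \<sigma>)"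
  using stft_scale[of a f] by (auto simp: fun_eq_iff analysis_operator_def stft_def)

lemma analysis_operator_diff:
  assumes "f \<in> S_omega \<omega>" "g \<in> S_omega \<omega>"
  shows "analysis_operator gaussian \<Lambda> (\<lambda>x. f x - g x) = (\<lambda>\<sigma>. analysis_operator gaussian \<Lambda> f \<sigma> - analysis_operator gaussian \<Lambda> g \<sigma>)"
  using analysis_operator_add[OF assms(1) S_omega_scale[OF assms(2), of "-1"], of \<Lambda>]
  unfolding analysis_operator_scale by simp

section \<open>The analysis operator as an isomorphism onto its image\<close>

lemma Lambda_norm_analysis_bound:
  fixes \<Lambda> :: "((real^'d::finite) \<times> (real^'d)) set"
  assumes w: "weight_function \<omega>" and \<Lambda>: "\<Lambda> \<noteq> {}"
  shows "\<exists>q\<in>S_seminorms \<omega>. \<exists>q'\<in>S_seminorms \<omega>. \<exists>C\<ge>0. \<forall>f\<in>S_omega \<omega>. Lambda_norm \<omega> \<Lambda> k (analysis_operator gaussian \<Lambda> f) \<le> C * (q f + q' f)"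
proof -
  have k: "real k + 1 > 0" by simp
  obtain C \<mu> \<nu> where C: "C > 0" "\<mu> > 0" "\<nu> > 0"
    and b: "\<And>(f :: real^'d \<Rightarrow> complex) z. f \<in> S_omega \<omega> \<Longrightarrow>
       exp ((real k + 1) * \<omega> (norm z)) * cmod (stft f z) \<le> C * (S_seminorm \<omega> \<mu> (\<lambda>_. 0) f + S_seminorm \<omega> \<nu> (\<lambda>_. 0) (fourier f))"
    by (rule stft_decay[OF w k, where 'd='d]) (rule that, assumption+)
  show ?thesis
  proof (rule bexI[of _ "S_seminorm \<omega> \<mu> (\<lambda>_. 0)"], rule bexI[of _ "\<lambda>u. S_seminorm \<omega> \<nu> (\<lambda>_. 0) (fourier u)"],
      rule exI[of _ C], intro conjI ballI)
    show "0 \<le> C" using C by simp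
    show "S_seminorm \<omega> \<mu> (\<lambda>_. 0) \<in> S_seminorms \<omega>" "(\<lambda>u. S_seminorm \<omega> \<nu> (\<lambda>_. 0) (fourier u)) \<in> S_seminorms \<omega>"
      using C unfolding S_seminorms_def by blast+
    fix f :: "real^'d \<Rightarrow> complex" assume f: "f \<in> S_omega \<omega>"
    let ?B = "C * (S_seminorm \<omega> \<mu> (\<lambda>_. 0) f + S_seminorm \<omega> \<nu> (\<lambda>_. 0) (fourier f))"
    show "Lambda_norm \<omega> \<Lambda> k (analysis_operator gaussian \<Lambda> f) \<le> ?B"
      unfolding Lambda_norm_def
    proof (rule cSUP_least[OF \<Lambda>])
      fix \<sigma> assume s: "\<sigma> \<in> \<Lambda>"
      have "cmod (analysis_operator gaussian \<Lambda> f \<sigma>) * exp (real k * \<omega> (norm \<sigma>)) \<le> exp ((real k + 1) * \<omega> (norm \<sigma>)) * cmod (stft f \<sigma>)"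
      proof -
        have "exp (real k * \<omega> (norm \<sigma>)) \<le> exp ((real k + 1) * \<omega> (norm \<sigma>))"
          using weight_nonneg[OF w, of "norm \<sigma>"] by (simp add: distrib_right)
        from mult_right_mono[OF this norm_ge_zero[of "stft f \<sigma>"]]
        show ?thesis by (simp only: analysis_operator_eq[OF s] mult.commute)
      qed
      then show "cmod (analysis_operator gaussian \<Lambda> f \<sigma>) * exp (real k * \<omega> (norm \<sigma>)) \<le> ?B"
        using b[OF f, of \<sigma>] by simp
    qed
  qed
qed

lemma S_seminorm_Lambda_bound:
  fixes \<Lambda> :: "((real^'d::finite) \<times> (real^'d)) set"
  assumes w: "weight_function \<omega>" and r: "r > 0" and ne: "\<Lambda> \<noteq> {}"
    and sep: "\<And>x y. x \<in> \<Lambda> \<Longrightarrow> y \<in> \<Lambda> \<Longrightarrow> x \<noteq> y \<Longrightarrow> dist x y \<ge> r"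
    and frame: "gabor_frame gaussian \<Lambda>" and p: "p \<in> S_seminorms \<omega>"
  shows "\<exists>C\<ge>0. \<exists>k. \<forall>f\<in>S_omega \<omega>. p f \<le> C * Lambda_norm \<omega> \<Lambda> k (analysis_operator gaussian \<Lambda> f)"
proof -
  have "\<exists>C l. C \<ge> 0 \<and> l \<ge> 0 \<and> (\<forall>f\<in>S_omega \<omega>. p f \<le> C * (LINT z|lborel. exp (l * \<omega> (norm z)) * cmod (stft f z)))"
    using p unfolding S_seminorms_def
  proof (elim UnE CollectE exE conjE)
    fix \<mu> \<alpha> assume p: "p = S_seminorm \<omega> \<mu> \<alpha>" and \<mu>: "\<mu> > 0"
    show ?thesis unfolding p by (rule S_seminorm_le_stft[OF w \<mu>, of \<alpha>]) blast
  next
    fix \<mu> \<alpha> assume p: "p = (\<lambda>u. S_seminorm \<omega> \<mu> \<alpha> (fourier u))" and \<mu>: "\<mu> > 0"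
    show ?thesis unfolding p by (rule S_seminorm_fourier_le_stft[OF w \<mu>, of \<alpha>]) blast
  qed
  then obtain C l where C: "C \<ge> 0" and l: "l \<ge> 0"
    and pb: "\<forall>f\<in>S_omega \<omega>. p f \<le> C * (LINT z|lborel. exp (l * \<omega> (norm z)) * cmod (stft f z))"
    by (elim exE conjE)
  obtain D k where D: "D \<ge> 0" and Db: "\<And>f. f \<in> S_omega \<omega> \<Longrightarrow> (LINT z|lborel. exp (l * \<omega> (norm z)) * cmod (stft f z))
       \<le> D * Lambda_norm \<omega> \<Lambda> k (analysis_operator gaussian \<Lambda> f)"
    by (rule weighted_stft_bound[OF w r ne _ frame l]) (rule sep, assumption+, rule that, assumption+)
  show ?thesis
  proof (intro exI[of _ "C * D"] conjI exI[of _ k] ballI)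
    fix f :: "real^'d \<Rightarrow> complex" assume f: "f \<in> S_omega \<omega>"
    let ?N = "Lambda_norm \<omega> \<Lambda> k (analysis_operator gaussian \<Lambda> f)"
    have "p f \<le> C * (LINT z|lborel. exp (l * \<omega> (norm z)) * cmod (stft f z))" using pb f by blast
    also have "\<dots> \<le> C * (D * ?N)" by (intro mult_left_mono Db f C)
    finally show "p f \<le> C * D * ?N" by (simp add: mult.assoc)
  qed (use C D in simp)
qed

text \<open>Injectivity is the seminorm estimate applied to a
difference with vanishing coefficients, and continuity of the inverse is the same estimate.\<close>
theorem analysis_operator_isomorphism:
  fixes \<omega> :: "real \<Rightarrow> real" and \<Lambda> :: "((real^'d::finite) \<times> (real^'d)) set"
  assumes w: "weight_function \<omega>" and r: "r > 0" and ne: "\<Lambda> \<noteq> {}"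
    and sep: "\<And>x y. x \<in> \<Lambda> \<Longrightarrow> y \<in> \<Lambda> \<Longrightarrow> x \<noteq> y \<Longrightarrow> dist x y \<ge> r"
    and frame: "gabor_frame gaussian \<Lambda>"
  defines "T \<equiv> analysis_operator gaussian \<Lambda> :: (real^'d \<Rightarrow> complex) \<Rightarrow> _"
  shows "T ` S_omega \<omega> \<subseteq> Lambda_omega \<omega> \<Lambda>" "complex_subspace (T ` S_omega \<omega>)"
    "topological_isomorphism (S_topology \<omega>) (subtopology (Lambda_topology \<omega> \<Lambda>) (T ` S_omega \<omega>)) T"
proof -
  let ?M = "T ` S_omega \<omega>"
  let ?Y = "subtopology (Lambda_topology \<omega> \<Lambda>) ?M"
  show M: "?M \<subseteq> Lambda_omega \<omega> \<Lambda>"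
    unfolding T_def using analysis_operator_in_Lambda_omega[OF w] by blast
  have Tadd: "T (\<lambda>x. f x + g x) = (\<lambda>y. T f y + T g y)" and Tdiff: "T (\<lambda>x. f x - g x) = (\<lambda>y. T f y - T g y)"
    if "f \<in> S_omega \<omega>" "g \<in> S_omega \<omega>" for f g
    unfolding T_def using analysis_operator_add[OF that] analysis_operator_diff[OF that] by simp_all
  have Tscale: "T (\<lambda>x. a * f x) = (\<lambda>y. a * T f y)" for a f
    unfolding T_def by (rule analysis_operator_scale)
  have S0: "complex_subspace (S_omega \<omega> :: (real^'d \<Rightarrow> complex) set)"
    unfolding complex_subspace_def by (auto intro: S_omega_zero S_omega_add S_omega_scale)
  show M0: "complex_subspace ?M"
    unfolding complex_subspace_def
  proof (intro conjI ballI allI)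
    have "T (\<lambda>x. 0 * 0) = (\<lambda>\<sigma>. 0)" using Tscale[of 0 "\<lambda>x. 0"] by simp
    then show "(\<lambda>_. 0) \<in> ?M" using S_omega_zero[of \<omega>] by (metis image_eqI mult_zero_left)
    show "(\<lambda>x. c x + d x) \<in> ?M" if "c \<in> ?M" "d \<in> ?M" for c d
      using that by (auto simp flip: Tadd intro!: imageI S_omega_add)
    show "(\<lambda>x. a * c x) \<in> ?M" if "c \<in> ?M" for a c
      using that by (auto simp flip: Tscale intro!: imageI S_omega_scale)
  qed
  have topY: "topspace ?Y = ?M" using M by (auto simp: topspace_Lambda_topology)
  have lin: "complex_linear_on (S_omega \<omega>) T"
    unfolding complex_linear_on_def using Tadd Tscale by blast
  have bnd: "\<exists>C\<ge>0. \<exists>k. \<forall>f\<in>S_omega \<omega>. p f \<le> C * Lambda_norm \<omega> \<Lambda> k (T f)" if p: "p \<in> S_seminorms \<omega>" for p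
    unfolding T_def by (rule S_seminorm_Lambda_bound[OF w r ne sep frame p])
  have inj: "inj_on T (S_omega \<omega>)"
  proof (rule inj_onI)
    fix f g assume f: "f \<in> S_omega \<omega>" and g: "g \<in> S_omega \<omega>" and eq: "T f = T g"
    let ?p = "S_seminorm \<omega> 1 (\<lambda>_. 0) :: (real^'d \<Rightarrow> complex) \<Rightarrow> real"
    have d: "(\<lambda>x. f x - g x) \<in> S_omega \<omega>" by (rule S_omega_diff[OF f g])
    have "?p \<in> S_seminorms \<omega>" unfolding S_seminorms_def using zero_less_one by blast
    from bnd[OF this] obtain C k where "?p (\<lambda>x. f x - g x) \<le> C * Lambda_norm \<omega> \<Lambda> k (T (\<lambda>x. f x - g x))" using d by blast
    then have "?p (\<lambda>x. f x - g x) \<le> 0" by (simp add: Tdiff[OF f g] eq Lambda_norm_zero[OF ne])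
    then have "cmod (f x - g x) \<le> 0" for x using S_omega_bounded[OF d w, of x] by linarith
    then show "f = g" by (simp add: fun_eq_iff)
  qed
  let ?h = "inv_into (S_omega \<omega>) T"
  have h: "?h c \<in> S_omega \<omega>" "T (?h c) = c" if "c \<in> ?M" for c
    using that by (simp_all add: inv_into_into f_inv_into_f)
  have hT: "?h (T f) = f" if "f \<in> S_omega \<omega>" for f using inj that by simp
  have hdiff: "?h (\<lambda>x. c x - d x) = (\<lambda>y. ?h c y - ?h d y)" if "c \<in> ?M" "d \<in> ?M" for c d
  proof -
    have "T (\<lambda>y. ?h c y - ?h d y) = (\<lambda>x. c x - d x)" using Tdiff h that by simp
    then show ?thesis using hT[OF S_omega_diff[OF h(1)[OF that(1)] h(1)[OF that(2)]]] by simp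
  qed
  have Mdiff: "(\<lambda>x. c x - d x) \<in> ?M" if "c \<in> ?M" "d \<in> ?M" for c d
    using that by (auto simp flip: Tdiff intro!: imageI S_omega_diff)
  have "continuous_map (subtopology (S_topology \<omega>) (S_omega \<omega>)) (Lambda_topology \<omega> \<Lambda>) T"
    unfolding S_topology_def Lambda_topology_def
  proof (rule continuous_map_seminorm_topology)
    show "\<exists>q\<in>S_seminorms \<omega>. \<exists>q'\<in>S_seminorms \<omega>. \<exists>C\<ge>0. \<forall>c\<in>S_omega \<omega>. p (T c) \<le> C * (q c + q' c)"
      if "p \<in> range (Lambda_norm \<omega> \<Lambda>)" for p
      using that Lambda_norm_analysis_bound[OF w ne] unfolding T_def by blast
  qed (use M in \<open>auto intro: S_omega_diff Lambda_omega_diff Tdiff Lambda_norm_add[OF ne] S_seminorms_zero\<close>)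
  then have c1: "continuous_map (S_topology \<omega>) ?Y T"
    using subtopology_topspace[of "S_topology \<omega> :: (real^'d \<Rightarrow> complex) topology"]
    by (simp add: topspace_S_topology continuous_map_in_subtopology image_subset_iff)
  have c2: "continuous_map ?Y (S_topology \<omega>) ?h"
    unfolding S_topology_def Lambda_topology_def
  proof (rule continuous_map_seminorm_topology)
    have "S_seminorm \<omega> 1 (\<lambda>_. 0) \<in> (S_seminorms \<omega> :: ((real^'d \<Rightarrow> complex) \<Rightarrow> real) set)" unfolding S_seminorms_def using zero_less_one by blast
    then show "(S_seminorms \<omega> :: ((real^'d \<Rightarrow> complex) \<Rightarrow> real) set) \<noteq> {}" by blast
    show "\<exists>q\<in>range (Lambda_norm \<omega> \<Lambda>). \<exists>q'\<in>range (Lambda_norm \<omega> \<Lambda>). \<exists>C\<ge>0. \<forall>c\<in>?M. p (?h c) \<le> C * (q c + q' c)"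
      if p: "p \<in> S_seminorms \<omega>" for p
    proof -
      obtain C k where C: "C \<ge> 0" "\<forall>f\<in>S_omega \<omega>. p f \<le> C * Lambda_norm \<omega> \<Lambda> k (T f)" using bnd[OF p] by blast
      have "p (?h c) \<le> C / 2 * (Lambda_norm \<omega> \<Lambda> k c + Lambda_norm \<omega> \<Lambda> k c)" if "c \<in> ?M" for c
        using C(2) h[OF that] by force
      then show ?thesis using C(1) by (intro bexI[of _ "Lambda_norm \<omega> \<Lambda> k"] exI[of _ "C / 2"] conjI ballI) auto
    qed
  qed (use M Mdiff hdiff h in \<open>auto intro: S_omega_diff S_seminorms_add simp: Lambda_norm_zero[OF ne]\<close>)
  have "homeomorphic_maps (S_topology \<omega>) ?Y T ?h"
    unfolding homeomorphic_maps_def using c1 c2 hT h(2) by (simp add: topspace_S_topology topY)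
  then have "homeomorphic_map (S_topology \<omega>) ?Y T" by (rule homeomorphic_maps_imp_map)
  then show "topological_isomorphism (S_topology \<omega>) ?Y T"
    unfolding topological_isomorphism_def topspace_S_topology topY using S0 M0 lin by blast
qed

theorem mainTheorem3:
  fixes \<omega> :: "real \<Rightarrow> real" and \<alpha>\<^sub>0 \<beta>\<^sub>0 :: real
    and \<Lambda> :: "((real^'d::finite) \<times> (real^'d)) set"
  assumes "weight_function \<omega>"
    and "\<alpha>\<^sub>0 > 0" and "\<beta>\<^sub>0 > 0"
    and "\<Lambda> = gabor_lattice \<alpha>\<^sub>0 \<beta>\<^sub>0"
    and "gabor_frame gaussian \<Lambda>"
  shows "analysis_operator gaussian \<Lambda> ` S_omega \<omega> \<subseteq> Lambda_omega \<omega> \<Lambda> \<and>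
    topological_isomorphism (S_topology \<omega>)
      (subtopology (Lambda_topology \<omega> \<Lambda>) (analysis_operator gaussian \<Lambda> ` S_omega \<omega>))
      (analysis_operator gaussian \<Lambda>) \<and>
    (\<exists>M T. complex_subspace M \<and> M \<subseteq> Lambda_omega \<omega> \<Lambda> \<and>
      topological_isomorphism (S_topology \<omega> :: (real^'d \<Rightarrow> complex) topology)
        (subtopology (Lambda_topology \<omega> \<Lambda>) M) T)"
proof -
  have r: "min \<alpha>\<^sub>0 \<beta>\<^sub>0 > 0" using assms(2,3) by simp
  have "(\<alpha>\<^sub>0 *\<^sub>R 0, \<beta>\<^sub>0 *\<^sub>R 0) \<in> \<Lambda>" unfolding assms(4) gabor_lattice_def by force
  then have ne: "\<Lambda> \<noteq> {}" by blast
  have sep: "dist x y \<ge> min \<alpha>\<^sub>0 \<beta>\<^sub>0" if "x \<in> \<Lambda>" "y \<in> \<Lambda>" "x \<noteq> y" for x y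
    using that gabor_lattice_separated[OF assms(2,3)] unfolding assms(4) by blast
  note iso = analysis_operator_isomorphism[OF assms(1) r ne sep assms(5)]
  show ?thesis using iso by blast
qed

end
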